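(* Assume the abstract phase-space setting satisfies (A1) and (A2). Let $\{T_\gamma:\gamma\in\Gamma\}$ be a well-spread family of operators and suppose the operator $\sum_{\gamma}T_\gamma:S_E\to S_E$ is invertible. Then $$\|f\|_E\approx\big\|\big(\|T_\gamma f\|_{L^2(\mathcal G)}\big)_{\gamma\in\Gamma}\big\|_{E_d(\Gamma)},\qquad f\in S_E,$$ i.e. there are constants $0<c\le C<\infty$ with $c\|f\|_E\le\|(\|T_\gamma f\|_{L^2})_\gamma\|_{E_d}\le C\|f\|_E$ for all $f\in S_E$.
   Context: $\mathcal G$ is a locally compact, $\sigma$-compact group with left Haar measure $dy$ and modular function $\Delta$; $L_xf(y)=f(x^{-1}y)$, $R_xf(y)=f(yx)$; convolution $(f*g)(x)=\int f(y)g(y^{-1}x)dy$; $L^p_m$ denotes weighted $L^p$ with norm $\|fm\|_p$. A solid translation invariant BF space is a Banach space $E$ of functions on $\mathcal G$, continuously embedded in $L^1_{loc}$, solid ($|g|\le|f|$ a.e., $f\in E$ implies $g\in E$, $\|g\|_E\le\|f\|_E$), invariant under $L_x,R_x$, with $L^1_u*E\subseteq E$, $E*L^1_v\subseteq E$ where $u(x)=\|L_x\|_{E\to E}$, $v(x)=\Delta(x^{-1})\|R_{x^{-1}}\|_{E\to E}$. An admissible weight for $E$ is $w:\mathcal G\to(0,\infty)$ with $w(x)=\Delta(x^{-1})w(x^{-1})$, $w(xy)\le w(x)w(y)$, $w(x)\ge C\max\{u(x),u(x^{-1}),v(x),\Delta(x^{-1})v(x^{-1})\}$. With $V$ a fixed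 symmetric relatively compact neighbourhood of the identity, $f^\#(x)=\operatorname{ess\,sup}_{y\in V}|f(xy)|$, $f_\#(x)=\operatorname{ess\,sup}_{y\in V}|f(yx)|$, $W(L^\infty,L^1_w)=\{f:f^\#\in L^1_w\}$, $W_R(L^\infty,L^1_w)=\{f:f_\#\in L^1_w\}$, and $W(L^1,L^\infty_{1/w})$ is the space of locally integrable $f$ with $x\mapsto\int_{xV}|f|$ in $L^\infty_{1/w}$. (A1) $E$ is a solid translation invariant BF space, $w$ an admissible weight for $E$, $S_E$ a closed complemented subspace of $E$ of continuous functions. (A2) $P:W(L^1,L^\infty_{1/w})\to L^\infty_{1/w}$ bounded linear, $P(E)=S_E$, $Pf=f$ on $S_E$, and a non-negative $K\in W(L^\infty,L^1_w)\cap W_R(L^\infty,L^1_w)$ with $|Pf(x)|\le\int|f(y)|K(y^{-1}x)dy$. A set $\Gamma\subseteq\mathcal G$ is relatively separated if $\sup_{x\in\mathcal G}\#(\Gamma\cap xV)<\infty$. For such $\Gamma$, $E_d(\Gamma)=\{c\in\mathbb C^\Gamma:\sum_\gamma|c_\gamma|1_{\gamma V}\in E\}$ with norm $\|c\|_{E_d}=\|\sum_\gamma|c_\gamma|1_{\gamma V}\|_E$. A family of operators $\{T_\gamma:S_E\to S_E:\gamma\in\Gamma\}$ is well-spread if there are a relatively separated $\Gamma$ and non-negative $\Theta\in W(L^\infty,L^1_w)\cap W_R(L^\infty,L^1_w)$, $g\in W_R(L^\infty,L^1_w)$ with $|T_\gamma f(x)|\le\int_{\mathcal G}g(\gamma^{-1}y)|f(y)|\Theta(y^{-1}x)\,dy$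 for all $f\in S_E$, $\gamma\in\Gamma$, $x\in\mathcal G$. *)

theory Defs
  imports "HOL-Probability.Probability"
begin

text \<open>The group G is a type 'g with a (not necessarily commutative) group structure written
additively: x + y is the group product xy, - x is the inverse, 0 is the identity.
So L_x f(y) = f(x^-1 y) becomes f(- x + y), and y^-1 x becomes - y + x.\<close>

definition lc_sigma_compact :: "'g::{topological_group_add,t2_space} itself \<Rightarrow> bool" where
  "lc_sigma_compact _ \<longleftrightarrow>
     (\<forall>x::'g. \<exists>U K. open U \<and> compact K \<and> x \<in> U \<and> U \<subseteq> K) \<and>
     (\<exists>K::nat \<Rightarrow> 'g set. (\<forall>n. compact (K n)) \<and> (\<Union>n. K n) = UNIV)"

definition left_haar :: "'g::{topological_group_add,t2_space} measure \<Rightarrow> bool" where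
  "left_haar \<mu> \<longleftrightarrow>
     sets \<mu> = sets borel \<and>
     (\<forall>x. \<forall>A\<in>sets borel. emeasure \<mu> ((\<lambda>y. x + y) ` A) = emeasure \<mu> A) \<and>
     (\<forall>K. compact K \<longrightarrow> emeasure \<mu> K < \<infinity>) \<and>
     (\<forall>U. open U \<and> U \<noteq> {} \<longrightarrow> emeasure \<mu> U > 0) \<and>
     (\<forall>A\<in>sets borel. emeasure \<mu> A = (INF U\<in>{U. open U \<and> A \<subseteq> U}. emeasure \<mu> U)) \<and>
     (\<forall>U. open U \<longrightarrow> emeasure \<mu> U = (SUP K\<in>{K. compact K \<and> K \<subseteq> U}. emeasure \<mu> K))"

definition modular_function :: "'g::{topological_group_add,t2_space} measure \<Rightarrow> ('g \<Rightarrow> real) \<Rightarrow> bool" where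
  "modular_function \<mu> \<Delta> \<longleftrightarrow>
     (\<forall>x. \<Delta> x > 0 \<and>
        (\<forall>A\<in>sets borel. emeasure \<mu> ((\<lambda>y. y + x) ` A) = ennreal (\<Delta> x) * emeasure \<mu> A))"

definition Ltr :: "'g::group_add \<Rightarrow> ('g \<Rightarrow> 'b) \<Rightarrow> 'g \<Rightarrow> 'b" where
  "Ltr x f = (\<lambda>y. f (- x + y))"

definition Rtr :: "'g::group_add \<Rightarrow> ('g \<Rightarrow> 'b) \<Rightarrow> 'g \<Rightarrow> 'b" where
  "Rtr x f = (\<lambda>y. f (y + x))"

definition conv :: "'g::group_add measure \<Rightarrow> ('g \<Rightarrow> complex) \<Rightarrow> ('g \<Rightarrow> complex) \<Rightarrow> 'g \<Rightarrow> complex" where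
  "conv \<mu> f g = (\<lambda>x. \<integral>y. f y * g (- y + x) \<partial>\<mu>)"

definition conv_defined :: "'g::group_add measure \<Rightarrow> ('g \<Rightarrow> complex) \<Rightarrow> ('g \<Rightarrow> complex) \<Rightarrow> bool" where
  "conv_defined \<mu> f g \<longleftrightarrow> (AE x in \<mu>. integrable \<mu> (\<lambda>y. f y * g (- y + x)))"

definition ae_eq :: "'a measure \<Rightarrow> ('a \<Rightarrow> 'b) \<Rightarrow> ('a \<Rightarrow> 'b) \<Rightarrow> bool" where
  "ae_eq \<mu> f g \<longleftrightarrow> (AE x in \<mu>. f x = g x)"

definition is_subspace :: "('a \<Rightarrow> complex) set \<Rightarrow> bool" where
  "is_subspace X \<longleftrightarrow> (\<lambda>x. 0) \<in> X \<and> (\<forall>f\<in>X. \<forall>g\<in>X. (\<lambda>x. f x + g x) \<in> X) \<and>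
     (\<forall>c. \<forall>f\<in>X. (\<lambda>x. c * f x) \<in> X)"

text \<open>A Banach space of (a.e.-classes of) measurable functions, given by a set E of
representatives and a norm nE, continuously embedded in L^1_loc.\<close>
definition BF_space :: "'g::{topological_group_add,t2_space} measure \<Rightarrow> ('g \<Rightarrow> complex) set \<Rightarrow> (('g \<Rightarrow> complex) \<Rightarrow> real) \<Rightarrow> bool" where
  "BF_space \<mu> E nE \<longleftrightarrow>
     E \<subseteq> borel_measurable \<mu> \<and> is_subspace E \<and>
     (\<forall>f\<in>E. nE f \<ge> 0 \<and> (nE f = 0 \<longleftrightarrow> ae_eq \<mu> f (\<lambda>x. 0))) \<and>
     (\<forall>f\<in>E. \<forall>g\<in>E. nE (\<lambda>x. f x + g x) \<le> nE f + nE g) \<and>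
     (\<forall>c. \<forall>f\<in>E. nE (\<lambda>x. c * f x) = cmod c * nE f) \<and>
     (\<forall>F::nat \<Rightarrow> 'g \<Rightarrow> complex. (\<forall>n. F n \<in> E) \<and>
        (\<forall>\<epsilon>>0. \<exists>N. \<forall>m\<ge>N. \<forall>n\<ge>N. nE (\<lambda>x. F m x - F n x) < \<epsilon>) \<longrightarrow>
        (\<exists>f\<in>E. (\<lambda>n. nE (\<lambda>x. F n x - f x)) \<longlonglongrightarrow> 0)) \<and>
     (\<forall>K. compact K \<longrightarrow> (\<exists>C. \<forall>f\<in>E. set_integrable \<mu> K f \<and>
        (LINT x:K|\<mu>. cmod (f x)) \<le> C * nE f))"

definition solid :: "'g::{topological_group_add,t2_space} measure \<Rightarrow> ('g \<Rightarrow> complex) set \<Rightarrow> (('g \<Rightarrow> complex) \<Rightarrow> real) \<Rightarrow> bool" where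
  "solid \<mu> E nE \<longleftrightarrow> (\<forall>f\<in>E. \<forall>g. g \<in> borel_measurable \<mu> \<and> (AE x in \<mu>. cmod (g x) \<le> cmod (f x))
       \<longrightarrow> g \<in> E \<and> nE g \<le> nE f)"

definition opnorm :: "('a \<Rightarrow> complex) set \<Rightarrow> (('a \<Rightarrow> complex) \<Rightarrow> real) \<Rightarrow> (('a \<Rightarrow> complex) \<Rightarrow> ('a \<Rightarrow> complex)) \<Rightarrow> real" where
  "opnorm E nE T = Sup {nE (T f) | f. f \<in> E \<and> nE f \<le> 1}"

definition uE :: "('g::group_add \<Rightarrow> complex) set \<Rightarrow> (('g \<Rightarrow> complex) \<Rightarrow> real) \<Rightarrow> 'g \<Rightarrow> real" where
  "uE E nE x = opnorm E nE (Ltr x)"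

definition vE :: "('g::group_add \<Rightarrow> real) \<Rightarrow> ('g \<Rightarrow> complex) set \<Rightarrow> (('g \<Rightarrow> complex) \<Rightarrow> real) \<Rightarrow> 'g \<Rightarrow> real" where
  "vE \<Delta> E nE x = \<Delta> (- x) * opnorm E nE (Rtr (- x))"

definition translation_invariant :: "('g::group_add \<Rightarrow> complex) set \<Rightarrow> (('g \<Rightarrow> complex) \<Rightarrow> real) \<Rightarrow> bool" where
  "translation_invariant E nE \<longleftrightarrow>
     (\<forall>x. \<forall>f\<in>E. Ltr x f \<in> E \<and> Rtr x f \<in> E) \<and>
     (\<forall>x. \<exists>B. \<forall>f\<in>E. nE (Ltr x f) \<le> B * nE f \<and> nE (Rtr x f) \<le> B * nE f)"

definition solid_TI_BF_space :: "'g::{topological_group_add,t2_space} measure \<Rightarrow> ('g \<Rightarrow> real) \<Rightarrow> ('g \<Rightarrow> complex) set \<Rightarrow> (('g \<Rightarrow> complex) \<Rightarrow> real) \<Rightarrow> bool" where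
  "solid_TI_BF_space \<mu> \<Delta> E nE \<longleftrightarrow>
     BF_space \<mu> E nE \<and> solid \<mu> E nE \<and> translation_invariant E nE \<and>
     (\<forall>h f. h \<in> borel_measurable \<mu> \<and> (\<integral>\<^sup>+ y. ennreal (cmod (h y) * uE E nE y) \<partial>\<mu>) < \<infinity> \<and> f \<in> E
        \<longrightarrow> conv_defined \<mu> h f \<and> conv \<mu> h f \<in> E) \<and>
     (\<forall>h f. h \<in> borel_measurable \<mu> \<and> (\<integral>\<^sup>+ y. ennreal (cmod (h y) * vE \<Delta> E nE y) \<partial>\<mu>) < \<infinity> \<and> f \<in> E
        \<longrightarrow> conv_defined \<mu> f h \<and> conv \<mu> f h \<in> E)"

definition admissible_weight :: "('g::group_add \<Rightarrow> real) \<Rightarrow> ('g \<Rightarrow> complex) set \<Rightarrow> (('g \<Rightarrow> complex) \<Rightarrow> real) \<Rightarrow> ('g \<Rightarrow> real) \<Rightarrow> bool" where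
  "admissible_weight \<Delta> E nE w \<longleftrightarrow>
     (\<forall>x. w x > 0) \<and> (\<forall>x. w x = \<Delta> (- x) * w (- x)) \<and> (\<forall>x y. w (x + y) \<le> w x * w y) \<and>
     (\<exists>C>0. \<forall>x. w x \<ge> C * max (max (uE E nE x) (uE E nE (- x)))
                              (max (vE \<Delta> E nE x) (\<Delta> (- x) * vE \<Delta> E nE (- x))))"

definition good_nbhd :: "'g::{topological_group_add,t2_space} set \<Rightarrow> bool" where
  "good_nbhd V \<longleftrightarrow> V \<in> sets borel \<and> uminus ` V = V \<and> compact (closure V) \<and> 0 \<in> interior V"

definition sharpL :: "'g::group_add measure \<Rightarrow> 'g set \<Rightarrow> ('g \<Rightarrow> 'b::real_normed_vector) \<Rightarrow> 'g \<Rightarrow> ennreal" where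
  "sharpL \<mu> V f x = e2ennreal (esssup (restrict_space \<mu> V) (\<lambda>y. ereal (norm (f (x + y)))))"

definition sharpR :: "'g::group_add measure \<Rightarrow> 'g set \<Rightarrow> ('g \<Rightarrow> 'b::real_normed_vector) \<Rightarrow> 'g \<Rightarrow> ennreal" where
  "sharpR \<mu> V f x = e2ennreal (esssup (restrict_space \<mu> V) (\<lambda>y. ereal (norm (f (y + x)))))"

definition W_Linf_L1 :: "'g::{topological_group_add,t2_space} measure \<Rightarrow> 'g set \<Rightarrow> ('g \<Rightarrow> real) \<Rightarrow> ('g \<Rightarrow> 'b::real_normed_vector) set" where
  "W_Linf_L1 \<mu> V w = {f. f \<in> borel_measurable \<mu> \<and> (\<integral>\<^sup>+ x. sharpL \<mu> V f x * ennreal (w x) \<partial>\<mu>) < \<infinity>}"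

definition WR_Linf_L1 :: "'g::{topological_group_add,t2_space} measure \<Rightarrow> 'g set \<Rightarrow> ('g \<Rightarrow> real) \<Rightarrow> ('g \<Rightarrow> 'b::real_normed_vector) set" where
  "WR_Linf_L1 \<mu> V w = {f. f \<in> borel_measurable \<mu> \<and> (\<integral>\<^sup>+ x. sharpR \<mu> V f x * ennreal (w x) \<partial>\<mu>) < \<infinity>}"

definition local_L1 :: "'g::group_add measure \<Rightarrow> 'g set \<Rightarrow> ('g \<Rightarrow> complex) \<Rightarrow> 'g \<Rightarrow> ennreal" where
  "local_L1 \<mu> V f x = (\<integral>\<^sup>+ y. indicator ((\<lambda>v. x + v) ` V) y * ennreal (cmod (f y)) \<partial>\<mu>)"

definition W_L1_Linf_norm :: "'g::group_add measure \<Rightarrow> 'g set \<Rightarrow> ('g \<Rightarrow> real) \<Rightarrow> ('g \<Rightarrow> complex) \<Rightarrow> ennreal" where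
  "W_L1_Linf_norm \<mu> V w f = (SUP x. local_L1 \<mu> V f x / ennreal (w x))"

definition W_L1_Linf :: "'g::{topological_group_add,t2_space} measure \<Rightarrow> 'g set \<Rightarrow> ('g \<Rightarrow> real) \<Rightarrow> ('g \<Rightarrow> complex) set" where
  "W_L1_Linf \<mu> V w = {f. f \<in> borel_measurable \<mu> \<and> (\<forall>K. compact K \<longrightarrow> set_integrable \<mu> K f) \<and>
                        W_L1_Linf_norm \<mu> V w f < \<infinity>}"

definition Linf_inv_norm :: "'g measure \<Rightarrow> ('g \<Rightarrow> real) \<Rightarrow> ('g \<Rightarrow> complex) \<Rightarrow> ereal" where
  "Linf_inv_norm \<mu> w h = esssup \<mu> (\<lambda>x. ereal (cmod (h x) / w x))"

definition closed_mod_ae :: "'g measure \<Rightarrow> ('g \<Rightarrow> complex) set \<Rightarrow> (('g \<Rightarrow> complex) \<Rightarrow> real) \<Rightarrow> ('g \<Rightarrow> complex) set \<Rightarrow> bool" where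
  "closed_mod_ae \<mu> E nE X \<longleftrightarrow> (\<forall>F f. (\<forall>n. F n \<in> X) \<and> f \<in> E \<and> (\<lambda>n. nE (\<lambda>x. F n x - f x)) \<longlonglongrightarrow> 0
       \<longrightarrow> (\<exists>g\<in>X. ae_eq \<mu> f g))"

definition A1 :: "'g::{topological_group_add,t2_space} measure \<Rightarrow> ('g \<Rightarrow> real) \<Rightarrow> ('g \<Rightarrow> complex) set \<Rightarrow> (('g \<Rightarrow> complex) \<Rightarrow> real) \<Rightarrow> ('g \<Rightarrow> real) \<Rightarrow> ('g \<Rightarrow> complex) set \<Rightarrow> bool" where
  "A1 \<mu> \<Delta> E nE w S \<longleftrightarrow>
     solid_TI_BF_space \<mu> \<Delta> E nE \<and> admissible_weight \<Delta> E nE w \<and> w \<in> borel_measurable borel \<and>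
     S \<subseteq> E \<and> is_subspace S \<and> (\<forall>s\<in>S. continuous_on UNIV s) \<and> closed_mod_ae \<mu> E nE S \<and>
     (\<exists>M. M \<subseteq> E \<and> is_subspace M \<and> closed_mod_ae \<mu> E nE M \<and>
        (\<forall>f\<in>E. \<exists>s\<in>S. \<exists>m\<in>M. ae_eq \<mu> f (\<lambda>x. s x + m x)) \<and>
        (\<forall>s\<in>S. \<forall>m\<in>M. ae_eq \<mu> (\<lambda>x. s x + m x) (\<lambda>x. 0) \<longrightarrow> ae_eq \<mu> s (\<lambda>x. 0)))"

definition A2 :: "'g::{topological_group_add,t2_space} measure \<Rightarrow> 'g set \<Rightarrow> ('g \<Rightarrow> real) \<Rightarrow> ('g \<Rightarrow> complex) set \<Rightarrow> ('g \<Rightarrow> complex) set \<Rightarrow> (('g \<Rightarrow> complex) \<Rightarrow> ('g \<Rightarrow> complex)) \<Rightarrow> ('g \<Rightarrow> real) \<Rightarrow> bool" where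
  "A2 \<mu> V w E S P K \<longleftrightarrow>
     (let D = W_L1_Linf \<mu> V w in
       (\<forall>f\<in>D. \<forall>g\<in>D. P (\<lambda>x. f x + g x) = (\<lambda>x. P f x + P g x)) \<and>
       (\<forall>c. \<forall>f\<in>D. P (\<lambda>x. c * f x) = (\<lambda>x. c * P f x)) \<and>
       (\<forall>f\<in>D. \<forall>g\<in>D. ae_eq \<mu> f g \<longrightarrow> P f = P g) \<and>
       (\<exists>B. \<forall>f\<in>D. P f \<in> borel_measurable \<mu> \<and>
            Linf_inv_norm \<mu> w (P f) \<le> ereal B * ereal (enn2real (W_L1_Linf_norm \<mu> V w f))) \<and>
       P ` E = S \<and> (\<forall>s\<in>S. P s = s) \<and>
       (\<forall>x. K x \<ge> 0) \<and> K \<in> W_Linf_L1 \<mu> V w \<and> K \<in> WR_Linf_L1 \<mu> V w \<and>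
       (\<forall>f\<in>D \<union> E. \<forall>x. ennreal (cmod (P f x)) \<le> (\<integral>\<^sup>+ y. ennreal (cmod (f y) * K (- y + x)) \<partial>\<mu>)))"

definition rel_separated :: "'g::group_add set \<Rightarrow> 'g set \<Rightarrow> bool" where
  "rel_separated V \<Gamma> \<longleftrightarrow> (\<exists>N::nat. \<forall>x. finite (\<Gamma> \<inter> (\<lambda>v. x + v) ` V) \<and> card (\<Gamma> \<inter> (\<lambda>v. x + v) ` V) \<le> N)"

definition well_spread :: "'g::{topological_group_add,t2_space} measure \<Rightarrow> 'g set \<Rightarrow> ('g \<Rightarrow> real) \<Rightarrow> ('g \<Rightarrow> complex) set \<Rightarrow> 'g set \<Rightarrow> ('g \<Rightarrow> ('g \<Rightarrow> complex) \<Rightarrow> ('g \<Rightarrow> complex)) \<Rightarrow> bool" where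
  "well_spread \<mu> V w S \<Gamma> T \<longleftrightarrow>
     (\<forall>\<gamma>\<in>\<Gamma>. (\<forall>f\<in>S. T \<gamma> f \<in> S) \<and>
        (\<forall>f\<in>S. \<forall>g\<in>S. T \<gamma> (\<lambda>x. f x + g x) = (\<lambda>x. T \<gamma> f x + T \<gamma> g x)) \<and>
        (\<forall>c. \<forall>f\<in>S. T \<gamma> (\<lambda>x. c * f x) = (\<lambda>x. c * T \<gamma> f x))) \<and>
     rel_separated V \<Gamma> \<and>
     (\<exists>\<Theta> g. (\<forall>x. \<Theta> x \<ge> 0) \<and> \<Theta> \<in> W_Linf_L1 \<mu> V w \<and> \<Theta> \<in> WR_Linf_L1 \<mu> V w \<and>
        (g::'g \<Rightarrow> complex) \<in> WR_Linf_L1 \<mu> V w \<and>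
        (\<forall>\<gamma>\<in>\<Gamma>. \<forall>f\<in>S. \<forall>x. ennreal (cmod (T \<gamma> f x)) \<le>
            (\<integral>\<^sup>+ y. ennreal (cmod (g (- \<gamma> + y)) * cmod (f y) * \<Theta> (- y + x)) \<partial>\<mu>)))"

text \<open>The function \<Sum>_\<gamma> |c_\<gamma>| 1_{\<gamma>V}, whose E-norm is the E_d(\<Gamma>)-norm of c.\<close>
definition Ed_fun :: "'g::group_add set \<Rightarrow> 'g set \<Rightarrow> ('g \<Rightarrow> real) \<Rightarrow> 'g \<Rightarrow> complex" where
  "Ed_fun V \<Gamma> c = (\<lambda>x. complex_of_real (\<Sum>\<gamma>\<in>{\<gamma>\<in>\<Gamma>. x \<in> (\<lambda>v. \<gamma> + v) ` V}. \<bar>c \<gamma>\<bar>))"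

definition L2_sq :: "'g measure \<Rightarrow> ('g \<Rightarrow> complex) \<Rightarrow> ennreal" where
  "L2_sq \<mu> h = (\<integral>\<^sup>+ x. ennreal ((cmod (h x))\<^sup>2) \<partial>\<mu>)"

definition L2_norm :: "'g measure \<Rightarrow> ('g \<Rightarrow> complex) \<Rightarrow> real" where
  "L2_norm \<mu> h = sqrt (enn2real (L2_sq \<mu> h))"

definition sum_ops :: "'g set \<Rightarrow> ('g \<Rightarrow> ('g \<Rightarrow> complex) \<Rightarrow> ('g \<Rightarrow> complex)) \<Rightarrow> ('g \<Rightarrow> complex) \<Rightarrow> 'g \<Rightarrow> complex" where
  "sum_ops \<Gamma> T f = (\<lambda>x. \<Sum>\<^sub>\<infinity>\<gamma>\<in>\<Gamma>. T \<gamma> f x)"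

end

theory Submission
  imports Defs
begin

text \<open>
  A kernel in \<open>W\<^sub>R(L\<^sup>\<infinity>, L\<^sup>1\<^sub>w)\<close> agrees almost everywhere with one whose pointwise supremum over translates of
  an open neighbourhood (its envelope) is lower semicontinuous and lies in \<open>L\<^sup>1\<^sub>w\<close>. Together with the
  boundedness of convolution by \<open>L\<^sup>1\<^sub>w\<close> on \<open>E\<close> this gives the upper estimate, since
  \<open>\<parallel>T \<gamma> f\<parallel>\<^sub>2\<close> is at most a multiple of \<open>\<integral> g(-\<gamma> + y) |f y| dy\<close>, which for \<open>x \<in> \<gamma> + V\<close> is bounded by the
  convolution at \<open>x\<close> of \<open>|f|\<close> with the reflected envelope of \<open>g\<close>.

  For the lower estimate, the inverse of the sum of the \<open>T \<gamma>\<close> is bounded by the open mapping theorem. Since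
  \<open>P\<close> reproduces each \<open>T \<gamma> f\<close>, the sum is dominated by \<open>(\<Sum> |T \<gamma> f|) * K\<close>. Splitting \<open>T \<gamma> f\<close> at a large
  compact neighbourhood \<open>\<gamma> + U\<close>, the outer part has norm at most \<open>\<epsilon> \<parallel>f\<parallel>\<close> and is absorbed, and the
  inner part is bounded by the \<open>L\<^sup>2\<close> norms of the \<open>T \<gamma> f\<close> convolved with an envelope of \<open>K\<close>.

  The group need not be second countable, so no Fubini theorem for Borel functions of \<open>-y + x\<close> is
  at hand; all interchanges are between an integral and a countable sum.
\<close>

section \<open>Topological groups and Haar measure\<close>

text \<open>Three obstacles shape the details. The hypotheses on kernels concern essential suprema,
  while the estimates shift the argument \<open>- y + x\<close> of a kernel by a small amount for
  all \<open>y\<close> at once, which only a pointwise supremum permits. Changing a kernel on a null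
  set is harmless once the map from \<open>y\<close> to \<open>- y + x\<close> is known to preserve
  null sets, and this is where inversion of Haar measure enters. Next, the hypothesis on convolution
  is an inclusion of sets, so its norm bound must be extracted from completeness and solidity.
  Finally, sums over \<Gamma> and L2 norms are controlled by weighted L1 norms only through a
  positive lower bound for \<open>w\<close>. It comes from admissibility: translations by
  \<open>x\<close> and \<open>- x\<close> undo each other, so one of their norms is at least 1
  unless every norm on \<open>E\<close> vanishes, a case treated separately. Integrals are exchanged
  or compared on pieces of small diameter: the variable is replaced by a base point of its piece,
  and a larger neighbourhood in the envelope absorbs the error.\<close>

abbreviation ltr :: "'g::plus \<Rightarrow> 'g set \<Rightarrow> 'g set" where
  "ltr a A \<equiv> (\<lambda>x. a + x) ` A"

abbreviation rtr :: "'g::plus \<Rightarrow> 'g set \<Rightarrow> 'g set" where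
  "rtr a A \<equiv> (\<lambda>x. x + a) ` A"

lemma continuous_on_add_left:
  fixes a :: "'g::topological_group_add"
  shows "continuous_on UNIV (\<lambda>x. a + x)"
  by (intro continuous_intros)

lemma continuous_on_add_right:
  fixes a :: "'g::topological_group_add"
  shows "continuous_on UNIV (\<lambda>x. x + a)"
  by (intro continuous_intros)

lemma continuous_on_uminus:
  "continuous_on UNIV (uminus :: 'g::topological_group_add \<Rightarrow> 'g)"
  by (intro continuous_intros)

lemma measurable_add_left [measurable]:
  "(\<lambda>x. a + x) \<in> borel \<rightarrow>\<^sub>M (borel :: 'g::topological_group_add measure)"
  by (rule borel_measurable_continuous_onI[OF continuous_on_add_left])

lemma measurable_add_right [measurable]:
  "(\<lambda>x. x + a) \<in> borel \<rightarrow>\<^sub>M (borel :: 'g::topological_group_add measure)"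
  by (rule borel_measurable_continuous_onI[OF continuous_on_add_right])

lemma measurable_uminus_group [measurable]:
  "uminus \<in> borel \<rightarrow>\<^sub>M (borel :: 'g::topological_group_add measure)"
  by (rule borel_measurable_continuous_onI[OF continuous_on_uminus])

lemma image_add_left_eq_vimage:
  fixes a :: "'g::group_add"
  shows "ltr a A = (\<lambda>x. - a + x) -` A"
proof safe
  fix x assume "- a + x \<in> A"
  then show "x \<in> ltr a A"
    by (intro image_eqI[of _ _ "- a + x"]) (auto simp: add.assoc[symmetric])
qed (auto simp: add.assoc[symmetric])

lemma image_add_right_eq_vimage:
  fixes a :: "'g::group_add"
  shows "rtr a A = (\<lambda>x. x - a) -` A"
proof safe
  fix x assume "x - a \<in> A"
  then show "x \<in> rtr a A"
    by (intro image_eqI[of _ _ "x - a"]) auto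
qed auto

lemma image_uminus_eq_vimage:
  "uminus ` A = uminus -` (A :: 'g::group_add set)"
  by force

lemma sets_add_left [measurable]:
  "A \<in> sets borel \<Longrightarrow> ltr a A \<in> sets (borel :: 'g::topological_group_add measure)"
  unfolding image_add_left_eq_vimage using measurable_sets[OF measurable_add_left, of A "- a"] by simp

lemma sets_add_right [measurable]:
  "A \<in> sets borel \<Longrightarrow> rtr a A \<in> sets (borel :: 'g::topological_group_add measure)"
  unfolding image_add_right_eq_vimage using measurable_sets[OF measurable_add_right, of A "- a"] by simp

lemma sets_uminus [measurable]:
  "A \<in> sets borel \<Longrightarrow> uminus ` A \<in> sets (borel :: 'g::topological_group_add measure)"
  unfolding image_uminus_eq_vimage using measurable_sets[OF measurable_uminus_group, of A] by simp

lemma open_add_left: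
  "open A \<Longrightarrow> open (ltr a (A :: 'g::topological_group_add set))"
  unfolding image_add_left_eq_vimage by (rule open_vimage[OF _ continuous_on_add_left])

lemma open_add_right:
  "open A \<Longrightarrow> open (rtr a (A :: 'g::topological_group_add set))"
  unfolding image_add_right_eq_vimage
  using open_vimage[OF _ continuous_on_add_right[of "- a"]] by simp

lemma open_uminus:
  "open A \<Longrightarrow> open (uminus ` (A :: 'g::topological_group_add set))"
  unfolding image_uminus_eq_vimage by (rule open_vimage[OF _ continuous_on_uminus])

lemma compact_add_left:
  "compact A \<Longrightarrow> compact (ltr a (A :: 'g::topological_group_add set))"
  by (intro compact_continuous_image continuous_intros)

lemma compact_add_right:
  "compact A \<Longrightarrow> compact (rtr a (A :: 'g::topological_group_add set))"
  by (intro compact_continuous_image continuous_intros)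

lemma compact_uminus:
  "compact A \<Longrightarrow> compact (uminus ` (A :: 'g::topological_group_add set))"
  by (intro compact_continuous_image continuous_intros)

section \<open>Sumsets, finite covers of compact sets, small neighbourhoods of the identity\<close>

definition group_sumset :: "'g::group_add set \<Rightarrow> 'g set \<Rightarrow> 'g set" where
  "group_sumset A B = (\<lambda>p. fst p + snd p) ` (A \<times> B)"

lemma group_sumsetI: "a \<in> A \<Longrightarrow> b \<in> B \<Longrightarrow> a + b \<in> group_sumset A B"
  by (force simp: group_sumset_def)

lemma compact_group_sumset:
  fixes A B :: "'g::topological_group_add set"
  assumes "compact A" "compact B"
  shows "compact (group_sumset A B)"
  unfolding group_sumset_def
  by (intro compact_continuous_image compact_Times assms continuous_intros)

lemma open_group_sumset:
  fixes A B :: "'g::topological_group_add set"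
  assumes "open B" shows "open (group_sumset A B)"
proof -
  have "group_sumset A B = (\<Union>a\<in>A. ltr a B)" by (force simp: group_sumset_def)
  then show ?thesis using open_add_left[OF assms] by auto
qed

lemma group_sumset_mono: "A \<subseteq> A' \<Longrightarrow> B \<subseteq> B' \<Longrightarrow> group_sumset A B \<subseteq> group_sumset A' B'"
  by (auto simp: group_sumset_def)

lemma ex_open_add_subset:
  fixes x y :: "'g::topological_group_add"
  assumes "open W" "x + y \<in> W"
  obtains A B where "open A" "x \<in> A" "open B" "y \<in> B" "\<And>a b. a \<in> A \<Longrightarrow> b \<in> B \<Longrightarrow> a + b \<in> W"
proof -
  have "continuous_on UNIV (\<lambda>p. fst p + snd p :: 'g)"
    by (intro continuous_intros)
  then have "open ((\<lambda>p. fst p + snd p) -` W)"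
    using assms(1) by (rule open_vimage[rotated])
  moreover have "(x, y) \<in> (\<lambda>p. fst p + snd p) -` W"
    using assms(2) by simp
  ultimately obtain A B where "open A" "open B" "(x, y) \<in> A \<times> B" "A \<times> B \<subseteq> (\<lambda>p. fst p + snd p) -` W"
    by (rule open_prod_elim)
  then show ?thesis
    by (intro that[of A B]) auto
qed

text \<open>The tube-lemma argument: each \<open>x\<close> in \<open>L\<close> has open sets
  \<open>A x\<close> and \<open>B x\<close> whose sums lie in \<open>W\<close>. Finitely many
  \<open>A x\<close> cover \<open>L\<close>, and the intersection of the corresponding
  \<open>B x\<close> serves all points of \<open>L\<close> at once.\<close>

lemma compact_subset_open_add:
  fixes L :: "'g::topological_group_add set"
  assumes "compact L" "open W" "L \<subseteq> W"
  obtains Q where "open Q" "0 \<in> Q" "\<And>l q. l \<in> L \<Longrightarrow> q \<in> Q \<Longrightarrow> l + q \<in> W"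
proof -
  have "\<exists>A B. open A \<and> x \<in> A \<and> open B \<and> 0 \<in> B \<and> (\<forall>a\<in>A. \<forall>b\<in>B. a + b \<in> W)" if "x \<in> L" for x
  proof -
    have "x + 0 \<in> W" using that assms by auto
    from ex_open_add_subset[OF assms(2) this] show ?thesis by metis
  qed
  then obtain A B where AB: "\<And>x. x \<in> L \<Longrightarrow> open (A x) \<and> x \<in> A x \<and> open (B x) \<and> 0 \<in> B x \<and> (\<forall>a\<in>A x. \<forall>b\<in>B x. a + b \<in> W)"
    by metis
  have "L \<subseteq> (\<Union>x\<in>L. A x)" "\<And>x. x \<in> L \<Longrightarrow> open (A x)" using AB by auto
  from compactE_image[OF assms(1) this(2) this(1)] obtain F where F: "F \<subseteq> L" "finite F" "L \<subseteq> (\<Union>x\<in>F. A x)"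
    by (metis (mono_tags, lifting))
  show ?thesis
  proof (rule that[of "\<Inter>x\<in>F. B x"])
    show "open (\<Inter>x\<in>F. B x)" using AB F by (intro open_INT) auto
    show "0 \<in> (\<Inter>x\<in>F. B x)" using AB F by auto
    show "l + q \<in> W" if "l \<in> L" "q \<in> (\<Inter>x\<in>F. B x)" for l q
      using that AB F by (metis INT_E UN_E subsetD)
  qed
qed

lemma compact_cover_translates_left:
  fixes L Q :: "'g::topological_group_add set"
  assumes "compact L" "open Q" "0 \<in> Q"
  obtains F where "finite F" "F \<subseteq> L" "L \<subseteq> (\<Union>x\<in>F. ltr x Q)"
proof -
  have "L \<subseteq> (\<Union>x\<in>L. ltr x Q)"
    using assms(3) by force
  from compactE_image[OF assms(1) _ this] show ?thesis
    using that open_add_left[OF assms(2)] by metis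
qed

lemma compact_cover_translates_right:
  fixes L Q :: "'g::topological_group_add set"
  assumes "compact L" "open Q" "0 \<in> Q"
  obtains F where "finite F" "F \<subseteq> L" "L \<subseteq> (\<Union>x\<in>F. rtr x Q)"
proof -
  have "L \<subseteq> (\<Union>x\<in>L. rtr x Q)"
    using assms(3) by force
  from compactE_image[OF assms(1) _ this] show ?thesis
    using that open_add_right[OF assms(2)] by metis
qed

lemma ex_symmetric_half_nbhd:
  fixes W :: "'g::topological_group_add set"
  assumes "open W" "0 \<in> W"
  obtains Q where "open Q" "0 \<in> Q" "uminus ` Q = Q" "\<And>a b. a \<in> Q \<Longrightarrow> b \<in> Q \<Longrightarrow> a + b \<in> W"
proof -
  have "0 + 0 \<in> W" using assms by simp
  from ex_open_add_subset[OF assms(1) this] obtain A B where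
    AB: "open A" "0 \<in> A" "open B" "0 \<in> B" "\<And>a b. a \<in> A \<Longrightarrow> b \<in> B \<Longrightarrow> a + b \<in> W" by metis
  define Q where "Q = (A \<inter> B) \<inter> uminus ` (A \<inter> B)"
  have "uminus ` Q = Q" unfolding Q_def image_uminus_eq_vimage by auto
  moreover have "0 \<in> Q" using AB by (force simp: Q_def image_uminus_eq_vimage)
  moreover have "open Q" unfolding Q_def using AB by (intro open_Int open_uminus)
  ultimately show ?thesis using AB(5) by (intro that[of Q]) (auto simp: Q_def)
qed

lemma ennreal_mult_right_cancel_fin:
  fixes a b c :: ennreal
  assumes "a * c = b * c" "0 < c" "c < \<infinity>" shows "a = b"
proof -
  have "a = a * c / c" using assms by (subst ennreal_mult_divide_eq) auto
  also have "\<dots> = b" using assms by (subst assms(1), subst ennreal_mult_divide_eq) auto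
  finally show ?thesis .
qed

section \<open>Haar measure, countable covers by translates, the modular function\<close>

locale haar_group =
  fixes \<mu> :: "'g::{topological_group_add,t2_space} measure" and \<Delta> :: "'g \<Rightarrow> real"
  assumes lc: "lc_sigma_compact TYPE('g)" and haar: "left_haar \<mu>" and modular: "modular_function \<mu> \<Delta>"
begin

lemma sets_mu [measurable_cong, simp]: "sets \<mu> = sets borel"
  by (rule haar[unfolded left_haar_def, THEN conjunct1])

lemma space_mu [simp]: "space \<mu> = UNIV"
  using sets_eq_imp_space_eq[OF sets_mu] by simp

lemma emeasure_add_left: "A \<in> sets borel \<Longrightarrow> emeasure \<mu> (ltr x A) = emeasure \<mu> A"
  using haar[unfolded left_haar_def, THEN conjunct2, THEN conjunct1] by blast

lemma emeasure_compact: "compact L \<Longrightarrow> emeasure \<mu> L < \<infinity>"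
  using haar[unfolded left_haar_def, THEN conjunct2, THEN conjunct2, THEN conjunct1] by blast

lemma emeasure_open_pos: "open U \<Longrightarrow> U \<noteq> {} \<Longrightarrow> 0 < emeasure \<mu> U"
  using haar[unfolded left_haar_def, THEN conjunct2, THEN conjunct2, THEN conjunct2, THEN conjunct1] by blast

lemma outer_regular:
  "A \<in> sets borel \<Longrightarrow> emeasure \<mu> A = (INF U\<in>{U. open U \<and> A \<subseteq> U}. emeasure \<mu> U)"
  using haar[unfolded left_haar_def, THEN conjunct2, THEN conjunct2, THEN conjunct2, THEN conjunct2, THEN conjunct1] by blast

lemma inner_regular:
  "open U \<Longrightarrow> emeasure \<mu> U = (SUP L\<in>{L. compact L \<and> L \<subseteq> U}. emeasure \<mu> L)"
  using haar[unfolded left_haar_def, THEN conjunct2, THEN conjunct2, THEN conjunct2, THEN conjunct2, THEN conjunct2] by blast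

lemma modular_pos [simp]: "0 < \<Delta> x"
  using modular by (simp add: modular_function_def)

lemma emeasure_add_right:
  "A \<in> sets borel \<Longrightarrow> emeasure \<mu> (rtr x A) = ennreal (\<Delta> x) * emeasure \<mu> A"
  using modular by (simp add: modular_function_def)

lemma borel_compact: "compact (L :: 'g set) \<Longrightarrow> L \<in> sets borel"
  by (intro borel_closed compact_imp_closed)

lemma ex_compact_nbhd:
  obtains U Z :: "'g set" where "open U" "compact Z" "0 \<in> U" "U \<subseteq> Z"
  using lc that unfolding lc_sigma_compact_def by blast

lemma ex_sigma_compact:
  obtains L :: "nat \<Rightarrow> 'g set" where "\<And>n. compact (L n)" "(\<Union>n. L n) = UNIV"
  using lc that unfolding lc_sigma_compact_def by blast

text \<open>Sigma-compactness enters here: each compact set of a countable cover needs only finitely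
  many translates. Made disjoint, such translates cut the group into countably many small pieces on
  which integrals are estimated.\<close>

lemma ex_countable_translates_left:
  assumes "open Q" "(0::'g) \<in> Q"
  obtains X where "countable X" "(\<Union>x\<in>X. ltr x Q) = UNIV"
proof -
  obtain L :: "nat \<Rightarrow> 'g set" where L: "\<And>n. compact (L n)" "(\<Union>n. L n) = UNIV" using ex_sigma_compact by blast
  have "\<exists>F. finite F \<and> L n \<subseteq> (\<Union>x\<in>F. ltr x Q)" for n
    using compact_cover_translates_left[OF L(1) assms] by metis
  then obtain F where F: "\<And>n. finite (F n)" "\<And>n. L n \<subseteq> (\<Union>x\<in>F n. ltr x Q)" by metis
  show ?thesis
  proof (rule that)
    show "countable (\<Union>n. F n)" using F(1) by (auto intro: countable_finite)
    have "(\<Union>n. L n) \<subseteq> (\<Union>n. \<Union>x\<in>F n. ltr x Q)" by (intro UN_mono F(2) subset_refl)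
    then show "(\<Union>x\<in>\<Union>n. F n. ltr x Q) = UNIV" using L(2) by auto
  qed
qed

lemma ex_sequence_translates_left:
  assumes "open Q" "(0::'g) \<in> Q"
  obtains x :: "nat \<Rightarrow> 'g" where "(\<Union>n. ltr (x n) Q) = UNIV"
proof -
  obtain X where X: "countable X" "(\<Union>x\<in>X. ltr x Q) = UNIV"
    using ex_countable_translates_left[OF assms] .
  then have "X \<noteq> {}" by auto
  then have "range (from_nat_into X) = X" using X(1) by (rule range_from_nat_into)
  moreover have "(\<Union>n. ltr (from_nat_into X n) Q) = (\<Union>x\<in>range (from_nat_into X). ltr x Q)"
    by blast
  ultimately have "(\<Union>n. ltr (from_nat_into X n) Q) = UNIV" using X(2) by simp
  then show ?thesis by (rule that)
qed

lemma ex_sequence_translates_right: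
  assumes "open Q" "(0::'g) \<in> Q"
  obtains x :: "nat \<Rightarrow> 'g" where "(\<Union>n. rtr (x n) Q) = UNIV"
proof -
  have "open (uminus ` Q)" "0 \<in> uminus ` Q" using assms open_uminus by (auto simp: image_uminus_eq_vimage)
  from ex_sequence_translates_left[OF this]
  obtain x :: "nat \<Rightarrow> 'g" where x: "(\<Union>n. (\<lambda>q. x n + q) ` uminus ` Q) = UNIV" .
  have "y \<in> (\<Union>n. rtr (- x n) Q)" for y
  proof -
    have "- y \<in> (\<Union>n. (\<lambda>q. x n + q) ` uminus ` Q)" using x by simp
    then obtain n q where "q \<in> Q" "- y = x n + - q" by blast
    then have "y = q + - x n" by (metis minus_add minus_minus)
    then show ?thesis using \<open>q \<in> Q\<close> by blast
  qed
  then show ?thesis by (intro that[of "\<lambda>n. - x n"]) auto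
qed

lemma distr_add_left: "distr \<mu> \<mu> (\<lambda>y. x + y) = \<mu>"
proof (rule measure_eqI)
  fix A assume "A \<in> sets (distr \<mu> \<mu> (\<lambda>y. x + y))"
  then have A: "A \<in> sets borel" by simp
  have "emeasure (distr \<mu> \<mu> (\<lambda>y. x + y)) A = emeasure \<mu> ((\<lambda>y. x + y) -` A)"
    using A by (subst emeasure_distr) auto
  also have "\<dots> = emeasure \<mu> A"
    using image_add_left_eq_vimage[of "- x" A] emeasure_add_left[OF A, of "- x"] by simp
  finally show "emeasure (distr \<mu> \<mu> (\<lambda>y. x + y)) A = emeasure \<mu> A" .
qed simp

lemma nn_integral_add_left:
  assumes [measurable]: "f \<in> borel_measurable borel"
  shows "(\<integral>\<^sup>+ y. f (x + y) \<partial>\<mu>) = (\<integral>\<^sup>+ y. f y \<partial>\<mu>)"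
proof -
  have "(\<integral>\<^sup>+ y. f y \<partial>\<mu>) = (\<integral>\<^sup>+ y. f y \<partial>distr \<mu> \<mu> (\<lambda>y. x + y))" by (simp add: distr_add_left)
  also have "\<dots> = (\<integral>\<^sup>+ y. f (x + y) \<partial>\<mu>)" by (subst nn_integral_distr) auto
  finally show ?thesis ..
qed

lemma nn_integral_partition:
  fixes G :: "'g \<Rightarrow> ennreal" and X :: "nat \<Rightarrow> 'g set"
  assumes "G \<in> borel_measurable borel" "\<And>n. X n \<in> sets borel" "(\<Union>n. X n) = UNIV" "disjoint_family X"
  shows "(\<integral>\<^sup>+ y. G y \<partial>\<mu>) = (\<Sum>n. \<integral>\<^sup>+ y. G y * indicator (X n) y \<partial>\<mu>)"
  using nn_integral_disjoint_family[of G \<mu> X] assms by simp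

lemma null_sets_add_left: "N \<in> null_sets \<mu> \<Longrightarrow> (\<lambda>y. x + y) -` N \<in> null_sets \<mu>"
  using image_add_left_eq_vimage[of "- x" N] emeasure_add_left[of N "- x"] sets_add_left[of N "- x"]
  by (auto simp: null_sets_def)

lemma null_sets_add_right: "N \<in> null_sets \<mu> \<Longrightarrow> (\<lambda>y. y + x) -` N \<in> null_sets \<mu>"
  using image_add_right_eq_vimage[of "- x" N] emeasure_add_right[of N "- x"] sets_add_right[of N "- x"]
  by (auto simp: null_sets_def)

lemma ex_compact_pos:
  obtains Z where "compact Z" "0 < emeasure \<mu> Z" "emeasure \<mu> Z < \<infinity>"
proof -
  obtain U Z :: "'g set" where UZ: "open U" "compact Z" "0 \<in> U" "U \<subseteq> Z" by (rule ex_compact_nbhd)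
  have "0 < emeasure \<mu> U" using UZ by (intro emeasure_open_pos) auto
  also have "\<dots> \<le> emeasure \<mu> Z" using UZ borel_compact by (intro emeasure_mono) auto
  finally show ?thesis using that[of Z] UZ emeasure_compact by auto
qed

text \<open>The right translate of \<open>Z\<close> by \<open>x + y\<close> is measured in one step
  and in two; the measure of \<open>Z\<close> is positive and finite and cancels.\<close>

lemma modular_add: "\<Delta> (x + y) = \<Delta> x * \<Delta> y"
proof -
  obtain Z where Z: "compact Z" "0 < emeasure \<mu> Z" "emeasure \<mu> Z < \<infinity>" by (rule ex_compact_pos)
  have b: "Z \<in> sets borel" using Z borel_compact by auto
  have "ennreal (\<Delta> (x + y)) * emeasure \<mu> Z = emeasure \<mu> (rtr (x + y) Z)"
    by (simp only: emeasure_add_right[OF b])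
  also have "rtr (x + y) Z = (\<lambda>z. z + y) ` rtr x Z"
    by (simp add: image_image add.assoc)
  also have "emeasure \<mu> \<dots> = ennreal (\<Delta> y) * (ennreal (\<Delta> x) * emeasure \<mu> Z)"
    by (simp only: emeasure_add_right[OF b] emeasure_add_right[OF sets_add_right[OF b]])
  also have "\<dots> = ennreal (\<Delta> x * \<Delta> y) * emeasure \<mu> Z"
    by (simp add: ennreal_mult less_imp_le mult_ac)
  finally have "ennreal (\<Delta> (x + y)) = ennreal (\<Delta> x * \<Delta> y)" using Z(2,3) by (rule ennreal_mult_right_cancel_fin)
  then show ?thesis by (simp add: less_imp_le)
qed

lemma modular_0: "\<Delta> 0 = 1"
  using modular_add[of 0 0] modular_pos[of 0] by simp

lemma modular_minus: "\<Delta> (- x) * \<Delta> x = 1"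
  using modular_add[of "- x" x] modular_0 by simp

text \<open>\<open>\<Delta>\<close> is not assumed continuous. All right translates of
  \<open>Z\<close> by points of \<open>L\<close> lie in the compact sumset \<open>M\<close>, so
  their measures, \<open>\<Delta> x\<close> times that of \<open>Z\<close>, stay below the measure
  of \<open>M\<close>.\<close>

lemma modular_bounded_compact:
  assumes "compact L"
  obtains B where "0 < B" "\<And>x. x \<in> L \<Longrightarrow> \<Delta> x \<le> B"
proof -
  obtain Z where Z: "compact Z" "0 < emeasure \<mu> Z" "emeasure \<mu> Z < \<infinity>" by (rule ex_compact_pos)
  have b: "Z \<in> sets borel" using Z borel_compact by auto
  define M where "M = group_sumset Z L"
  have M: "compact M" unfolding M_def by (intro compact_group_sumset Z assms)
  define m z where "m = measure \<mu> M" and "z = measure \<mu> Z"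
  have ez: "emeasure \<mu> Z = ennreal z" using Z by (simp add: z_def emeasure_eq_ennreal_measure)
  then have z0: "z > 0" using Z(2) by (simp add: ennreal_less_zero_iff)
  have em: "emeasure \<mu> M = ennreal m" using emeasure_compact[OF M] by (auto simp: m_def emeasure_eq_ennreal_measure)
  have "\<Delta> x \<le> m / z" if "x \<in> L" for x
  proof -
    have "ennreal (\<Delta> x) * emeasure \<mu> Z = emeasure \<mu> (rtr x Z)" by (simp add: emeasure_add_right[OF b])
    also have "\<dots> \<le> emeasure \<mu> M" using that borel_compact[OF M] by (intro emeasure_mono) (auto simp: M_def intro: group_sumsetI)
    finally have "ennreal (\<Delta> x * z) \<le> ennreal m" using ez em z0 by (simp add: ennreal_mult less_imp_le)
    then have "\<Delta> x * z \<le> m" by (simp add: m_def)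
    then show ?thesis using z0 by (simp add: field_simps)
  qed
  then show ?thesis using that[of "max 1 (m / z)"] by fastforce
qed

end

section \<open>Inversion of Haar measure\<close>

context haar_group
begin

text \<open>Both sides come from integrating \<open>(x, y) \<mapsto> 1\<^sub>N(x) 1\<^sub>B(-x + y)\<close> in the two orders. Borel sets of
  the product need not be product measurable here, so the exchange is carried out on a finite partition
  of \<open>N\<close> into pieces so small that \<open>-B\<close> stays inside a prescribed open set.\<close>
lemma emeasure_add_le_uminus:
  assumes N: "compact N" and B: "compact B"
  shows "emeasure \<mu> N * emeasure \<mu> B \<le> emeasure \<mu> (group_sumset N B) * emeasure \<mu> (uminus ` B)"
proof (cases "N = {}")
  case True
  then show ?thesis by simp
next
  case False
  define M where "M = group_sumset N B"
  have M: "compact M" unfolding M_def by (intro compact_group_sumset N B)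
  note [measurable] = borel_compact[OF N] borel_compact[OF B] borel_compact[OF M]
  have *: "emeasure \<mu> N * emeasure \<mu> B \<le> emeasure \<mu> M * emeasure \<mu> W"
    if W: "open W" "uminus ` B \<subseteq> W" for W
  proof -
    have [measurable]: "W \<in> sets borel" using W by simp
    obtain Q where Q: "open Q" "0 \<in> Q" "\<And>l q. l \<in> uminus ` B \<Longrightarrow> q \<in> Q \<Longrightarrow> l + q \<in> W"
      using compact_subset_open_add[OF compact_uminus[OF B] W] by metis
    obtain F where F: "finite F" "F \<subseteq> N" "N \<subseteq> (\<Union>x\<in>F. ltr x Q)"
      using compact_cover_translates_left[OF N Q(1,2)] by metis
    define x where "x = from_nat_into F"
    have "F \<noteq> {}" using F(3) False by auto
    then have rx: "range x = F" unfolding x_def using F(1) by (intro range_from_nat_into countable_finite)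
    define A where "A n = ltr (x n) Q" for n
    have A[measurable]: "A n \<in> sets borel" for n using open_add_left[OF Q(1)] by (auto simp: A_def)
    define D where "D n = N \<inter> disjointed A n" for n
    have "disjointed A n \<in> sets borel" for n
    proof -
      have "range A \<subseteq> sets borel" using A by blast
      from sets.range_disjointed_sets[OF this] show ?thesis by blast
    qed
    then have D[measurable]: "D n \<in> sets borel" for n by (auto simp: D_def)
    have disj: "disjoint_family D"
      using disjoint_family_disjointed[of A] by (auto simp: disjoint_family_on_def D_def)
    have "(\<Union>n. A n) = (\<Union>x\<in>F. ltr x Q)" unfolding A_def rx[symmetric] by blast
    then have UD: "(\<Union>n. D n) = N"
      using F(3) by (auto simp: D_def UN_disjointed_eq simp flip: Int_UN_distrib)
    have xN: "x n \<in> N" for n using rx F(2) by auto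
    have "emeasure \<mu> N = (\<Sum>n. emeasure \<mu> (D n))"
      using disj UD by (subst suminf_emeasure) auto
    then have "emeasure \<mu> N * emeasure \<mu> B = (\<Sum>n. emeasure \<mu> (D n) * emeasure \<mu> B)"
      by (simp add: ennreal_suminf_multc)
    also have "\<dots> = (\<Sum>n. \<integral>\<^sup>+ y. emeasure \<mu> (D n) * indicator (ltr (x n) B) y \<partial>\<mu>)"
      by (subst nn_integral_cmult_indicator) (auto simp: emeasure_add_left)
    also have "\<dots> = (\<integral>\<^sup>+ y. (\<Sum>n. emeasure \<mu> (D n) * indicator (ltr (x n) B) y) \<partial>\<mu>)"
      by (rule nn_integral_suminf[symmetric]) simp
    also have "\<dots> \<le> (\<integral>\<^sup>+ y. emeasure \<mu> W * indicator M y \<partial>\<mu>)"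
    proof (rule nn_integral_mono)
      fix y
      show "(\<Sum>n. emeasure \<mu> (D n) * indicator (ltr (x n) B) y) \<le> emeasure \<mu> W * indicator M y"
      proof (cases "y \<in> M")
        case False
        then have "y \<notin> ltr (x n) B" for n
          using xN by (auto simp: M_def intro: group_sumsetI)
        then show ?thesis by simp
      next
        case True
        have "emeasure \<mu> (D n) * indicator (ltr (x n) B) y \<le> emeasure \<mu> (D n \<inter> ltr y W)" for n
        proof (cases "y \<in> ltr (x n) B")
          case True
          then obtain b where b: "b \<in> B" "y = x n + b" by auto
          have "D n \<subseteq> ltr y W"
          proof
            fix z assume "z \<in> D n"
            then obtain q where q: "q \<in> Q" "z = x n + q"
              using disjointed_subset[of A n] by (auto simp: D_def A_def)
            then have "z = y + (- b + q)" using b by (simp add: add.assoc)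
            moreover have "- b + q \<in> W" using Q(3) b q by auto
            ultimately show "z \<in> ltr y W" by blast
          qed
          then show ?thesis using True by (simp add: Int_absorb2)
        qed simp
        then have "(\<Sum>n. emeasure \<mu> (D n) * indicator (ltr (x n) B) y) \<le> (\<Sum>n. emeasure \<mu> (D n \<inter> ltr y W))"
          by (intro suminf_le) auto
        also have "\<dots> = emeasure \<mu> (\<Union>n. D n \<inter> ltr y W)"
          using disj by (intro suminf_emeasure) (auto simp: disjoint_family_on_def)
        also have "\<dots> \<le> emeasure \<mu> (ltr y W)" by (intro emeasure_mono) auto
        also have "\<dots> = emeasure \<mu> W" by (simp add: emeasure_add_left)
        finally show ?thesis using True by simp
      qed
    qed
    also have "\<dots> = emeasure \<mu> M * emeasure \<mu> W"
      by (subst nn_integral_cmult_indicator) (auto simp: mult.commute)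
    finally show ?thesis .
  qed
  have Mfin: "emeasure \<mu> M < \<infinity>" by (rule emeasure_compact[OF M])
  show ?thesis
  proof (cases "emeasure \<mu> M = 0")
    case True
    \<comment> \<open>Division by the measure of \<open>M\<close> is impossible here, but with
      \<open>W = UNIV\<close> the right side is 0, even if the group has infinite measure.\<close>
    then show ?thesis using *[of UNIV] by (simp add: M_def)
  next
    case False
    \<comment> \<open>The bound holds for every open \<open>W\<close> around the reflection of
      \<open>B\<close>, so outer regularity carries it over to the reflection itself.\<close>
    have "emeasure \<mu> N * emeasure \<mu> B / emeasure \<mu> M \<le> (INF W\<in>{W. open W \<and> uminus ` B \<subseteq> W}. emeasure \<mu> W)"
      using * False by (intro INF_greatest divide_le_posI_ennreal) (auto simp: zero_less_iff_neq_zero)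
    also have "\<dots> = emeasure \<mu> (uminus ` B)"
      by (subst outer_regular[of "uminus ` B"]) auto
    finally have "emeasure \<mu> M * (emeasure \<mu> N * emeasure \<mu> B / emeasure \<mu> M) \<le> emeasure \<mu> M * emeasure \<mu> (uminus ` B)"
      by (rule mult_left_mono) simp
    moreover have "emeasure \<mu> M * (emeasure \<mu> N * emeasure \<mu> B / emeasure \<mu> M) = emeasure \<mu> N * emeasure \<mu> B"
      using False Mfin by (subst mult.commute) (simp add: ennreal_divide_times ennreal_divide_self)
    ultimately show ?thesis by (simp add: M_def)
  qed
qed

text \<open>Inner regularity is given for open sets only. For a Borel subset \<open>B\<close> of a
  compact \<open>C\<close> it follows from outer regularity of \<open>C - B\<close>: an open
  \<open>U\<close> around this difference with small excess leaves the compact set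
  \<open>C - U\<close> inside \<open>B\<close>, and finite measures may be subtracted.\<close>

lemma emeasure_le_if_compact_le:
  assumes B[measurable]: "B \<in> sets borel" and C: "compact C" "B \<subseteq> C"
    and le: "\<And>L. compact L \<Longrightarrow> L \<subseteq> B \<Longrightarrow> emeasure \<mu> L \<le> c"
  shows "emeasure \<mu> B \<le> c"
proof (rule ennreal_le_epsilon)
  fix e :: real assume "0 < e"
  note [measurable] = borel_compact[OF C(1)]
  have Cfin: "emeasure \<mu> C < \<infinity>" by (rule emeasure_compact[OF C(1)])
  have dfin: "emeasure \<mu> (C - B) < \<infinity>"
    using Cfin by (rule le_less_trans[rotated]) (auto intro!: emeasure_mono)
  have "(INF U\<in>{U. open U \<and> C - B \<subseteq> U}. emeasure \<mu> U) < emeasure \<mu> (C - B) + ennreal e"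
    using dfin \<open>0 < e\<close> by (subst outer_regular[symmetric]) (auto simp: ennreal_less_top)
  then obtain U where U: "open U" "C - B \<subseteq> U" "emeasure \<mu> U < emeasure \<mu> (C - B) + ennreal e"
    by (auto simp: INF_less_iff)
  have L: "compact (C - U)" "C - U \<subseteq> B" using U C by (auto intro: compact_diff)
  note [measurable] = borel_open[OF U(1)]
  have "emeasure \<mu> (C - B) + emeasure \<mu> B = emeasure \<mu> C"
    using C(2) by (subst plus_emeasure) (auto intro!: arg_cong[where f="emeasure \<mu>"])
  also have "\<dots> \<le> emeasure \<mu> ((C - U) \<union> U)" by (intro emeasure_mono) auto
  also have "\<dots> \<le> emeasure \<mu> (C - U) + emeasure \<mu> U" by (intro emeasure_subadditive) auto
  also have "\<dots> \<le> c + (emeasure \<mu> (C - B) + ennreal e)"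
    using U(3) le[OF L] by (intro add_mono) auto
  finally have "emeasure \<mu> (C - B) + emeasure \<mu> B \<le> emeasure \<mu> (C - B) + (c + ennreal e)"
    by (simp add: ac_simps)
  then show "emeasure \<mu> B \<le> c + ennreal e"
    using dfin by (auto simp: ennreal_add_left_cancel_le)
qed

text \<open>One half of the formula d(- y) = \<Delta>(- y) dy, up to a constant. If \<open>L\<close>
  lies in the right translate of \<open>Z\<close> by \<open>p\<close>, then \<open>N + L\<close>
  lies in the right translate of \<open>N + Z\<close>, of measure \<open>m * \<Delta> p\<close>.
  Dividing \<open>emeasure_add_le_uminus\<close> by the measure \<open>n\<close> of \<open>N\<close>
  gives the factor \<open>m / n * \<Delta> p\<close>, whose constant is independent of
  \<open>p\<close>.\<close>

lemma emeasure_le_uminus: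
  assumes Z: "compact Z"
  obtains c where "0 < c" "\<And>p B. B \<in> sets borel \<Longrightarrow> B \<subseteq> rtr p Z \<Longrightarrow>
    emeasure \<mu> B \<le> ennreal (c * \<Delta> p) * emeasure \<mu> (uminus ` B)"
proof -
  obtain N where N: "compact N" "0 < emeasure \<mu> N" "emeasure \<mu> N < \<infinity>" by (rule ex_compact_pos)
  define n m where "n = measure \<mu> N" and "m = measure \<mu> (group_sumset N Z)"
  have cNZ: "compact (group_sumset N Z)" by (intro compact_group_sumset N Z)
  have en: "emeasure \<mu> N = ennreal n" using N by (simp add: n_def emeasure_eq_ennreal_measure)
  then have n0: "0 < n" using N(2) by (simp add: ennreal_less_zero_iff)
  have em: "emeasure \<mu> (group_sumset N Z) = ennreal m"
    using emeasure_compact[OF cNZ] by (simp add: m_def emeasure_eq_ennreal_measure)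
  have m0: "0 \<le> m" by (simp add: m_def)
  have main: "emeasure \<mu> B \<le> ennreal (m / n * \<Delta> p) * emeasure \<mu> (uminus ` B)"
    if B[measurable]: "B \<in> sets borel" and sub: "B \<subseteq> rtr p Z" for p B
  proof (rule emeasure_le_if_compact_le[OF B compact_add_right[OF Z] sub])
    fix L assume L: "compact L" "L \<subseteq> B"
    have "emeasure \<mu> N * emeasure \<mu> L \<le> emeasure \<mu> (group_sumset N L) * emeasure \<mu> (uminus ` L)"
      by (rule emeasure_add_le_uminus[OF N(1) L(1)])
    also have "\<dots> \<le> emeasure \<mu> ((\<lambda>z. z + p) ` group_sumset N Z) * emeasure \<mu> (uminus ` B)"
    proof (intro mult_mono emeasure_mono)
      show "group_sumset N L \<subseteq> (\<lambda>z. z + p) ` group_sumset N Z"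
      proof
        fix y assume "y \<in> group_sumset N L"
        then obtain a l where al: "y = a + l" "a \<in> N" "l \<in> L" by (auto simp: group_sumset_def)
        then obtain z where "z \<in> Z" "l = z + p" using L sub by blast
        then show "y \<in> (\<lambda>z. z + p) ` group_sumset N Z"
          using al by (intro image_eqI[of _ _ "a + z"]) (auto simp: add.assoc intro: group_sumsetI)
      qed
    qed (use L borel_compact[OF cNZ] in auto)
    also have "\<dots> = ennreal (\<Delta> p) * ennreal m * emeasure \<mu> (uminus ` B)"
      using borel_compact[OF cNZ] by (simp add: emeasure_add_right em)
    finally have *: "ennreal n * emeasure \<mu> L \<le> ennreal (\<Delta> p * m) * emeasure \<mu> (uminus ` B)"
      using m0 by (simp add: en ennreal_mult' less_imp_le)
    have "emeasure \<mu> L = ennreal (1 / n) * (ennreal n * emeasure \<mu> L)"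
      using n0 by (simp add: mult.assoc[symmetric] ennreal_mult[symmetric])
    also have "\<dots> \<le> ennreal (1 / n) * (ennreal (\<Delta> p * m) * emeasure \<mu> (uminus ` B))"
      by (intro mult_left_mono *) auto
    also have "\<dots> = ennreal (m / n * \<Delta> p) * emeasure \<mu> (uminus ` B)"
      using n0 m0 by (simp add: mult.assoc[symmetric] ennreal_mult[symmetric] less_imp_le field_simps)
    finally show "emeasure \<mu> L \<le> ennreal (m / n * \<Delta> p) * emeasure \<mu> (uminus ` B)" .
  qed
  show ?thesis
  proof (rule that)
    \<comment> \<open>Adding 1 keeps the constant positive when \<open>m = 0\<close>.\<close>
    show "0 < m / n + 1" using m0 n0 by (simp add: add_nonneg_pos)
    show "emeasure \<mu> B \<le> ennreal ((m / n + 1) * \<Delta> p) * emeasure \<mu> (uminus ` B)"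
      if "B \<in> sets borel" "B \<subseteq> rtr p Z" for p B
    proof -
      have "m / n * \<Delta> p \<le> (m / n + 1) * \<Delta> p" by (intro mult_right_mono) (auto simp: less_imp_le)
      then show ?thesis using main[OF that] by (meson dual_order.trans ennreal_leI mult_right_mono zero_le)
    qed
  qed
qed

text \<open>On each right translate of a compact set the measure is at most a multiple of the
  measure of the reflected set, which lies in \<open>N\<close>. Countably many translates cover the
  group.\<close>

lemma null_sets_uminus:
  assumes N: "N \<in> null_sets \<mu>" shows "uminus -` N \<in> null_sets \<mu>"
proof -
  have [measurable]: "N \<in> sets borel" using N by (auto simp: null_sets_def)
  obtain U Z :: "'g set" where UZ: "open U" "compact Z" "0 \<in> U" "U \<subseteq> Z" by (rule ex_compact_nbhd)
  obtain p :: "nat \<Rightarrow> 'g" where p: "(\<Union>n. rtr (p n) U) = UNIV"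
    using ex_sequence_translates_right[OF UZ(1,3)] .
  obtain c where c: "\<And>p B. B \<in> sets borel \<Longrightarrow> B \<subseteq> rtr p Z \<Longrightarrow>
    emeasure \<mu> B \<le> ennreal (c * \<Delta> p) * emeasure \<mu> (uminus ` B)"
    using emeasure_le_uminus[OF UZ(2)] by metis
  have "uminus ` N \<inter> rtr (p n) U \<in> null_sets \<mu>" (is "?B n \<in> _") for n
  proof -
    have [measurable]: "?B n \<in> sets borel" using open_add_right[OF UZ(1)] by (intro sets.Int) auto
    have "emeasure \<mu> (?B n) \<le> ennreal (c * \<Delta> (p n)) * emeasure \<mu> (uminus ` ?B n)"
      using UZ(4) by (intro c) auto
    also have "uminus ` ?B n \<subseteq> N"
    proof
      fix y assume "y \<in> uminus ` ?B n"
      then have "- y \<in> uminus ` N" by force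
      then show "y \<in> N" by (simp add: image_uminus_eq_vimage)
    qed
    then have "emeasure \<mu> (uminus ` ?B n) \<le> emeasure \<mu> N" by (intro emeasure_mono) auto
    then have "uminus ` ?B n \<in> null_sets \<mu>" using N by (auto simp: null_sets_def)
    then have "ennreal (c * \<Delta> (p n)) * emeasure \<mu> (uminus ` ?B n) = 0" by auto
    finally show ?thesis by (auto simp: null_sets_def)
  qed
  then have "(\<Union>n. ?B n) \<in> null_sets \<mu>" by (rule null_sets_UN)
  also have "(\<Union>n. ?B n) = uminus -` N" using p unfolding image_uminus_eq_vimage by (auto simp flip: Int_UN_distrib)
  finally show ?thesis .
qed

lemma AE_add_left: "(AE y in \<mu>. P y) \<Longrightarrow> AE y in \<mu>. P (x + y)"
proof -
  assume "AE y in \<mu>. P y"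
  then obtain N where N: "N \<in> null_sets \<mu>" "{y. \<not> P y} \<subseteq> N"
    by (auto simp: eventually_ae_filter)
  then show ?thesis by (intro AE_I'[OF null_sets_add_left[OF N(1), of x]]) auto
qed

text \<open>In a convolution the kernel is evaluated at \<open>- y + x\<close> as a function of
  \<open>y\<close>; this fact allows kernels to be replaced by almost everywhere equal ones at every
  single \<open>x\<close>.\<close>

lemma AE_minus_add: "(AE y in \<mu>. P y) \<Longrightarrow> AE y in \<mu>. P (- y + x)"
proof -
  assume "AE y in \<mu>. P y"
  then obtain N where N: "N \<in> null_sets \<mu>" "{y. \<not> P y} \<subseteq> N"
    by (auto simp: eventually_ae_filter)
  show ?thesis
  proof (rule AE_I')
    show "uminus -` (\<lambda>y. y + x) -` N \<in> null_sets \<mu>"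
      by (intro null_sets_uminus null_sets_add_right N)
    show "{y \<in> space \<mu>. \<not> P (- y + x)} \<subseteq> uminus -` (\<lambda>y. y + x) -` N" using N by auto
  qed
qed

text \<open>The symmetry \<open>w x = \<Delta> (- x) * w (- x)\<close> matches the transformation of
  Haar measure under inversion, so reflection acts boundedly on weighted L1. On the piece near
  \<open>p n\<close> the weight contributes \<open>d * \<Delta> (- p n)\<close> and the measure
  comparison \<open>c * \<Delta> (p n)\<close>; the modular factors cancel, leaving
  \<open>c * d\<close> on every piece.\<close>

lemma nn_integral_uminus_le:
  obtains c where "0 < c" "\<And>F w. F \<in> borel_measurable borel \<Longrightarrow> w \<in> borel_measurable borel \<Longrightarrow>
     (\<And>x. 0 \<le> w x) \<Longrightarrow> (\<And>x. w x = \<Delta> (- x) * w (- x)) \<Longrightarrow>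
     (\<integral>\<^sup>+ y. F (- y) * ennreal (w y) \<partial>\<mu>) \<le> ennreal c * (\<integral>\<^sup>+ y. F y * ennreal (w y) \<partial>\<mu>)"
proof -
  obtain U Z :: "'g set" where UZ: "open U" "compact Z" "0 \<in> U" "U \<subseteq> Z" by (rule ex_compact_nbhd)
  obtain p :: "nat \<Rightarrow> 'g" where p: "(\<Union>n. rtr (p n) U) = UNIV"
    using ex_sequence_translates_right[OF UZ(1,3)] .
  obtain c where c0: "0 < c" and c: "\<And>p B. B \<in> sets borel \<Longrightarrow> B \<subseteq> rtr p Z \<Longrightarrow>
    emeasure \<mu> B \<le> ennreal (c * \<Delta> p) * emeasure \<mu> (uminus ` B)"
    using emeasure_le_uminus[OF UZ(2)] by metis
  obtain d where d0: "0 < d" and d: "\<And>x. x \<in> uminus ` Z \<Longrightarrow> \<Delta> x \<le> d"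
    using modular_bounded_compact[OF compact_uminus[OF UZ(2)]] by metis
  define A where "A n = rtr (p n) U" for n
  have "A n \<in> sets borel" for n using open_add_right[OF UZ(1)] by (auto simp: A_def)
  then have D[measurable]: "disjointed A n \<in> sets borel" for n
    using sets.range_disjointed_sets[of A borel] by auto
  have UD: "(\<Union>n. disjointed A n) = UNIV" using p by (simp add: UN_disjointed_eq A_def)
  have disj: "disjoint_family (disjointed A)" by (rule disjoint_family_disjointed)
  have subA: "disjointed A n \<subseteq> rtr (p n) Z" for n
    using disjointed_subset[of A n] UZ(4) by (auto simp: A_def)
  have main: "(\<integral>\<^sup>+ y. F (- y) * ennreal (w y) \<partial>\<mu>) \<le> ennreal (c * d) * (\<integral>\<^sup>+ y. F y * ennreal (w y) \<partial>\<mu>)"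
    if [measurable]: "F \<in> borel_measurable borel" "w \<in> borel_measurable borel"
      and w0: "\<And>x. 0 \<le> w x" and w: "\<And>x. w x = \<Delta> (- x) * w (- x)" for F :: "'g \<Rightarrow> ennreal" and w
  proof -
    define H where "H y = F y * ennreal (w y)" for y
    have [measurable]: "H \<in> borel_measurable borel" unfolding H_def by measurable
    have piece: "(\<integral>\<^sup>+ y. F (- y) * ennreal (w y) * indicator (disjointed A n) y \<partial>\<mu>)
        \<le> ennreal (c * d) * (\<integral>\<^sup>+ y. H y * indicator (uminus ` disjointed A n) y \<partial>\<mu>)" for n
    proof -
      let ?B = "disjointed A n"
      define M1 where "M1 = distr (density \<mu> (indicator ?B)) borel uminus"
      define M2 where "M2 = density \<mu> (\<lambda>y. ennreal (c * \<Delta> (p n)) * indicator (uminus ` ?B) y)"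
      \<comment> \<open>The comparison of measures of sets is read as an inequality between two
        measures, which then applies to the integral of any nonnegative \<open>H\<close>.\<close>
      have "M1 \<le> M2"
      proof (subst le_measure; (intro ballI)?)
        fix X assume "X \<in> sets M1"
        then have [measurable]: "X \<in> sets borel" by (simp add: M1_def)
        have [measurable]: "uminus -` X \<in> sets borel" using sets_uminus[of X] by (simp add: image_uminus_eq_vimage)
        have "emeasure M1 X = emeasure (density \<mu> (indicator ?B)) (uminus -` X)"
          unfolding M1_def by (subst emeasure_distr) auto
        also have "\<dots> = emeasure \<mu> (?B \<inter> uminus -` X)"
          by (simp add: emeasure_density nn_integral_indicator flip: indicator_inter_arith)
        also have "\<dots> \<le> ennreal (c * \<Delta> (p n)) * emeasure \<mu> (uminus ` (?B \<inter> uminus -` X))"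
          using subA[of n] by (intro c) auto
        also have "uminus ` (?B \<inter> uminus -` X) = uminus ` ?B \<inter> X"
          by (auto simp: image_uminus_eq_vimage)
        also have "ennreal (c * \<Delta> (p n)) * emeasure \<mu> (uminus ` ?B \<inter> X) = emeasure M2 X"
          unfolding M2_def by (simp add: emeasure_density mult.assoc nn_integral_cmult nn_integral_indicator flip: indicator_inter_arith)
        finally show "emeasure M1 X \<le> emeasure M2 X" .
      qed (simp add: M1_def M2_def)
      have "(\<integral>\<^sup>+ y. F (- y) * ennreal (w y) * indicator ?B y \<partial>\<mu>)
          \<le> (\<integral>\<^sup>+ y. ennreal (d * \<Delta> (- p n)) * (indicator ?B y * H (- y)) \<partial>\<mu>)"
      proof (rule nn_integral_mono)
        fix y
        show "F (- y) * ennreal (w y) * indicator ?B y \<le> ennreal (d * \<Delta> (- p n)) * (indicator ?B y * H (- y))"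
        proof (cases "y \<in> ?B")
          case True
          then obtain z where z: "z \<in> Z" "y = z + p n" using subA by blast
          have "\<Delta> (- y) = \<Delta> (- p n) * \<Delta> (- z)" using z by (simp only: minus_add modular_add)
          also have "\<dots> \<le> \<Delta> (- p n) * d" using d z by (intro mult_left_mono) (auto simp: less_imp_le)
          finally have "w y \<le> d * \<Delta> (- p n) * w (- y)"
            by (subst w) (intro mult_right_mono w0, simp add: mult.commute)
          then have "ennreal (w y) \<le> ennreal (d * \<Delta> (- p n)) * ennreal (w (- y))"
            using d0 w0 by (subst ennreal_mult[symmetric]) (auto intro!: ennreal_leI simp: less_imp_le)
          then have "F (- y) * ennreal (w y) \<le> F (- y) * (ennreal (d * \<Delta> (- p n)) * ennreal (w (- y)))"
            by (rule mult_left_mono) simp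
          then show ?thesis using True by (simp add: H_def ac_simps)
        qed simp
      qed
      also have "\<dots> = ennreal (d * \<Delta> (- p n)) * (\<integral>\<^sup>+ y. indicator ?B y * H (- y) \<partial>\<mu>)"
        by (rule nn_integral_cmult) simp
      also have "(\<integral>\<^sup>+ y. indicator ?B y * H (- y) \<partial>\<mu>) = (\<integral>\<^sup>+ y. H y \<partial>M1)"
        unfolding M1_def by (subst nn_integral_distr) (auto simp: nn_integral_density)
      also have "\<dots> \<le> (\<integral>\<^sup>+ y. H y \<partial>M2)"
        by (rule nn_integral_mono_measure[OF _ \<open>M1 \<le> M2\<close>]) (simp add: M1_def M2_def)
      also have "(\<integral>\<^sup>+ y. H y \<partial>M2) = ennreal (c * \<Delta> (p n)) * (\<integral>\<^sup>+ y. H y * indicator (uminus ` ?B) y \<partial>\<mu>)"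
        unfolding M2_def by (simp add: nn_integral_density mult.assoc nn_integral_cmult mult.commute[of "H _"])
      also have "ennreal (d * \<Delta> (- p n)) * (ennreal (c * \<Delta> (p n)) * (\<integral>\<^sup>+ y. H y * indicator (uminus ` ?B) y \<partial>\<mu>))
         = ennreal (c * d) * (\<integral>\<^sup>+ y. H y * indicator (uminus ` ?B) y \<partial>\<mu>)"
      proof -
        have "d * \<Delta> (- p n) * (c * \<Delta> (p n)) = c * d * (\<Delta> (- p n) * \<Delta> (p n))" by simp
        also have "\<dots> = c * d" by (simp add: modular_minus)
        finally have "ennreal (d * \<Delta> (- p n)) * ennreal (c * \<Delta> (p n)) = ennreal (c * d)"
          using c0 d0 by (subst ennreal_mult[symmetric]) (auto simp: less_imp_le)
        then show ?thesis by (simp only: mult.assoc[symmetric])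
      qed
      finally show ?thesis by (simp add: mult_left_mono)
    qed
    have UD': "(\<Union>n. uminus ` disjointed A n) = UNIV"
    proof -
      have "x \<in> (\<Union>n. uminus ` disjointed A n)" for x
      proof -
        have "- x \<in> (\<Union>n. disjointed A n)" using UD by simp
        then show ?thesis by (auto simp: image_uminus_eq_vimage)
      qed
      then show ?thesis by auto
    qed
    have disj': "disjoint_family (\<lambda>n. uminus ` disjointed A n)"
      using disj by (auto simp: disjoint_family_on_def image_uminus_eq_vimage)
    have "(\<integral>\<^sup>+ y. F (- y) * ennreal (w y) \<partial>\<mu>) = (\<Sum>n. \<integral>\<^sup>+ y. F (- y) * ennreal (w y) * indicator (disjointed A n) y \<partial>\<mu>)"
      by (rule nn_integral_partition[OF _ D UD disj]) simp
    also have "\<dots> \<le> (\<Sum>n. ennreal (c * d) * (\<integral>\<^sup>+ y. H y * indicator (uminus ` disjointed A n) y \<partial>\<mu>))"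
      by (intro suminf_le piece) auto
    also have "\<dots> = ennreal (c * d) * (\<Sum>n. \<integral>\<^sup>+ y. H y * indicator (uminus ` disjointed A n) y \<partial>\<mu>)"
      by (rule ennreal_suminf_cmult)
    also have "(\<Sum>n. \<integral>\<^sup>+ y. H y * indicator (uminus ` disjointed A n) y \<partial>\<mu>) = (\<integral>\<^sup>+ y. H y \<partial>\<mu>)"
      by (rule nn_integral_partition[OF _ _ UD' disj', symmetric]) simp_all
    finally show ?thesis by (simp add: H_def)
  qed
  show ?thesis
  proof (rule that[OF _ main])
    show "0 < c * d" using c0 d0 by simp
  qed
qed

end

section \<open>Envelopes of kernels\<close>

text \<open>With a countable index set, measurability of each \<open>f i\<close> already yields
  joint measurability, whatever the sigma-algebra of \<open>M\<close>.\<close>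

lemma borel_measurable_nn_integral_count_space:
  fixes f :: "'i \<Rightarrow> 'a \<Rightarrow> ennreal"
  assumes I: "countable I" and f: "\<And>i. i \<in> I \<Longrightarrow> f i \<in> borel_measurable M"
  shows "(\<lambda>x. \<integral>\<^sup>+ i. f i x \<partial>count_space I) \<in> borel_measurable M"
proof -
  interpret sigma_finite_measure "count_space I"
    by (rule sigma_finite_measure_count_space_countable[OF I])
  show ?thesis
  proof (rule borel_measurable_nn_integral)
    have "(\<lambda>(i, x). f i x) \<in> borel_measurable (count_space I \<Otimes>\<^sub>M M)"
      using f by (intro measurable_pair_measure_countable1 I) auto
    from measurable_pair_swap[OF this]
    show "(\<lambda>(x, i). f i x) \<in> borel_measurable (M \<Otimes>\<^sub>M count_space I)"
      by (simp add: split_beta')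
  qed
qed

lemma ennreal_le_esssup_restrict:
  assumes "V \<in> sets M" "\<not> (AE y in M. y \<in> V \<longrightarrow> f y \<le> q)"
  shows "ennreal q \<le> e2ennreal (esssup (restrict_space M V) (\<lambda>y. ereal (f y)))"
proof -
  let ?s = "esssup (restrict_space M V) (\<lambda>y. ereal (f y))"
  have "ereal q \<le> ?s"
  proof (rule ccontr)
    assume "\<not> ereal q \<le> ?s"
    then have less: "?s < ereal q" by simp
    have "AE y in restrict_space M V. ereal (f y) \<le> ?s" by (rule esssup_AE)
    then have "AE y in restrict_space M V. f y \<le> q"
      using less by (auto elim!: eventually_mono dest!: le_less_trans)
    then have "AE y in M. y \<in> V \<longrightarrow> f y \<le> q"
      using assms(1) by (subst (asm) AE_restrict_space_iff) auto
    with assms(2) show False ..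
  qed
  from e2ennreal_mono[OF this] show ?thesis by simp
qed

text \<open>The pointwise analogue of \<open>sharpR\<close>; for open \<open>C\<close> it is lower semicontinuous, whatever \<open>k\<close> is.\<close>
definition env :: "'g::group_add set \<Rightarrow> ('g \<Rightarrow> real) \<Rightarrow> 'g \<Rightarrow> ennreal" where
  "env C k z = (SUP p\<in>rtr z C. ennreal (k p))"

lemma env_upper: "c \<in> C \<Longrightarrow> ennreal (k (c + z)) \<le> env C k z"
  unfolding env_def by (rule SUP_upper) auto

lemma env_mono: "C \<subseteq> D \<Longrightarrow> (\<And>x. k x \<le> l x) \<Longrightarrow> env C k z \<le> env D l z"
  unfolding env_def by (rule SUP_subset_mono) (auto intro!: ennreal_leI)

text \<open>Every superlevel set is open: it is a union of right translates of the open set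
  \<open>- C\<close>, one for each point at which \<open>k\<close> exceeds the level.\<close>

lemma borel_measurable_env [measurable]:
  fixes C :: "'g::topological_group_add set"
  assumes "open C"
  shows "env C k \<in> borel_measurable borel"
proof (rule borel_measurableI_greater)
  fix y
  have "{x. y < env C k x} = (\<Union>p\<in>{p. y < ennreal (k p)}. (\<lambda>c. c + p) ` uminus ` C)" (is "?L = ?R")
  proof (rule set_eqI)
    fix x
    have "x \<in> ?L \<longleftrightarrow> (\<exists>c\<in>C. y < ennreal (k (c + x)))" by (auto simp: env_def less_SUP_iff)
    also have "\<dots> \<longleftrightarrow> x \<in> ?R"
    proof
      assume "\<exists>c\<in>C. y < ennreal (k (c + x))"
      then obtain c where c: "c \<in> C" "y < ennreal (k (c + x))" by blast
      have "x = - c + (c + x)" by (simp add: add.assoc[symmetric])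
      then have "x \<in> (\<lambda>d. d + (c + x)) ` uminus ` C" using c(1) by blast
      then show "x \<in> ?R" using c(2) by blast
    next
      assume "x \<in> ?R"
      then obtain p c where "y < ennreal (k p)" "c \<in> C" "x = - c + p" by blast
      then have "y < ennreal (k (c + x))" by (simp add: add.assoc[symmetric])
      then show "\<exists>c\<in>C. y < ennreal (k (c + x))" using \<open>c \<in> C\<close> by blast
    qed
    finally show "x \<in> ?L \<longleftrightarrow> x \<in> ?R" .
  qed
  moreover have "open ?R" using assms by (intro open_UN ballI open_add_right open_uminus)
  ultimately show "{x \<in> space borel. y < env C k x} \<in> sets borel" by simp
qed

context haar_group
begin

text \<open>Inside a relatively compact open piece \<open>D n\<close>, each compact set loses
  nothing when \<open>A\<close> is removed. By inner regularity \<open>D n\<close> and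
  \<open>D n - A\<close> then have the same finite measure, so \<open>D n\<close> meets
  \<open>A\<close> in a null set. The lemma makes an arbitrary union of open sets that meet
  \<open>A\<close> in null sets meet it in a null set as well.\<close>

lemma null_open_Int_if_compact:
  assumes W: "open W" and A[measurable]: "A \<in> sets borel"
    and L: "\<And>L. compact L \<Longrightarrow> L \<subseteq> W \<Longrightarrow> emeasure \<mu> (L \<inter> A) = 0"
  shows "W \<inter> A \<in> null_sets \<mu>"
proof -
  obtain U Z :: "'g set" where UZ: "open U" "compact Z" "0 \<in> U" "U \<subseteq> Z" by (rule ex_compact_nbhd)
  obtain x :: "nat \<Rightarrow> 'g" where x: "(\<Union>n. ltr (x n) U) = UNIV"
    using ex_sequence_translates_left[OF UZ(1,3)] .
  define D where "D n = W \<inter> ltr (x n) U" for n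
  have D: "open (D n)" for n unfolding D_def by (intro open_Int W open_add_left UZ)
  then have [measurable]: "D n \<in> sets borel" for n by auto
  have "D n \<inter> A \<in> null_sets \<mu>" for n
  proof -
    have "emeasure \<mu> (D n) \<le> emeasure \<mu> (ltr (x n) Z)"
      using UZ(4) borel_compact[OF compact_add_left[OF UZ(2)]] by (intro emeasure_mono) (auto simp: D_def)
    also have "\<dots> < \<infinity>" by (rule emeasure_compact[OF compact_add_left[OF UZ(2)]])
    finally have fin: "emeasure \<mu> (D n) < \<infinity>" .
    then have fin': "emeasure \<mu> (D n - A) < \<infinity>"
      by (rule le_less_trans[rotated]) (auto intro!: emeasure_mono)
    have "emeasure \<mu> (D n) \<le> emeasure \<mu> (D n - A)"
      unfolding inner_regular[OF D]
    proof (rule SUP_least)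
      fix L' assume "L' \<in> {L. compact L \<and> L \<subseteq> D n}"
      then have L': "compact L'" "L' \<subseteq> D n" by auto
      note [measurable] = borel_compact[OF L'(1)]
      have "emeasure \<mu> L' = emeasure \<mu> (L' \<inter> A) + emeasure \<mu> (L' - A)"
        by (subst plus_emeasure) (auto intro!: arg_cong[where f="emeasure \<mu>"])
      also have "emeasure \<mu> (L' \<inter> A) = 0" using L' by (intro L) (auto simp: D_def)
      also have "emeasure \<mu> (L' - A) \<le> emeasure \<mu> (D n - A)" using L' by (intro emeasure_mono) auto
      finally show "emeasure \<mu> L' \<le> emeasure \<mu> (D n - A)" by simp
    qed
    moreover have "emeasure \<mu> (D n) = emeasure \<mu> (D n - A) + emeasure \<mu> (D n \<inter> A)"
      by (subst plus_emeasure) (auto intro!: arg_cong[where f="emeasure \<mu>"])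
    ultimately have "emeasure \<mu> (D n - A) + emeasure \<mu> (D n \<inter> A) \<le> emeasure \<mu> (D n - A) + 0" by simp
    then have "emeasure \<mu> (D n \<inter> A) = 0" using fin' by (simp only: ennreal_add_left_cancel_le) auto
    then show ?thesis by (auto simp: null_sets_def)
  qed
  then have "(\<Union>n. D n \<inter> A) \<in> null_sets \<mu>" by (rule null_sets_UN)
  also have "(\<Union>n. D n \<inter> A) = W \<inter> A" using x by (auto simp: D_def)
  finally show ?thesis .
qed

end

section \<open>Weighted integrability of envelopes\<close>

locale weighted_group = haar_group \<mu> \<Delta>
  for \<mu> :: "'g::{topological_group_add,t2_space} measure" and \<Delta> :: "'g \<Rightarrow> real" +
  fixes V :: "'g set" and w :: "'g \<Rightarrow> real"
  assumes V: "good_nbhd V"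
    and w_pos: "0 < w x"
    and w_sym: "w x = \<Delta> (- x) * w (- x)"
    and w_sub: "w (x + y) \<le> w x * w y"
    and w_meas [measurable]: "w \<in> borel_measurable borel"
begin

text \<open>Envelopes are measurable over open sets, so the interior of \<open>V\<close> stands in
  for \<open>V\<close>; it is again symmetric and contains the identity.\<close>

abbreviation "Q \<equiv> interior V"

abbreviation "wint h \<equiv> \<integral>\<^sup>+ x. h x * ennreal (w x) \<partial>\<mu>"

lemma w_nonneg [simp]: "0 \<le> w x"
  using w_pos[of x] by simp

lemma nn_integral_uminus_w:
  obtains c where "0 < c" "\<And>F. F \<in> borel_measurable borel \<Longrightarrow>
     (\<integral>\<^sup>+ y. F (- y) * ennreal (w y) \<partial>\<mu>) \<le> ennreal c * (\<integral>\<^sup>+ y. F y * ennreal (w y) \<partial>\<mu>)"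
proof (rule nn_integral_uminus_le)
  fix c assume c: "0 < c" "\<And>F w. F \<in> borel_measurable borel \<Longrightarrow> w \<in> borel_measurable borel \<Longrightarrow>
     (\<And>x. 0 \<le> w x) \<Longrightarrow> (\<And>x. w x = \<Delta> (- x) * w (- x)) \<Longrightarrow>
     (\<integral>\<^sup>+ y. F (- y) * ennreal (w y) \<partial>\<mu>) \<le> ennreal c * (\<integral>\<^sup>+ y. F y * ennreal (w y) \<partial>\<mu>)"
  show thesis by (rule that[OF c(1) c(2)[OF _ w_meas w_nonneg w_sym]])
qed

lemma V_borel [measurable]: "V \<in> sets borel"
  using V by (simp add: good_nbhd_def)

lemma V_uminus: "uminus ` V = V"
  using V by (simp add: good_nbhd_def)

lemma V_uminus_iff: "- x \<in> V \<longleftrightarrow> x \<in> V"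
  using V_uminus by (metis image_uminus_eq_vimage vimage_eq)

lemma compact_closure_V: "compact (closure V)"
  using V by (simp add: good_nbhd_def)

lemma zero_in_Q: "0 \<in> Q"
  using V by (simp add: good_nbhd_def)

lemma Q_subset_V: "Q \<subseteq> V"
  by (rule interior_subset)

lemma V_subset_closure: "V \<subseteq> closure V"
  by (rule closure_subset)

lemma Q_uminus_iff: "- x \<in> Q \<longleftrightarrow> x \<in> Q"
proof -
  have "uminus ` Q \<subseteq> Q"
    using Q_subset_V V_uminus by (intro interior_maximal open_uminus open_interior) blast
  then show ?thesis by (metis image_eqI minus_minus subsetD)
qed

lemma emeasure_Q: "0 < emeasure \<mu> Q" "emeasure \<mu> Q < \<infinity>"
proof -
  show "0 < emeasure \<mu> Q" using zero_in_Q by (intro emeasure_open_pos) auto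
  have "emeasure \<mu> Q \<le> emeasure \<mu> (closure V)"
    using Q_subset_V V_subset_closure borel_compact[OF compact_closure_V] by (intro emeasure_mono) auto
  also have "\<dots> < \<infinity>" by (rule emeasure_compact[OF compact_closure_V])
  finally show "emeasure \<mu> Q < \<infinity>" .
qed

text \<open>Off a null set, a value \<open>k p\<close> never exceeds the essential supremum of \<open>k\<close> over a neighbourhood
  of \<open>p\<close>; inner regularity replaces the missing second countability.\<close>
lemma regularise:
  assumes k[measurable]: "k \<in> borel_measurable borel" and k0: "\<And>x. 0 \<le> k x"
  obtains k' where "k' \<in> borel_measurable borel" "\<And>x. 0 \<le> k' x" "\<And>x. k' x \<le> k x"
    "AE x in \<mu>. k' x = k x" "\<And>z. env Q k' z \<le> sharpR \<mu> V k z"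
proof -
  \<comment> \<open>\<open>O' q\<close> is the largest open set on which \<open>k\<close> is at most
    \<open>q\<close> almost everywhere.\<close>
  define O' where "O' q = \<Union>{U. open U \<and> U \<inter> {x. q < k x} \<in> null_sets \<mu>}" for q :: real
  have openO: "open (O' q)" for q unfolding O'_def by auto
  have m[measurable]: "{x. q < k x} \<in> sets borel" for q by measurable
  have nullO: "O' q \<inter> {x. q < k x} \<in> null_sets \<mu>" for q
  proof (rule null_open_Int_if_compact[OF openO m])
    fix L assume L: "compact L" "L \<subseteq> O' q"
    from compactE[OF L(1) L(2)[unfolded O'_def]] obtain T where
      T: "T \<subseteq> {U. open U \<and> U \<inter> {x. q < k x} \<in> null_sets \<mu>}" "finite T" "L \<subseteq> \<Union>T" by auto
    have "(\<Union>U\<in>T. U \<inter> {x. q < k x}) \<in> null_sets \<mu>"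
      using T by (intro null_sets_UN') (auto intro: countable_finite)
    then have "L \<inter> {x. q < k x} \<in> null_sets \<mu>"
      by (rule null_sets_subset) (use T borel_compact[OF L(1)] in auto)
    then show "emeasure \<mu> (L \<inter> {x. q < k x}) = 0" by auto
  qed
  \<comment> \<open>The exceptional points: \<open>k\<close> exceeds some rational \<open>q\<close>
    there although it is at most \<open>q\<close> almost everywhere nearby. Rational levels keep the
    union countable.\<close>
  define N where "N = (\<Union>q\<in>\<rat>. O' q \<inter> {x. q < k x})"
  have N: "N \<in> null_sets \<mu>" unfolding N_def by (intro null_sets_UN' countable_rat nullO)
  then have [measurable]: "N \<in> sets borel" by (auto simp: null_sets_def)
  define k' where "k' x = (if x \<in> N then 0 else k x)" for x
  show ?thesis
  proof (rule that[of k'])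
    show "k' \<in> borel_measurable borel" unfolding k'_def by measurable
    show "0 \<le> k' x" "k' x \<le> k x" for x by (auto simp: k'_def k0)
    show "AE x in \<mu>. k' x = k x" by (rule AE_I'[OF N]) (auto simp: k'_def)
    show "env Q k' z \<le> sharpR \<mu> V k z" for z
      unfolding env_def
    proof (rule SUP_least)
      fix p assume p: "p \<in> rtr z Q"
      show "ennreal (k' p) \<le> sharpR \<mu> V k z"
      proof (rule ccontr)
        assume "\<not> ennreal (k' p) \<le> sharpR \<mu> V k z"
        then have less: "sharpR \<mu> V k z < ennreal (k' p)" by simp
        then have pN: "p \<notin> N" by (auto simp: k'_def)
        obtain s where s: "sharpR \<mu> V k z = ennreal s" "0 \<le> s"
          using less by (cases "sharpR \<mu> V k z") (auto simp: top_unique)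
        then have "s < k p" using less pN by (simp add: k'_def ennreal_less_iff)
        then obtain q where q: "q \<in> \<rat>" "s < q" "q < k p" using Rats_dense_in_real by blast
        then have "p \<notin> O' q" using pN by (auto simp: N_def)
        \<comment> \<open>Since \<open>p\<close> lies outside \<open>O' q\<close>, every open set
          around \<open>p\<close>, in particular the translate of \<open>Q\<close> by
          \<open>z\<close>, meets the set where \<open>k\<close> exceeds \<open>q\<close> in more
          than a null set. This contradicts an essential supremum \<open>s\<close> below
          \<open>q\<close>.\<close>
        then have notnull: "rtr z Q \<inter> {x. q < k x} \<notin> null_sets \<mu>"
          using p open_add_right[OF open_interior[of V], of z] by (auto simp: O'_def)
        have "\<not> (AE y in \<mu>. y \<in> V \<longrightarrow> norm (k (y + z)) \<le> q)"
        proof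
          assume "AE y in \<mu>. y \<in> V \<longrightarrow> norm (k (y + z)) \<le> q"
          then obtain N0 where N0: "N0 \<in> null_sets \<mu>" "{y. \<not> (y \<in> V \<longrightarrow> norm (k (y + z)) \<le> q)} \<subseteq> N0"
            by (auto simp: eventually_ae_filter)
          have "(\<lambda>y. y + - z) -` N0 \<in> null_sets \<mu>" by (rule null_sets_add_right[OF N0(1)])
          then have "rtr z Q \<inter> {x. q < k x} \<in> null_sets \<mu>"
          proof (rule null_sets_subset)
            have "rtr z Q \<in> sets borel" using open_add_right[OF open_interior[of V], of z] by auto
            then show "rtr z Q \<inter> {x. q < k x} \<in> sets \<mu>" by auto
            show "rtr z Q \<inter> {x. q < k x} \<subseteq> (\<lambda>y. y + - z) -` N0"
              using N0(2) Q_subset_V by (auto simp: k0)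
          qed
          with notnull show False ..
        qed
        from ennreal_le_esssup_restrict[OF _ this] have "ennreal q \<le> ennreal s"
          by (simp add: sharpR_def s(1)[symmetric])
        then show False using q s by simp
      qed
    qed
  qed
qed

text \<open>If \<open>k\<close> exceeded \<open>B\<close> on a non-null part of the translate of
  \<open>H\<close> by \<open>x\<close>, then \<open>sharpL\<close> would be at least
  \<open>B\<close> at every point \<open>z\<close> of that translate, because the translate lies in
  \<open>z + V\<close>. Its weighted integral would be at least \<open>B * c * m\<close>, which
  \<open>B\<close> is chosen to push above the actual value \<open>j\<close>.\<close>

lemma AE_bounded:
  fixes k :: "'g \<Rightarrow> real"
  assumes k[measurable]: "k \<in> borel_measurable borel" and k0: "\<And>x. 0 \<le> k x"
    and int: "wint (sharpL \<mu> V k) < \<infinity>"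
    and c: "0 < c" "\<And>x. c \<le> w x"
  obtains B where "0 < B" "AE x in \<mu>. k x \<le> B"
proof -
  obtain H where H: "open H" "0 \<in> H" "uminus ` H = H" "\<And>a b. a \<in> H \<Longrightarrow> b \<in> H \<Longrightarrow> a + b \<in> Q"
    using ex_symmetric_half_nbhd[OF open_interior zero_in_Q] by metis
  then have HQ: "H \<subseteq> Q" by (metis add.left_neutral subsetI)
  have [measurable]: "H \<in> sets borel" using H by auto
  have "emeasure \<mu> H \<le> emeasure \<mu> Q" using HQ by (intro emeasure_mono) auto
  also have "\<dots> < \<infinity>" by (rule emeasure_Q)
  finally have "emeasure \<mu> H < \<infinity>" .
  then obtain m where m: "emeasure \<mu> H = ennreal m" "0 \<le> m" by (cases "emeasure \<mu> H") auto
  have "0 < emeasure \<mu> H" using H by (intro emeasure_open_pos) auto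
  then have m0: "0 < m" using m by (simp add: ennreal_less_zero_iff)
  obtain j where j: "wint (sharpL \<mu> V k) = ennreal j" "0 \<le> j"
    using int by (cases "wint (sharpL \<mu> V k)") auto
  define B where "B = j / (c * m) + 1"
  have B0: "0 < B" using j c m0 by (simp add: B_def add_nonneg_pos)
  have Bj: "j < B * c * m" using c m0 by (simp add: B_def field_simps)
  have local: "AE y in \<mu>. y \<in> ltr x H \<longrightarrow> k y \<le> B" for x
  proof (rule ccontr)
    assume neg: "\<not> (AE y in \<mu>. y \<in> ltr x H \<longrightarrow> k y \<le> B)"
    have ge: "ennreal B \<le> sharpL \<mu> V k z" if z: "z \<in> ltr x H" for z
    proof -
      have "\<not> (AE v in \<mu>. v \<in> V \<longrightarrow> norm (k (z + v)) \<le> B)"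
      proof
        assume "AE v in \<mu>. v \<in> V \<longrightarrow> norm (k (z + v)) \<le> B"
        from AE_add_left[OF this, of "- z"]
        have "AE y in \<mu>. - z + y \<in> V \<longrightarrow> k y \<le> B" by (simp add: add.assoc[symmetric] k0)
        then have "AE y in \<mu>. y \<in> ltr x H \<longrightarrow> k y \<le> B"
        proof eventually_elim
          case (elim y)
          show ?case
          proof
            assume "y \<in> ltr x H"
            then obtain h' where h': "h' \<in> H" "y = x + h'" by auto
            obtain h where h: "h \<in> H" "z = x + h" using z by auto
            have "- z + y = - h + h'" using h h' by (simp add: minus_add add.assoc del: add_uminus_conv_diff)
            moreover have "- h \<in> H" using h(1) H(3) by blast
            ultimately have "- z + y \<in> V" using H(4) h' Q_subset_V by auto
            then show "k y \<le> B" using elim by blast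
          qed
        qed
        with neg show False ..
      qed
      then show ?thesis unfolding sharpL_def by (intro ennreal_le_esssup_restrict) auto
    qed
    have "ennreal (B * c) * emeasure \<mu> (ltr x H) = (\<integral>\<^sup>+ z. ennreal (B * c) * indicator (ltr x H) z \<partial>\<mu>)"
      by (rule nn_integral_cmult_indicator[symmetric]) simp
    also have "\<dots> \<le> (wint (sharpL \<mu> V k))"
    proof (rule nn_integral_mono)
      fix z
      show "ennreal (B * c) * indicator (ltr x H) z \<le> sharpL \<mu> V k z * ennreal (w z)"
        using ge[of z] B0 c(1) by (auto simp: indicator_def ennreal_mult intro!: mult_mono ennreal_leI c(2))
    qed
    finally have "ennreal (B * c * m) \<le> ennreal j"
      using m j B0 c(1) by (simp add: emeasure_add_left ennreal_mult)
    then show False using Bj j by simp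
  qed
  obtain x :: "nat \<Rightarrow> 'g" where x: "(\<Union>n. ltr (x n) H) = UNIV"
    using ex_sequence_translates_left[OF H(1,2)] .
  have "AE y in \<mu>. \<forall>n. y \<in> ltr (x n) H \<longrightarrow> k y \<le> B"
    unfolding AE_all_countable using local by blast
  then have "AE y in \<mu>. k y \<le> B"
  proof eventually_elim
    case (elim y)
    have "y \<in> (\<Union>n. ltr (x n) H)" using x by simp
    then show ?case using elim by blast
  qed
  then show ?thesis using B0 that by blast
qed

text \<open>Independence of the right-sided amalgam condition from the neighbourhood: finitely many
  right translates of \<open>Q\<close> cover \<open>C\<close>, so the larger envelope is at most a
  sum of left translates of the smaller one, and submultiplicativity of \<open>w\<close> makes left
  translation bounded on weighted L1.\<close>

lemma nn_integral_env_finite: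
  assumes int: "wint (env Q k) < \<infinity>"
    and L: "compact L" and C: "open C" "C \<subseteq> L"
  shows "wint (env C k) < \<infinity>"
proof -
  have mQ[measurable]: "env Q k \<in> borel_measurable borel" by (rule borel_measurable_env) simp
  obtain F where F: "finite F" "L \<subseteq> (\<Union>b\<in>F. rtr b Q)"
    using compact_cover_translates_right[OF L open_interior zero_in_Q] by metis
  have le: "env C k z \<le> (\<Sum>b\<in>F. env Q k (b + z))" for z
    unfolding env_def[of C]
  proof (rule SUP_least)
    fix p assume "p \<in> rtr z C"
    then obtain c where c: "c \<in> C" "p = c + z" by auto
    then obtain b q where b: "b \<in> F" "q \<in> Q" "c = q + b" using F(2) C by blast
    have "ennreal (k p) = ennreal (k (q + (b + z)))" using c b by (simp add: add.assoc)
    also have "\<dots> \<le> env Q k (b + z)" by (rule env_upper[OF b(2)])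
    also have "\<dots> \<le> (\<Sum>b\<in>F. env Q k (b + z))" using F(1) b(1) by (intro member_le_sum) auto
    finally show "ennreal (k p) \<le> (\<Sum>b\<in>F. env Q k (b + z))" .
  qed
  have fin: "(\<integral>\<^sup>+ z. env Q k (b + z) * ennreal (w z) \<partial>\<mu>) < \<infinity>" for b
  proof -
    have "(\<integral>\<^sup>+ z. env Q k (b + z) * ennreal (w z) \<partial>\<mu>) = (\<integral>\<^sup>+ z. env Q k (b + z) * ennreal (w (- b + (b + z))) \<partial>\<mu>)"
      by (simp add: add.assoc[symmetric])
    also have "\<dots> = (\<integral>\<^sup>+ z. env Q k z * ennreal (w (- b + z)) \<partial>\<mu>)"
      by (rule nn_integral_add_left[where f="\<lambda>z. env Q k z * ennreal (w (- b + z))"]) simp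
    also have "\<dots> \<le> (\<integral>\<^sup>+ z. ennreal (w (- b)) * (env Q k z * ennreal (w z)) \<partial>\<mu>)"
    proof (rule nn_integral_mono)
      fix z
      have "ennreal (w (- b + z)) \<le> ennreal (w (- b)) * ennreal (w z)"
        using w_sub[of "- b" z] by (simp add: ennreal_mult[symmetric] ennreal_leI)
      then have "env Q k z * ennreal (w (- b + z)) \<le> env Q k z * (ennreal (w (- b)) * ennreal (w z))"
        by (rule mult_left_mono) simp
      then show "env Q k z * ennreal (w (- b + z)) \<le> ennreal (w (- b)) * (env Q k z * ennreal (w z))"
        by (simp add: ac_simps)
    qed
    also have "\<dots> = ennreal (w (- b)) * (wint (env Q k))"
      by (rule nn_integral_cmult) simp
    also have "\<dots> < \<infinity>" using int by (simp add: ennreal_mult_less_top)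
    finally show ?thesis .
  qed
  have "wint (env C k) \<le> (\<integral>\<^sup>+ z. (\<Sum>b\<in>F. env Q k (b + z) * ennreal (w z)) \<partial>\<mu>)"
    using le by (intro nn_integral_mono) (auto simp: sum_distrib_right[symmetric] intro!: mult_right_mono)
  also have "\<dots> = (\<Sum>b\<in>F. \<integral>\<^sup>+ z. env Q k (b + z) * ennreal (w z) \<partial>\<mu>)"
    by (rule nn_integral_sum) simp
  also have "\<dots> < \<infinity>" using fin F(1) by (simp add: less_top[symmetric])
  finally show ?thesis .
qed

section \<open>Relatively separated sets\<close>

lemma rel_separated_mem: "x \<in> ltr \<gamma> V \<longleftrightarrow> \<gamma> \<in> ltr x V"
proof -
  have "y \<in> ltr x V \<Longrightarrow> x \<in> ltr y V" for x y :: 'g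
  proof -
    assume "y \<in> ltr x V"
    then obtain v where "v \<in> V" "y = x + v" by auto
    then show ?thesis by (intro image_eqI[of _ _ "- v"]) (auto simp: V_uminus_iff add.assoc)
  qed
  then show ?thesis by blast
qed

lemma rel_separated_countable:
  assumes "rel_separated V \<Gamma>" shows "countable \<Gamma>"
proof -
  obtain X where X: "countable X" "(\<Union>x\<in>X. ltr x Q) = UNIV"
    using ex_countable_translates_left[OF open_interior zero_in_Q] .
  have "\<Gamma> \<subseteq> (\<Union>x\<in>X. \<Gamma> \<inter> ltr x V)"
  proof
    fix y assume "y \<in> \<Gamma>"
    moreover have "y \<in> (\<Union>x\<in>X. ltr x Q)" using X(2) by simp
    ultimately show "y \<in> (\<Union>x\<in>X. \<Gamma> \<inter> ltr x V)" using Q_subset_V by blast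
  qed
  moreover have "countable (\<Union>x\<in>X. \<Gamma> \<inter> ltr x V)"
    using assms X(1) unfolding rel_separated_def by (intro countable_UN) (auto intro: countable_finite)
  ultimately show ?thesis by (rule countable_subset)
qed

text \<open>Sampling against integration: \<open>k (- \<gamma> + z)\<close> is at most the envelope
  on all of \<open>A \<gamma>\<close>, a right translate of \<open>Q\<close> whose weighted measure
  is bounded below uniformly. Relative separation limits to \<open>n\<close> the number of sets
  \<open>A \<gamma>\<close> containing a given point, so the sum is at most a multiple of one
  integral.\<close>

lemma rel_separated_sum_le:
  assumes sep: "rel_separated V \<Gamma>" and c: "0 < c" "\<And>x. c \<le> w x"
  obtains M where "0 < M" "\<And>k z. (\<integral>\<^sup>+ \<gamma>. ennreal (k (- \<gamma> + z)) \<partial>count_space \<Gamma>)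
      \<le> ennreal M * (wint (env Q k))"
proof -
  obtain n :: nat where n: "\<And>x. finite (\<Gamma> \<inter> ltr x V)" "\<And>x. card (\<Gamma> \<inter> ltr x V) \<le> n"
    using sep unfolding rel_separated_def by blast
  have cnt: "countable \<Gamma>" by (rule rel_separated_countable[OF sep])
  obtain d where d: "0 < d" "\<And>x. x \<in> closure V \<Longrightarrow> \<Delta> x \<le> d"
    using modular_bounded_compact[OF compact_closure_V] by metis
  obtain m where m: "emeasure \<mu> Q = ennreal m" "0 \<le> m" using emeasure_Q by (cases "emeasure \<mu> Q") auto
  have m0: "0 < m" using emeasure_Q m by (simp add: ennreal_less_zero_iff)
  \<comment> \<open>A lower bound for the weighted measure of any right translate of
    \<open>Q\<close>: \<open>m\<close> is the measure of \<open>Q\<close>, and \<open>c / d\<close>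
    is what remains of the weight once the modular factors cancel.\<close>
  define c1 where "c1 = c / d * m"
  have c1: "0 < c1" using c d m0 by (simp add: c1_def)
  have main: "ennreal c1 * (\<integral>\<^sup>+ \<gamma>. ennreal (k (- \<gamma> + z)) \<partial>count_space \<Gamma>)
      \<le> ennreal (real n) * (wint (env Q k))" for k z
  proof -
    have mQ[measurable]: "env Q k \<in> borel_measurable borel" by (rule borel_measurable_env) simp
    define A where "A \<gamma> = rtr (- \<gamma> + z) Q" for \<gamma>
    have [measurable]: "A \<gamma> \<in> sets borel" for \<gamma> unfolding A_def by simp
    have one: "ennreal c1 * ennreal (k (- \<gamma> + z)) \<le> (\<integral>\<^sup>+ x. env Q k x * ennreal (w x) * indicator (A \<gamma>) x \<partial>\<mu>)" for \<gamma>
    proof -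
      let ?a = "- \<gamma> + z"
      have "ennreal c1 * ennreal (k ?a) = ennreal (k ?a) * ennreal (c / d * \<Delta> (- ?a)) * emeasure \<mu> (A \<gamma>)"
      proof -
        have "ennreal (c / d * \<Delta> (- ?a)) * emeasure \<mu> (A \<gamma>) = ennreal (c / d * \<Delta> (- ?a)) * (ennreal (\<Delta> ?a) * ennreal m)"
          unfolding A_def by (subst emeasure_add_right) (auto simp: m)
        also have "\<dots> = ennreal (c / d * m * (\<Delta> (- ?a) * \<Delta> ?a))"
          using c d m0 by (simp only: ennreal_mult'[symmetric] mult_nonneg_nonneg less_imp_le modular_pos divide_nonneg_pos) (simp add: ac_simps)
        also have "\<dots> = ennreal c1" by (simp only: modular_minus c1_def mult_1_right)
        finally have X: "ennreal (c / d * \<Delta> (- ?a)) * emeasure \<mu> (A \<gamma>) = ennreal c1" .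
        show ?thesis unfolding mult.assoc[of "ennreal (k ?a)"] X by (rule mult.commute)
      qed
      also have "\<dots> = (\<integral>\<^sup>+ x. ennreal (k ?a) * ennreal (c / d * \<Delta> (- ?a)) * indicator (A \<gamma>) x \<partial>\<mu>)"
        by (rule nn_integral_cmult_indicator[symmetric]) simp
      also have "\<dots> \<le> (\<integral>\<^sup>+ x. env Q k x * ennreal (w x) * indicator (A \<gamma>) x \<partial>\<mu>)"
      proof (rule nn_integral_mono)
        fix x
        show "ennreal (k ?a) * ennreal (c / d * \<Delta> (- ?a)) * indicator (A \<gamma>) x \<le> env Q k x * ennreal (w x) * indicator (A \<gamma>) x"
        proof (cases "x \<in> A \<gamma>")
          case True
          then obtain q where q: "q \<in> Q" "x = q + ?a" unfolding A_def by auto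
          have "?a = - q + x" unfolding q(2) by (simp only: minus_add_cancel)
          then have "ennreal (k ?a) \<le> env Q k x" using env_upper[of "- q" Q k x] q(1) by (simp add: Q_uminus_iff)
          \<comment> \<open>The symmetry of \<open>w\<close> is essential: the plain bound
            \<open>c \<le> w x\<close> would not compensate the factor \<open>\<Delta> ?a\<close> in
            the measure of the translate, but \<open>w x = \<Delta> (- x) * w (- x)\<close>
            does.\<close>
          moreover have "c / d * \<Delta> (- ?a) \<le> w x"
          proof -
            have "\<Delta> q \<le> d" using q(1) Q_subset_V V_subset_closure d(2) by blast
            then have "\<Delta> (- q) * \<Delta> q \<le> \<Delta> (- q) * d" by (intro mult_left_mono) (auto simp: less_imp_le)
            then have dq: "1 / d \<le> \<Delta> (- q)" using d(1) by (simp only: modular_minus) (simp add: field_simps)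
            have "c / d * \<Delta> (- ?a) = \<Delta> (- ?a) * (1 / d) * c" by simp
            also have "\<dots> \<le> \<Delta> (- ?a) * \<Delta> (- q) * c"
              using dq c(1) by (intro mult_right_mono mult_left_mono) (auto simp: less_imp_le)
            also have "\<dots> \<le> \<Delta> (- ?a) * \<Delta> (- q) * w (- x)"
              using c(2) by (intro mult_left_mono) (auto simp: less_imp_le)
            also have "\<dots> = \<Delta> (- x) * w (- x)" unfolding q(2) minus_add[of q] modular_add ..
            also have "\<dots> = w x" by (rule w_sym[symmetric])
            finally show ?thesis .
          qed
          ultimately show ?thesis using True by (auto intro!: mult_mono ennreal_leI)
        qed simp
      qed
      finally show ?thesis .
    qed
    have "ennreal c1 * (\<integral>\<^sup>+ \<gamma>. ennreal (k (- \<gamma> + z)) \<partial>count_space \<Gamma>)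
       = (\<integral>\<^sup>+ \<gamma>. ennreal c1 * ennreal (k (- \<gamma> + z)) \<partial>count_space \<Gamma>)"
      by (rule nn_integral_cmult[symmetric]) simp
    also have "\<dots> \<le> (\<integral>\<^sup>+ \<gamma>. \<integral>\<^sup>+ x. env Q k x * ennreal (w x) * indicator (A \<gamma>) x \<partial>\<mu> \<partial>count_space \<Gamma>)"
      by (intro nn_integral_mono one)
    also have "\<dots> = (\<integral>\<^sup>+ x. \<integral>\<^sup>+ \<gamma>. env Q k x * ennreal (w x) * indicator (A \<gamma>) x \<partial>count_space \<Gamma> \<partial>\<mu>)"
      by (rule nn_integral_count_space_nn_integral[symmetric, OF cnt]) simp
    also have "\<dots> \<le> (\<integral>\<^sup>+ x. ennreal (real n) * (env Q k x * ennreal (w x)) \<partial>\<mu>)"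
    proof (rule nn_integral_mono)
      fix x
      let ?S = "{\<gamma> \<in> \<Gamma>. x \<in> A \<gamma>}"
      \<comment> \<open>From \<open>x = q + (- \<gamma> + z)\<close> one gets
        \<open>\<gamma> = (z - x) + q\<close>, so the sets through \<open>x\<close> are indexed by
        the points of \<Gamma> in one translate of \<open>V\<close>.\<close>
      have sub: "?S \<subseteq> \<Gamma> \<inter> ltr (z - x) V"
      proof
        fix \<gamma> assume "\<gamma> \<in> ?S"
        then obtain q where q: "\<gamma> \<in> \<Gamma>" "q \<in> Q" "x = q + (- \<gamma> + z)" by (auto simp: A_def)
        then have "- q + x = - \<gamma> + z" by (simp only: minus_add_cancel)
        then have "\<gamma> + (- q + x) = z" by (simp only: add_minus_cancel)
        then have "\<gamma> + - q = z - x" by (simp only: add.assoc[symmetric] eq_diff_eq)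
        then have "\<gamma> = (z - x) + q" by (metis add.assoc add.right_neutral left_minus)
        then show "\<gamma> \<in> \<Gamma> \<inter> ltr (z - x) V" using q Q_subset_V by blast
      qed
      have fS: "finite ?S" using finite_subset[OF sub n(1)] .
      have "card ?S \<le> n" using card_mono[OF n(1) sub] n(2)[of "z - x"] by linarith
      have "(\<integral>\<^sup>+ \<gamma>. indicator (A \<gamma>) x \<partial>count_space \<Gamma>) = (\<integral>\<^sup>+ \<gamma>. indicator ?S \<gamma> \<partial>count_space \<Gamma>)"
        by (intro nn_integral_cong) (auto simp: indicator_def)
      also have "\<dots> = emeasure (count_space \<Gamma>) ?S" by (rule nn_integral_indicator) auto
      also have "\<dots> = of_nat (card ?S)" using fS by (subst emeasure_count_space_finite) auto
      also have "\<dots> \<le> ennreal (real n)" using \<open>card ?S \<le> n\<close> by (simp add: ennreal_of_nat_eq_real_of_nat)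
      finally have le: "(\<integral>\<^sup>+ \<gamma>. indicator (A \<gamma>) x \<partial>count_space \<Gamma>) \<le> ennreal (real n)" .
      have "(\<integral>\<^sup>+ \<gamma>. env Q k x * ennreal (w x) * indicator (A \<gamma>) x \<partial>count_space \<Gamma>)
        = env Q k x * ennreal (w x) * (\<integral>\<^sup>+ \<gamma>. indicator (A \<gamma>) x \<partial>count_space \<Gamma>)"
        by (rule nn_integral_cmult) simp
      also have "\<dots> \<le> env Q k x * ennreal (w x) * ennreal (real n)" by (intro mult_left_mono le) simp
      finally show "(\<integral>\<^sup>+ \<gamma>. env Q k x * ennreal (w x) * indicator (A \<gamma>) x \<partial>count_space \<Gamma>)
         \<le> ennreal (real n) * (env Q k x * ennreal (w x))" by (simp add: ac_simps)
    qed
    also have "\<dots> = ennreal (real n) * (wint (env Q k))"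
      by (rule nn_integral_cmult) simp
    finally show ?thesis .
  qed
  show ?thesis
  proof (rule that)
    \<comment> \<open>\<open>n\<close> may be 0, hence the added 1.\<close>
    show "0 < (real n + 1) / c1" using c1 by simp
    fix k z
    let ?S = "\<integral>\<^sup>+ \<gamma>. ennreal (k (- \<gamma> + z)) \<partial>count_space \<Gamma>" and ?I = "wint (env Q k)"
    have "?S = ennreal (1 / c1) * (ennreal c1 * ?S)"
      using c1 by (simp add: mult.assoc[symmetric] ennreal_mult[symmetric])
    also have "\<dots> \<le> ennreal (1 / c1) * (ennreal (real n) * ?I)" by (intro mult_left_mono main) simp
    also have "\<dots> = ennreal (real n / c1) * ?I"
      using c1 by (simp add: mult.assoc[symmetric] ennreal_mult[symmetric])
    also have "\<dots> \<le> ennreal ((real n + 1) / c1) * ?I"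
      using c1 by (intro mult_right_mono ennreal_leI) (auto simp: divide_simps)
    finally show "?S \<le> ennreal ((real n + 1) / c1) * ?I" .
  qed
qed

end

section \<open>Convolution on solid translation invariant spaces\<close>

text \<open>Unlike \<open>conv\<close> this has a meaningful value, possibly infinite, at every
  point, so pointwise domination needs no integrability.\<close>

definition nconv :: "'g::group_add measure \<Rightarrow> ('g \<Rightarrow> complex) \<Rightarrow> ('g \<Rightarrow> ennreal) \<Rightarrow> 'g \<Rightarrow> ennreal" where
  "nconv \<mu> f h x = (\<integral>\<^sup>+ y. ennreal (cmod (f y)) * h (- y + x) \<partial>\<mu>)"

lemma sum_half_powers_le: "n \<le> m \<Longrightarrow> (\<Sum>k=n..<m. (1/2::real)^k) \<le> 2 * (1/2)^n"
proof -
  assume "n \<le> m"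
  then have "(\<Sum>k=n..<m. (1/2::real)^k) = 2 * (1/2)^n - 2 * (1/2::real)^m"
    by (induction rule: dec_induct) auto
  then show ?thesis by simp
qed

text \<open>Elements are functions and not classes, so \<open>N\<close> is only a seminorm. Both
  \<open>E\<close> and \<open>S\<close> are instances; on \<open>S\<close>, continuity of the
  elements turns it into a norm.\<close>

locale seminormed_functions =
  fixes X :: "('a \<Rightarrow> complex) set" and N :: "('a \<Rightarrow> complex) \<Rightarrow> real"
  assumes subspace: "is_subspace X"
    and N_nonneg: "f \<in> X \<Longrightarrow> 0 \<le> N f"
    and N_add: "f \<in> X \<Longrightarrow> g \<in> X \<Longrightarrow> N (\<lambda>x. f x + g x) \<le> N f + N g"
    and N_scale: "f \<in> X \<Longrightarrow> N (\<lambda>x. c * f x) = cmod c * N f"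
    and complete: "(\<And>n::nat. F n \<in> X) \<Longrightarrow>
       (\<And>\<epsilon>. 0 < \<epsilon> \<Longrightarrow> \<exists>n0. \<forall>m\<ge>n0. \<forall>n\<ge>n0. N (\<lambda>x. F m x - F n x) < \<epsilon>) \<Longrightarrow>
       \<exists>f\<in>X. (\<lambda>n. N (\<lambda>x. F n x - f x)) \<longlonglongrightarrow> 0"
begin

lemma X_zero: "(\<lambda>x. 0) \<in> X"
  and X_add: "f \<in> X \<Longrightarrow> g \<in> X \<Longrightarrow> (\<lambda>x. f x + g x) \<in> X"
  and X_scale: "f \<in> X \<Longrightarrow> (\<lambda>x. c * f x) \<in> X"
  using subspace unfolding is_subspace_def by blast+

lemma X_diff: "f \<in> X \<Longrightarrow> g \<in> X \<Longrightarrow> (\<lambda>x. f x - g x) \<in> X"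
  using X_add[OF _ X_scale[of g "- 1"], of f] by simp

lemma N_diff: "f \<in> X \<Longrightarrow> g \<in> X \<Longrightarrow> N (\<lambda>x. f x - g x) \<le> N f + N g"
  using N_add[OF _ X_scale[of g "- 1"], of f] N_scale[of g "- 1"] by simp

lemma N_diff_commute: "f \<in> X \<Longrightarrow> g \<in> X \<Longrightarrow> N (\<lambda>x. f x - g x) = N (\<lambda>x. g x - f x)"
  using N_scale[OF X_diff[of f g], of "- 1"] by simp

lemma N_diff_triangle:
  "f \<in> X \<Longrightarrow> g \<in> X \<Longrightarrow> h \<in> X \<Longrightarrow> N (\<lambda>x. f x - h x) \<le> N (\<lambda>x. f x - g x) + N (\<lambda>x. g x - h x)"
  using N_add[OF X_diff[of f g] X_diff[of g h]] by simp

lemma N_zero: "N (\<lambda>x. 0) = 0"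
  using N_scale[OF X_zero, of 0] by simp

lemma X_sum: "finite I \<Longrightarrow> (\<And>i. i \<in> I \<Longrightarrow> f i \<in> X) \<Longrightarrow>
   (\<lambda>x. \<Sum>i\<in>I. f i x) \<in> X \<and> N (\<lambda>x. \<Sum>i\<in>I. f i x) \<le> (\<Sum>i\<in>I. N (f i))"
proof (induction I rule: finite_induct)
  case empty
  then show ?case by (simp add: X_zero N_zero)
next
  case (insert i I)
  then have *: "(\<lambda>x. \<Sum>i\<in>I. f i x) \<in> X" "N (\<lambda>x. \<Sum>i\<in>I. f i x) \<le> (\<Sum>i\<in>I. N (f i))" "f i \<in> X" by auto
  show ?case using insert(1,2) X_add[OF *(3,1)] N_add[OF *(3,1)] *(2) by simp
qed

lemma series_converges:
  assumes f: "\<And>k. f k \<in> X" "\<And>k::nat. N (f k) \<le> c * (1/2) ^ k" and c: "0 \<le> c"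
  obtains h where "h \<in> X" "(\<lambda>n. N (\<lambda>x. (\<Sum>k<n. f k x) - h x)) \<longlonglongrightarrow> 0"
    "\<And>n. (\<lambda>x. \<Sum>k<n. f k x) \<in> X" "\<And>n. N (\<lambda>x. \<Sum>k<n. f k x) \<le> 2 * c"
proof -
  define s where "s n x = (\<Sum>k<n. f k x)" for n :: nat and x
  have sX: "s n \<in> X" for n unfolding s_def using X_sum[of "{..<n}" f] f(1) by auto
  have est: "N (\<lambda>x. s m x - s n x) \<le> 2 * c * (1/2) ^ n" if "n \<le> m" for n m
  proof -
    have "s m x - s n x = (\<Sum>k\<in>{n..<m}. f k x)" for x
      using sum_diff_nat_ivl[of 0 n m "\<lambda>k. f k x"] that by (simp add: s_def atLeast0LessThan)
    then have "N (\<lambda>x. s m x - s n x) \<le> (\<Sum>k\<in>{n..<m}. N (f k))"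
      using X_sum[of "{n..<m}" f] f(1) by simp
    also have "\<dots> \<le> (\<Sum>k\<in>{n..<m}. c * (1/2) ^ k)" by (intro sum_mono f(2))
    also have "\<dots> = c * (\<Sum>k\<in>{n..<m}. (1/2) ^ k)" by (rule sum_distrib_left[symmetric])
    also have "\<dots> \<le> c * (2 * (1/2) ^ n)" using c sum_half_powers_le[OF that] by (intro mult_left_mono) auto
    finally show ?thesis by simp
  qed
  have "\<exists>h\<in>X. (\<lambda>n. N (\<lambda>x. s n x - h x)) \<longlonglongrightarrow> 0"
  proof (rule complete[OF sX])
    fix e :: real assume "0 < e"
    have "(\<lambda>n. 2 * c * (1/2) ^ n) \<longlonglongrightarrow> 2 * c * 0"
      by (intro tendsto_intros LIMSEQ_power_zero) auto
    then have "eventually (\<lambda>n. 2 * c * (1/2) ^ n < e) sequentially"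
      using \<open>0 < e\<close> by (intro order_tendstoD(2)) auto
    then obtain n0 where n0: "\<And>n. n \<ge> n0 \<Longrightarrow> 2 * c * (1/2) ^ n < e" unfolding eventually_sequentially by blast
    have "N (\<lambda>x. s m x - s n x) < e" if "m \<ge> n0" "n \<ge> n0" for m n
    proof (cases "n \<le> m")
      case True
      then show ?thesis using est[of n m] n0[of n] that by auto
    next
      case False
      then show ?thesis using est[of m n] n0[of m] that N_diff_commute[OF sX sX, of m n] by auto
    qed
    then show "\<exists>n0. \<forall>m\<ge>n0. \<forall>n\<ge>n0. N (\<lambda>x. s m x - s n x) < e" by blast
  qed
  then obtain h where h: "h \<in> X" "(\<lambda>n. N (\<lambda>x. s n x - h x)) \<longlonglongrightarrow> 0" by blast
  have "N (s n) \<le> 2 * c" for n using est[of 0 n] by (simp add: s_def[abs_def])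
  then show ?thesis using that[OF h(1) h(2)[unfolded s_def]] sX unfolding s_def by blast
qed

end

text \<open>\<open>cw\<close> is the constant of the admissibility condition. That it also bounds
  \<open>w\<close> from below holds as soon as some element of \<open>E\<close> has positive
  norm.\<close>

locale bf_group = weighted_group \<mu> \<Delta> V w
  for \<mu> :: "'g::{topological_group_add,t2_space} measure" and \<Delta> :: "'g \<Rightarrow> real"
    and V :: "'g set" and w :: "'g \<Rightarrow> real" +
  fixes E :: "('g \<Rightarrow> complex) set" and nE :: "('g \<Rightarrow> complex) \<Rightarrow> real" and cw :: real
  assumes BF: "solid_TI_BF_space \<mu> \<Delta> E nE"
    and cw_pos: "0 < cw"
    and cw_le: "cw \<le> w x"
    and cw_vE: "cw * vE \<Delta> E nE x \<le> w x"
begin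

lemma BF_space: "BF_space \<mu> E nE"
  using BF by (simp add: solid_TI_BF_space_def)

lemma E_measurable: "f \<in> E \<Longrightarrow> f \<in> borel_measurable borel"
proof -
  assume "f \<in> E"
  then have "f \<in> borel_measurable \<mu>" using BF_space[unfolded BF_space_def, THEN conjunct1] by blast
  then show ?thesis by simp
qed

lemma E_subspace: "is_subspace E"
  by (rule BF_space[unfolded BF_space_def, THEN conjunct2, THEN conjunct1])

lemma nE_nonneg: "f \<in> E \<Longrightarrow> 0 \<le> nE f"
  using BF_space[unfolded BF_space_def, THEN conjunct2, THEN conjunct2, THEN conjunct1] by blast

lemma nE_eq_0_iff: "f \<in> E \<Longrightarrow> nE f = 0 \<longleftrightarrow> (AE x in \<mu>. f x = 0)"
  using BF_space[unfolded BF_space_def, THEN conjunct2, THEN conjunct2, THEN conjunct1] unfolding ae_eq_def by blast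

lemma nE_add: "f \<in> E \<Longrightarrow> g \<in> E \<Longrightarrow> nE (\<lambda>x. f x + g x) \<le> nE f + nE g"
  using BF_space[unfolded BF_space_def, THEN conjunct2, THEN conjunct2, THEN conjunct2, THEN conjunct1] by blast

lemma nE_scale: "f \<in> E \<Longrightarrow> nE (\<lambda>x. c * f x) = cmod c * nE f"
  using BF_space[unfolded BF_space_def, THEN conjunct2, THEN conjunct2, THEN conjunct2, THEN conjunct2, THEN conjunct1] by blast

lemma E_complete:
  assumes "\<And>n. F n \<in> E" "\<And>\<epsilon>. 0 < \<epsilon> \<Longrightarrow> \<exists>N. \<forall>m\<ge>N. \<forall>n\<ge>N. nE (\<lambda>x. F m x - F n x) < \<epsilon>"
  obtains f where "f \<in> E" "(\<lambda>n. nE (\<lambda>x. F n x - f x)) \<longlonglongrightarrow> 0"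
proof -
  have "\<forall>F::nat \<Rightarrow> 'g \<Rightarrow> complex. (\<forall>n. F n \<in> E) \<and>
        (\<forall>\<epsilon>>0. \<exists>N. \<forall>m\<ge>N. \<forall>n\<ge>N. nE (\<lambda>x. F m x - F n x) < \<epsilon>) \<longrightarrow>
        (\<exists>f\<in>E. (\<lambda>n. nE (\<lambda>x. F n x - f x)) \<longlonglongrightarrow> 0)"
    by (rule BF_space[unfolded BF_space_def, THEN conjunct2, THEN conjunct2, THEN conjunct2, THEN conjunct2, THEN conjunct2, THEN conjunct1])
  then show ?thesis using assms that by blast
qed

sublocale seminormed_functions E nE
proof
  show "\<exists>f\<in>E. (\<lambda>n. nE (\<lambda>x. F n x - f x)) \<longlonglongrightarrow> 0"
    if "\<And>n. F n \<in> E" "\<And>\<epsilon>. 0 < \<epsilon> \<Longrightarrow> \<exists>n0. \<forall>m\<ge>n0. \<forall>n\<ge>n0. nE (\<lambda>x. F m x - F n x) < \<epsilon>" for F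
    using E_complete[OF that] by blast
qed (use E_subspace nE_nonneg nE_add nE_scale in auto)

lemma E_solid:
  assumes "f \<in> E" "g \<in> borel_measurable borel" "AE x in \<mu>. cmod (g x) \<le> cmod (f x)"
  shows "g \<in> E" "nE g \<le> nE f"
proof -
  have "g \<in> borel_measurable \<mu>" using assms by simp
  then have "g \<in> E \<and> nE g \<le> nE f"
    using BF[unfolded solid_TI_BF_space_def solid_def, THEN conjunct2, THEN conjunct1] assms by blast
  then show "g \<in> E" "nE g \<le> nE f" by auto
qed

lemma E_cmod:
  assumes f: "f \<in> E"
  shows "(\<lambda>x. complex_of_real (cmod (f x))) \<in> E" "nE (\<lambda>x. complex_of_real (cmod (f x))) \<le> nE f"
proof -
  note [measurable] = E_measurable[OF f]
  have m: "(\<lambda>x. complex_of_real (cmod (f x))) \<in> borel_measurable borel" by measurable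
  have le: "AE x in \<mu>. cmod (complex_of_real (cmod (f x))) \<le> cmod (f x)" by simp
  show "(\<lambda>x. complex_of_real (cmod (f x))) \<in> E" "nE (\<lambda>x. complex_of_real (cmod (f x))) \<le> nE f"
    by (rule E_solid[OF f m le])+
qed

lemma E_solid_add:
  assumes f: "f1 \<in> E" "f2 \<in> E" and g: "g \<in> borel_measurable borel"
    and le: "AE x in \<mu>. cmod (g x) \<le> cmod (f1 x) + cmod (f2 x)"
  shows "g \<in> E" "nE g \<le> nE f1 + nE f2"
proof -
  let ?a1 = "\<lambda>x. complex_of_real (cmod (f1 x))" and ?a2 = "\<lambda>x. complex_of_real (cmod (f2 x))"
  have s: "(\<lambda>x. ?a1 x + ?a2 x) \<in> E" by (intro X_add E_cmod f)
  have "AE x in \<mu>. cmod (g x) \<le> cmod (?a1 x + ?a2 x)"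
    using le by eventually_elim (simp flip: of_real_add)
  note S = E_solid[OF s g this]
  show "g \<in> E" by (rule S)
  show "nE g \<le> nE f1 + nE f2"
    using S(2) nE_add[OF E_cmod(1)[OF f(1)] E_cmod(1)[OF f(2)]] E_cmod(2)[OF f(1)] E_cmod(2)[OF f(2)]
    by linarith
qed

text \<open>The partial sums of nonnegative functions increase, so the excess \<open>d\<close> of
  \<open>f k\<close> over the limit \<open>\<phi>\<close> is at most \<open>s n - \<phi>\<close> in
  modulus for all later \<open>n\<close>. By solidity its norm is 0. Thus domination follows from
  norm convergence without passing to an almost everywhere convergent subsequence.\<close>

lemma E_series_dominated:
  assumes f: "\<And>k. f k \<in> E" "\<And>k x. 0 \<le> r k x" "\<And>k x. f k x = complex_of_real (r k x)"
    and norm: "\<And>k. nE (f k) \<le> (1 / 2) ^ k"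
  obtains \<phi> where "\<phi> \<in> E" "\<And>k. AE x in \<mu>. cmod (f k x) \<le> cmod (\<phi> x)"
proof -
  define s where "s n x = (\<Sum>k<n. f k x)" for n :: nat and x
  obtain \<phi> where \<phi>: "\<phi> \<in> E" "(\<lambda>n. nE (\<lambda>x. s n x - \<phi> x)) \<longlonglongrightarrow> 0" and sE: "\<And>n. s n \<in> E"
  proof (rule series_converges[where f=f and c=1, OF f(1)])
    show "nE (f k) \<le> 1 * (1/2) ^ k" for k using norm[of k] by simp
  qed (auto simp: s_def[abs_def] intro: that)
  show ?thesis
  proof (rule that[OF \<phi>(1)])
    fix k
    note [measurable] = E_measurable[OF \<phi>(1)] E_measurable[OF f(1)[of k]]
    define d where "d x = complex_of_real (max 0 (cmod (f k x) - cmod (\<phi> x)))" for x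
    have [measurable]: "d \<in> borel_measurable borel" unfolding d_def by measurable
    have le: "cmod (d x) \<le> cmod (s n x - \<phi> x)" if "k < n" for n x
    proof -
      have "s n x = complex_of_real (\<Sum>j<n. r j x)" by (simp add: s_def f(3))
      then have "cmod (s n x) = (\<Sum>j<n. r j x)" using f(2) by (simp only: norm_of_real) (simp add: sum_nonneg)
      moreover have "r k x \<le> (\<Sum>j<n. r j x)" using that f(2) by (intro member_le_sum) auto
      moreover have "cmod (f k x) = r k x" using f by simp
      moreover have "cmod (s n x) \<le> cmod (\<phi> x) + cmod (s n x - \<phi> x)" by (metis norm_triangle_sub)
      ultimately show ?thesis by (simp add: d_def)
    qed
    have dE: "d \<in> E" by (rule E_solid(1)[OF X_diff[OF sE[of "Suc k"] \<phi>(1)]]) (use le in auto)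
    have "nE d \<le> nE (\<lambda>x. s n x - \<phi> x)" if "k < n" for n
      by (rule E_solid(2)[OF X_diff[OF sE \<phi>(1)]]) (use le that in auto)
    then have "nE d \<le> 0"
      by (intro LIMSEQ_le_const[OF \<phi>(2)]) (auto intro!: exI[of _ "Suc k"])
    then have "nE d = 0" using nE_nonneg[OF dE] by simp
    then have "AE x in \<mu>. d x = 0" using nE_eq_0_iff[OF dE] by simp
    then show "AE x in \<mu>. cmod (f k x) \<le> cmod (\<phi> x)" by eventually_elim (simp add: d_def)
  qed
qed

section \<open>Convolving elements of \<open>E\<close> with weighted integrable kernels\<close>

lemma nconv_mono_AE:
  assumes "AE x in \<mu>. cmod (f x) \<le> cmod (g x)" "AE x in \<mu>. h x \<le> k x"
  shows "nconv \<mu> f h x \<le> nconv \<mu> g k x"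
  unfolding nconv_def
proof (rule nn_integral_mono_AE)
  show "AE y in \<mu>. ennreal (cmod (f y)) * h (- y + x) \<le> ennreal (cmod (g y)) * k (- y + x)"
    using assms(1) AE_minus_add[OF assms(2), of x] by eventually_elim (auto intro!: mult_mono)
qed

text \<open>By \<open>cw_vE\<close>, weighted L1 lies in the L1 space with weight \<open>vE\<close>,
  so the assumed inclusion applies to \<open>h'\<close>. Both factors being nonnegative, the complex
  convolution and the extended one agree wherever the former is defined.\<close>

lemma nconv_in_E:
  assumes f: "f \<in> E" and h[measurable]: "h \<in> borel_measurable borel"
    and int: "wint h < \<infinity>"
  obtains F where "F \<in> E" "AE x in \<mu>. nconv \<mu> f h x = ennreal (cmod (F x))"
proof -
  note [measurable] = E_measurable[OF f]
  define f' where "f' x = complex_of_real (cmod (f x))" for x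
  have f': "f' \<in> E" unfolding f'_def by (rule E_cmod(1)[OF f])
  \<comment> \<open>\<open>enn2real\<close> sends infinity to 0; since \<open>wint h\<close> is
    finite and \<open>w\<close> positive, this changes \<open>h\<close> on a null set only.\<close>
  define h' where "h' x = complex_of_real (enn2real (h x))" for x
  have [measurable]: "h' \<in> borel_measurable borel" unfolding h'_def by measurable
  have "AE x in \<mu>. h x * ennreal (w x) \<noteq> \<infinity>"
    by (rule nn_integral_PInf_AE) (use int in auto)
  then have hfin: "AE x in \<mu>. h x = ennreal (enn2real (h x))"
  proof eventually_elim
    case (elim x)
    then have "h x < top" using w_pos[of x] by (auto simp: ennreal_mult_eq_top_iff less_top)
    then show ?case by simp
  qed
  have "(\<integral>\<^sup>+ y. ennreal (cmod (h' y) * vE \<Delta> E nE y) \<partial>\<mu>) \<le> (\<integral>\<^sup>+ y. ennreal (1 / cw) * (h y * ennreal (w y)) \<partial>\<mu>)"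
  proof (rule nn_integral_mono_AE, use hfin in eventually_elim)
    case (elim y)
    have "vE \<Delta> E nE y \<le> 1 / cw * w y" using cw_vE[of y] cw_pos by (simp add: field_simps)
    then have "ennreal (cmod (h' y) * vE \<Delta> E nE y) \<le> ennreal (enn2real (h y) * (1 / cw * w y))"
      unfolding h'_def norm_of_real abs_of_nonneg[OF enn2real_nonneg]
      by (intro ennreal_leI mult_left_mono) auto
    also have "\<dots> = ennreal (1 / cw) * (ennreal (enn2real (h y)) * ennreal (w y))"
      using cw_pos by (simp add: ennreal_mult[symmetric] mult.left_commute)
    finally show ?case using elim by simp
  qed
  also have "\<dots> = ennreal (1 / cw) * (wint h)" by (rule nn_integral_cmult) simp
  also have "\<dots> < \<infinity>" using int by (simp add: ennreal_mult_less_top)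
  finally have fin: "(\<integral>\<^sup>+ y. ennreal (cmod (h' y) * vE \<Delta> E nE y) \<partial>\<mu>) < \<infinity>" .
  have "\<forall>h f. h \<in> borel_measurable \<mu> \<and> (\<integral>\<^sup>+ y. ennreal (cmod (h y) * vE \<Delta> E nE y) \<partial>\<mu>) < \<infinity> \<and> f \<in> E
        \<longrightarrow> conv_defined \<mu> f h \<and> conv \<mu> f h \<in> E"
    by (rule BF[unfolded solid_TI_BF_space_def, THEN conjunct2, THEN conjunct2, THEN conjunct2, THEN conjunct2])
  moreover have "h' \<in> borel_measurable \<mu>" by simp
  ultimately have cd: "conv_defined \<mu> f' h'" and cE: "conv \<mu> f' h' \<in> E" using fin f' by blast+
  show ?thesis
  proof (rule that[OF cE])
    show "AE x in \<mu>. nconv \<mu> f h x = ennreal (cmod (conv \<mu> f' h' x))"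
      using cd unfolding conv_defined_def
    proof eventually_elim
      case (elim x)
      define u where "u y = cmod (f y) * enn2real (h (- y + x))" for y
      have u: "f' y * h' (- y + x) = complex_of_real (u y)" for y by (simp add: f'_def h'_def u_def)
      have iu: "integrable \<mu> u"
        using elim unfolding u by (simp add: complex_of_real_integrable_eq)
      have u0: "0 \<le> u y" for y by (simp add: u_def)
      have "nconv \<mu> f h x = (\<integral>\<^sup>+ y. ennreal (u y) \<partial>\<mu>)"
        unfolding nconv_def
      proof (rule nn_integral_cong_AE)
        show "AE y in \<mu>. ennreal (cmod (f y)) * h (- y + x) = ennreal (u y)"
          using AE_minus_add[OF hfin, of x] by eventually_elim (simp add: u_def ennreal_mult)
      qed
      also have "\<dots> = ennreal (\<integral>y. u y \<partial>\<mu>)" by (rule nn_integral_eq_integral[OF iu]) (simp add: u0)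
      also have "(\<integral>y. u y \<partial>\<mu>) = cmod (conv \<mu> f' h' x)"
        unfolding conv_def u by (simp add: u0 integral_nonneg_AE)
      finally show ?case .
    qed
  qed
qed

text \<open>Only \<open>E * L\<^sup>1\<^sub>v \<subseteq> E\<close> is assumed, not a norm estimate. A bilinear positive map is automatically
  bounded: a counterexample sequence \<open>f\<^sub>k, h\<^sub>k\<close> sums to \<open>\<phi>, H\<close> whose convolution dominates every
  \<open>4\<^sup>-\<^sup>k f\<^sub>k * h\<^sub>k\<close>.\<close>
lemma nconv_bound:
  obtains C where "0 < C" "\<And>f h b F. f \<in> E \<Longrightarrow> h \<in> borel_measurable borel \<Longrightarrow> 0 < b \<Longrightarrow>
     (wint h) \<le> ennreal b \<Longrightarrow> F \<in> E \<Longrightarrow>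
     AE x in \<mu>. nconv \<mu> f h x = ennreal (cmod (F x)) \<Longrightarrow> nE F \<le> C * b * nE f"
proof -
  have "\<exists>C. \<forall>f h F. f \<in> E \<longrightarrow> h \<in> borel_measurable borel \<longrightarrow> nE f \<le> 1 \<longrightarrow>
     (wint h) \<le> 1 \<longrightarrow> F \<in> E \<longrightarrow>
     (AE x in \<mu>. nconv \<mu> f h x = ennreal (cmod (F x))) \<longrightarrow> nE F \<le> C"
  proof (rule ccontr)
    assume neg: "\<not> ?thesis"
    \<comment> \<open>The factor \<open>4 ^ k\<close> survives scaling both arguments by
      \<open>(1/2)^k\<close>, and the remaining \<open>real k\<close> makes the norm of one single
      element exceed every integer.\<close>
    have "\<forall>k::nat. \<exists>f h F. f \<in> E \<and> h \<in> borel_measurable borel \<and> nE f \<le> 1 \<and>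
       (wint h) \<le> 1 \<and> F \<in> E \<and>
       (AE x in \<mu>. nconv \<mu> f h x = ennreal (cmod (F x))) \<and> \<not> nE F \<le> 4 ^ k * real k"
    proof
      fix k :: nat
      show "\<exists>f h F. f \<in> E \<and> h \<in> borel_measurable borel \<and> nE f \<le> 1 \<and>
       (wint h) \<le> 1 \<and> F \<in> E \<and>
       (AE x in \<mu>. nconv \<mu> f h x = ennreal (cmod (F x))) \<and> \<not> nE F \<le> 4 ^ k * real k"
        using neg[unfolded not_ex, rule_format, of "4 ^ k * real k"] by (simp only: not_all not_imp)
    qed
    then obtain f h F where *: "\<And>k::nat. f k \<in> E \<and> h k \<in> borel_measurable borel \<and> nE (f k) \<le> 1 \<and>
       (wint (h k)) \<le> 1 \<and> F k \<in> E \<and>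
       (AE x in \<mu>. nconv \<mu> (f k) (h k) x = ennreal (cmod (F k x))) \<and> \<not> nE (F k) \<le> 4 ^ k * real k"
      unfolding choice_iff by blast
    then have f: "f k \<in> E" "nE (f k) \<le> 1" and h[measurable]: "h k \<in> borel_measurable borel"
      and h1: "wint (h k) \<le> 1" and F: "F k \<in> E"
      and FF: "AE x in \<mu>. nconv \<mu> (f k) (h k) x = ennreal (cmod (F k x))"
      and big: "4 ^ k * real k < nE (F k)" for k by (auto simp: not_le)
    have fm[measurable]: "f k \<in> borel_measurable borel" for k by (rule E_measurable[OF f(1)])
    have fm'[measurable]: "F k \<in> borel_measurable borel" for k by (rule E_measurable[OF F])
    define r where "r k x = (1/2)^k * cmod (f k x)" for k x
    define g where "g k x = complex_of_real (r k x)" for k x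
    have gE: "g k \<in> E" "nE (g k) \<le> (1/2)^k" for k
    proof -
      have le: "AE x in \<mu>. cmod (g k x) \<le> cmod ((1/2)^k * f k x)"
        by (simp add: g_def r_def norm_mult norm_power norm_divide)
      have m: "g k \<in> borel_measurable borel" unfolding g_def r_def by measurable
      note S = E_solid[OF X_scale[OF f(1)] m le]
      show "g k \<in> E" by (rule S)
      have "nE (g k) \<le> (1/2)^k * nE (f k)" using S(2) nE_scale[OF f(1)] by (simp add: norm_power norm_divide)
      also have "\<dots> \<le> (1/2)^k * 1" using f(2) by (intro mult_left_mono) auto
      finally show "nE (g k) \<le> (1/2)^k" by simp
    qed
    obtain \<phi> where \<phi>: "\<phi> \<in> E" "\<And>k. AE x in \<mu>. cmod (g k x) \<le> cmod (\<phi> x)"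
      by (rule E_series_dominated[of g r]) (use gE in \<open>auto simp: g_def r_def\<close>)
    define H where "H x = (\<Sum>k. ennreal ((1/2)^k) * h k x)" for x
    have [measurable]: "H \<in> borel_measurable borel" unfolding H_def by measurable
    have "wint H = (\<integral>\<^sup>+ x. (\<Sum>k. ennreal ((1/2)^k) * (h k x * ennreal (w x))) \<partial>\<mu>)"
      by (simp add: H_def ennreal_suminf_multc[symmetric] mult.assoc)
    also have "\<dots> = (\<Sum>k. \<integral>\<^sup>+ x. ennreal ((1/2)^k) * (h k x * ennreal (w x)) \<partial>\<mu>)"
      by (rule nn_integral_suminf) simp
    also have "\<dots> = (\<Sum>k. ennreal ((1/2)^k) * (wint (h k)))"
      by (subst nn_integral_cmult) auto
    also have "\<dots> \<le> (\<Sum>k. ennreal ((1/2)^k) * 1)"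
      by (intro suminf_le mult_left_mono h1) auto
    also have "\<dots> = ennreal (\<Sum>k. (1/2)^k)"
      by (simp, intro suminf_ennreal2) (auto intro: summable_geometric)
    also have "\<dots> < \<infinity>" by simp
    finally have Hfin: "wint H < \<infinity>" .
    obtain G where G: "G \<in> E" "AE x in \<mu>. nconv \<mu> \<phi> H x = ennreal (cmod (G x))"
      by (rule nconv_in_E[OF \<phi>(1) _ Hfin]) auto
    have "real k < nE G" for k :: nat
    proof -
      have "AE x in \<mu>. cmod ((1/4)^k * F k x) \<le> cmod (G x)"
        using FF[of k] G(2)
      proof eventually_elim
        case (elim x)
        have "ennreal (cmod ((1/4)^k * F k x)) = ennreal ((1/4)^k) * nconv \<mu> (f k) (h k) x"
          by (simp add: elim norm_mult norm_power norm_divide ennreal_mult)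
        also have "\<dots> = nconv \<mu> (g k) (\<lambda>x. ennreal ((1/2)^k) * h k x) x"
        proof -
          have "ennreal (cmod (g k y)) = ennreal ((1/2)^k) * ennreal (cmod (f k y))" for y
            by (simp add: g_def r_def norm_mult norm_power norm_divide ennreal_mult)
          moreover have "ennreal ((1/4)^k) = ennreal ((1/2)^k) * ennreal ((1/2)^k)"
            by (simp add: ennreal_mult[symmetric] power_mult_distrib[symmetric])
          ultimately show ?thesis
            unfolding nconv_def by (subst nn_integral_cmult[symmetric]) (auto simp: ac_simps)
        qed
        also have "\<dots> \<le> nconv \<mu> \<phi> H x"
        proof (rule nconv_mono_AE[OF \<phi>(2)])
          have "ennreal ((1/2)^k) * h k x \<le> H x" for x
            unfolding H_def using sum_le_suminf[of "\<lambda>k. ennreal ((1/2)^k) * h k x" "{k}"] by simp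
          then show "AE x in \<mu>. ennreal ((1/2)^k) * h k x \<le> H x" by simp
        qed
        also have "\<dots> = ennreal (cmod (G x))" by (rule elim)
        finally show ?case by simp
      qed
      from E_solid(2)[OF G(1) _ this] have "nE (\<lambda>x. (1/4)^k * F k x) \<le> nE G" by simp
      then have "(1/4)^k * nE (F k) \<le> nE G" by (simp add: nE_scale[OF F] norm_power norm_divide)
      moreover have "(1/4)^k * (4 ^ k * real k) < (1/4)^k * nE (F k)"
        using big[of k] by (intro mult_strict_left_mono) auto
      moreover have "(1/4::real)^k * (4 ^ k * real k) = real k" by (simp add: power_divide)
      ultimately show ?thesis by simp
    qed
    then show False by (metis not_less_iff_gr_or_eq reals_Archimedean2)
  qed
  then obtain C where C: "\<And>f h F. f \<in> E \<Longrightarrow> h \<in> borel_measurable borel \<Longrightarrow> nE f \<le> 1 \<Longrightarrow>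
     (wint h) \<le> 1 \<Longrightarrow> F \<in> E \<Longrightarrow>
     (AE x in \<mu>. nconv \<mu> f h x = ennreal (cmod (F x))) \<Longrightarrow> nE F \<le> C" by blast
  show ?thesis
  proof (rule that[of "max 1 C"])
    fix f h b F
    assume f: "f \<in> E" and h[measurable]: "h \<in> borel_measurable borel" and b: "0 < b"
      and int: "wint h \<le> ennreal b" and F: "F \<in> E"
      and eq: "AE x in \<mu>. nconv \<mu> f h x = ennreal (cmod (F x))"
    note [measurable] = E_measurable[OF f]
    show "nE F \<le> max 1 C * b * nE f"
    proof (cases "nE f = 0")
      case True
      \<comment> \<open>Here \<open>f\<close> cannot be normalised, but it vanishes almost
        everywhere and so does \<open>F\<close>.\<close>
      then have f0: "AE x in \<mu>. f x = 0" using nE_eq_0_iff[OF f] by simp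
      have "nconv \<mu> f h x = 0" for x
      proof -
        have "nconv \<mu> f h x = (\<integral>\<^sup>+ y. 0 \<partial>\<mu>)"
          unfolding nconv_def by (rule nn_integral_cong_AE) (use f0 in eventually_elim, simp)
        then show ?thesis by simp
      qed
      then have "AE x in \<mu>. F x = 0" using eq by simp
      then show ?thesis using nE_eq_0_iff[OF F] True by simp
    next
      case False
      then have a: "0 < nE f" using nE_nonneg[OF f] by simp
      define a where "a = nE f"
      have a0: "0 < a" using a by (simp add: a_def)
      have "nE (\<lambda>x. complex_of_real (1 / (a * b)) * F x) \<le> C"
      proof (rule C[of "\<lambda>x. complex_of_real (1 / a) * f x" "\<lambda>x. ennreal (1 / b) * h x"])
        show "(\<lambda>x. complex_of_real (1 / a) * f x) \<in> E" by (rule X_scale[OF f])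
        show "nE (\<lambda>x. complex_of_real (1 / a) * f x) \<le> 1"
          unfolding nE_scale[OF f] using a0 by (simp add: a_def norm_divide)
        have "(\<integral>\<^sup>+ x. ennreal (1 / b) * h x * ennreal (w x) \<partial>\<mu>) = ennreal (1 / b) * (wint h)"
          unfolding mult.assoc by (rule nn_integral_cmult) simp
        also have "\<dots> \<le> ennreal (1 / b) * ennreal b" by (intro mult_left_mono int) simp
        also have "\<dots> = 1" using b by (simp add: ennreal_mult[symmetric])
        finally show "(\<integral>\<^sup>+ x. ennreal (1 / b) * h x * ennreal (w x) \<partial>\<mu>) \<le> 1" .
        show "(\<lambda>x. complex_of_real (1 / (a * b)) * F x) \<in> E" by (rule X_scale[OF F])
        show "AE x in \<mu>. nconv \<mu> (\<lambda>x. complex_of_real (1 / a) * f x) (\<lambda>x. ennreal (1 / b) * h x) x = ennreal (cmod (complex_of_real (1 / (a * b)) * F x))"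
          using eq
        proof eventually_elim
          case (elim x)
          have "nconv \<mu> (\<lambda>x. complex_of_real (1 / a) * f x) (\<lambda>x. ennreal (1 / b) * h x) x
              = (\<integral>\<^sup>+ y. ennreal (1 / (a * b)) * (ennreal (cmod (f y)) * h (- y + x)) \<partial>\<mu>)"
            unfolding nconv_def
          proof (rule nn_integral_cong)
            fix y
            have "ennreal (cmod (complex_of_real (1 / a) * f y)) = ennreal (1 / a) * ennreal (cmod (f y))"
              using a0 by (simp only: norm_mult norm_of_real) (subst ennreal_mult, auto)
            moreover have "ennreal (1 / (a * b)) = ennreal (1 / a) * ennreal (1 / b)"
              using a0 b by (simp add: ennreal_mult[symmetric])
            ultimately show "ennreal (cmod (complex_of_real (1 / a) * f y)) * (ennreal (1 / b) * h (- y + x))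
              = ennreal (1 / (a * b)) * (ennreal (cmod (f y)) * h (- y + x))" by (simp only: ac_simps)
          qed
          also have "\<dots> = ennreal (1 / (a * b)) * nconv \<mu> f h x"
            unfolding nconv_def by (rule nn_integral_cmult) simp
          also have "\<dots> = ennreal (cmod (complex_of_real (1 / (a * b)) * F x))"
            unfolding elim norm_mult norm_of_real using a0 b by (subst ennreal_mult) auto
          finally show ?case .
        qed
      qed simp
      then have "1 / (a * b) * nE F \<le> C" unfolding nE_scale[OF F] using a0 b by (simp add: norm_divide norm_mult)
      then have "nE F \<le> C * (a * b)" using a0 b by (simp add: field_simps)
      also have "\<dots> \<le> max 1 C * (a * b)" using a0 b by (intro mult_right_mono) auto
      finally show ?thesis by (simp add: a_def ac_simps)
    qed
  qed simp
qed

lemma nconv_bounded_in_E: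
  obtains C where "0 < C" "\<And>f h b. f \<in> E \<Longrightarrow> h \<in> borel_measurable borel \<Longrightarrow> 0 < b \<Longrightarrow>
     (wint h) \<le> ennreal b \<Longrightarrow>
     \<exists>F\<in>E. nE F \<le> C * b * nE f \<and> (AE x in \<mu>. nconv \<mu> f h x = ennreal (cmod (F x)))"
proof -
  obtain C where C: "0 < C" "\<And>f h b F. f \<in> E \<Longrightarrow> h \<in> borel_measurable borel \<Longrightarrow> 0 < b \<Longrightarrow>
     (wint h) \<le> ennreal b \<Longrightarrow> F \<in> E \<Longrightarrow>
     AE x in \<mu>. nconv \<mu> f h x = ennreal (cmod (F x)) \<Longrightarrow> nE F \<le> C * b * nE f"
    using nconv_bound by blast
  show ?thesis
  proof (rule that[OF C(1)])
    fix f h b assume *: "f \<in> E" "h \<in> borel_measurable borel" "0 < b"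
     "wint h \<le> ennreal b"
    then have "wint h < \<infinity>" by (auto intro: le_less_trans)
    from nconv_in_E[OF *(1,2) this] obtain F where "F \<in> E" "AE x in \<mu>. nconv \<mu> f h x = ennreal (cmod (F x))" .
    then show "\<exists>F\<in>E. nE F \<le> C * b * nE f \<and> (AE x in \<mu>. nconv \<mu> f h x = ennreal (cmod (F x)))"
      using C(2)[OF *] by blast
  qed
qed

end

section \<open>Bounded inverses\<close>

locale function_banach = seminormed_functions X N
  for X :: "('a \<Rightarrow> complex) set" and N :: "('a \<Rightarrow> complex) \<Rightarrow> real" +
  assumes N_zero_iff: "f \<in> X \<Longrightarrow> N f = 0 \<longleftrightarrow> f = (\<lambda>x. 0)"
begin

text \<open>The value 0 off \<open>X\<close> is a convention: symmetry and nonnegativity are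
  required of all arguments, the other metric axioms only on \<open>X\<close>.\<close>

definition dX :: "('a \<Rightarrow> complex) \<Rightarrow> ('a \<Rightarrow> complex) \<Rightarrow> real" where
  "dX f g = (if f \<in> X \<and> g \<in> X then N (\<lambda>x. f x - g x) else 0)"

lemma Metric_space_X: "Metric_space X dX"
proof
  show "0 \<le> dX f g" for f g by (simp add: dX_def N_nonneg X_diff)
  show "dX f g = dX g f" for f g using N_diff_commute by (auto simp: dX_def)
  show "dX f g = 0 \<longleftrightarrow> f = g" if "f \<in> X" "g \<in> X" for f g
    using that N_zero_iff[OF X_diff[OF that]] by (simp add: dX_def fun_eq_iff)
  show "dX f h \<le> dX f g + dX g h" if "f \<in> X" "g \<in> X" "h \<in> X" for f g h
    using that N_diff_triangle by (simp add: dX_def)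
qed

sublocale MX: Metric_space X dX by (rule Metric_space_X)

lemma mcomplete_X: "MX.mcomplete"
  unfolding MX.mcomplete_def
proof (intro allI impI)
  fix \<sigma> assume c: "MX.MCauchy \<sigma>"
  then have \<sigma>: "\<sigma> n \<in> X" for n by (auto simp: MX.MCauchy_def)
  have "\<exists>f\<in>X. (\<lambda>n. N (\<lambda>x. \<sigma> n x - f x)) \<longlonglongrightarrow> 0"
  proof (rule complete[OF \<sigma>])
    fix e :: real assume "0 < e"
    then obtain n0 where "\<And>n n'. n0 \<le> n \<Longrightarrow> n0 \<le> n' \<Longrightarrow> dX (\<sigma> n) (\<sigma> n') < e"
      using c unfolding MX.MCauchy_def by blast
    then show "\<exists>n0. \<forall>m\<ge>n0. \<forall>n\<ge>n0. N (\<lambda>x. \<sigma> m x - \<sigma> n x) < e"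
      using \<sigma> by (auto simp: dX_def)
  qed
  then obtain f where f: "f \<in> X" "(\<lambda>n. N (\<lambda>x. \<sigma> n x - f x)) \<longlonglongrightarrow> 0" by blast
  have "\<exists>n0. \<forall>n\<ge>n0. \<sigma> n \<in> X \<and> dX (\<sigma> n) f < e" if "0 < e" for e
  proof -
    have "eventually (\<lambda>n. N (\<lambda>x. \<sigma> n x - f x) < e) sequentially"
      using f(2) that by (intro order_tendstoD(2))
    then show ?thesis using \<sigma> f(1) by (auto simp: eventually_sequentially dX_def)
  qed
  then show "\<exists>x. limitin MX.mtopology \<sigma> x sequentially"
    using f(1) by (auto simp: MX.limit_metric_sequentially)
qed

context
  fixes A :: "('a \<Rightarrow> complex) \<Rightarrow> ('a \<Rightarrow> complex)" and B :: real
  assumes bij: "bij_betw A X X"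
    and A_add: "\<And>f g. f \<in> X \<Longrightarrow> g \<in> X \<Longrightarrow> A (\<lambda>x. f x + g x) = (\<lambda>x. A f x + A g x)"
    and A_scale: "\<And>c f. f \<in> X \<Longrightarrow> A (\<lambda>x. c * f x) = (\<lambda>x. c * A f x)"
    and A_bound: "\<And>f. f \<in> X \<Longrightarrow> N (A f) \<le> B * N f"
begin

lemma A_in: "f \<in> X \<Longrightarrow> A f \<in> X"
  using bij by (auto simp: bij_betw_def)

lemma A_diff: "f \<in> X \<Longrightarrow> g \<in> X \<Longrightarrow> A (\<lambda>x. f x - g x) = (\<lambda>x. A f x - A g x)"
  using A_add[OF _ X_scale[of g "- 1"], of f] A_scale[of g "- 1"] by simp

text \<open>The Baire half of the open mapping theorem. The closures of the images of balls cover
  \<open>X\<close>, so for some \<open>n\<close> the image of the ball of radius \<open>n\<close> is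
  dense in a ball around \<open>y0\<close>. A small multiple of \<open>y\<close> is written as a
  difference of two points of that ball, both are approximated, and the preimages are subtracted and
  scaled back.\<close>

lemma approx_solution:
  "\<exists>M>0. \<forall>y\<in>X. \<forall>\<epsilon>>0. \<exists>f\<in>X. N f \<le> M * N y \<and> N (\<lambda>x. y x - A f x) < \<epsilon>"
proof -
  define D where "D n = A ` {f \<in> X. N f \<le> real n}" for n
  have DX: "D n \<subseteq> X" for n by (auto simp: D_def A_in)
  define cl where "cl n = MX.mtopology closure_of D n" for n
  have "\<exists>n. MX.mtopology interior_of cl n \<noteq> {}"
  proof (rule ccontr)
    assume neg: "\<not> ?thesis"
    have "MX.mtopology interior_of \<Union>(range cl) = {}"
      by (rule MX.metric_Baire_category_alt[OF mcomplete_X]) (use neg in \<open>auto simp: cl_def\<close>)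
    moreover have "\<Union>(range cl) = X"
    proof
      show "\<Union>(range cl) \<subseteq> X" using closure_of_subset_topspace[of MX.mtopology] by (auto simp: cl_def)
      show "X \<subseteq> \<Union>(range cl)"
      proof
        fix y assume "y \<in> X"
        then obtain f where f: "f \<in> X" "y = A f" using bij by (auto simp: bij_betw_def)
        obtain n :: nat where "N f \<le> real n" using real_arch_simple by blast
        then have "y \<in> D n" using f by (auto simp: D_def)
        then have "y \<in> cl n" using closure_of_subset[of "D n" MX.mtopology] DX by (auto simp: cl_def)
        then show "y \<in> \<Union>(range cl)" by blast
      qed
    qed
    ultimately show False using interior_of_topspace[of MX.mtopology] X_zero by auto
  qed
  then obtain n y0 where y0: "y0 \<in> MX.mtopology interior_of cl n" by blast
  have "openin MX.mtopology (MX.mtopology interior_of cl n)" by simp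
  then obtain r where r: "0 < r" "MX.mball y0 r \<subseteq> MX.mtopology interior_of cl n"
    using y0 unfolding MX.openin_mtopology by blast
  have y0X: "y0 \<in> X" using y0 interior_of_subset_topspace[of MX.mtopology] by auto
  have near: "\<exists>f\<in>X. N f \<le> real n \<and> N (\<lambda>x. y x - A f x) < e" if "y \<in> X" "N (\<lambda>x. y0 x - y x) < r" "0 < e" for y e
  proof -
    have "y \<in> MX.mball y0 r" using that y0X by (simp add: MX.in_mball dX_def)
    then have "y \<in> cl n" using r(2) interior_of_subset[of MX.mtopology "cl n"] by blast
    then have "\<exists>z. z \<in> D n \<and> z \<in> MX.mball y e" using that(3) by (auto simp: cl_def MX.metric_closure_of)
    then obtain z where "z \<in> D n" "z \<in> MX.mball y e" by blast
    then show ?thesis using that(1) by (auto simp: D_def MX.in_mball dX_def A_in)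
  qed
  \<comment> \<open>The two preimages have norm at most \<open>n\<close> each and are divided by
    \<open>t\<close>, which gives \<open>4 * real n / r\<close> times \<open>N y\<close>; the 1
    makes \<open>M\<close> positive.\<close>
  define M where "M = 4 * real n / r + 1"
  have M: "0 < M" using r(1) by (simp add: M_def add_nonneg_pos)
  have "\<exists>f\<in>X. N f \<le> M * N y \<and> N (\<lambda>x. y x - A f x) < e" if y: "y \<in> X" and e: "0 < e" for y e
  proof (cases "N y = 0")
    case True
    then have "y = (\<lambda>x. 0)" using N_zero_iff[OF y] by simp
    moreover have "A (\<lambda>x. 0) = (\<lambda>x. 0)" using A_scale[OF X_zero, of 0] by simp
    ultimately show ?thesis using e by (intro bexI[OF _ X_zero]) (simp add: N_zero)
  next
    case False
    then have Ny: "0 < N y" using N_nonneg[OF y] by simp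
    \<comment> \<open>This scale puts \<open>y0 + t y\<close> at distance \<open>r / 2\<close> from
      \<open>y0\<close>.\<close>
    define t where "t = r / (2 * N y)"
    have t: "0 < t" using r(1) Ny by (simp add: t_def)
    \<comment> \<open>Two errors below \<open>e'\<close>, divided by \<open>t\<close>, add up to
      less than \<open>e\<close>.\<close>
    define e' where "e' = e * t / 2"
    have e': "0 < e'" using e t by (simp add: e'_def)
    define z where "z x = y0 x + complex_of_real t * y x" for x
    have zX: "z \<in> X" unfolding z_def by (intro X_add X_scale y y0X)
    have "N (\<lambda>x. y0 x - z x) = cmod (- complex_of_real t) * N y"
      using N_scale[OF y, of "- complex_of_real t"] by (simp add: z_def)
    also have "\<dots> = t * N y" using t by simp
    also have "\<dots> = r / 2" using Ny by (simp add: t_def)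
    finally have "N (\<lambda>x. y0 x - z x) < r" using r(1) by simp
    from near[OF zX this e'] obtain f1 where f1: "f1 \<in> X" "N f1 \<le> real n" "N (\<lambda>x. z x - A f1 x) < e'" by blast
    have "N (\<lambda>x. y0 x - y0 x) < r" using r(1) by (simp add: N_zero)
    from near[OF y0X this e'] obtain f2 where f2: "f2 \<in> X" "N f2 \<le> real n" "N (\<lambda>x. y0 x - A f2 x) < e'" by blast
    define f where "f x = complex_of_real (1 / t) * (f1 x - f2 x)" for x
    have fX: "f \<in> X" unfolding f_def by (intro X_scale X_diff f1 f2)
    have "N f = 1 / t * N (\<lambda>x. f1 x - f2 x)"
      unfolding f_def N_scale[OF X_diff[OF f1(1) f2(1)]] using t by (simp add: norm_divide)
    also have "\<dots> \<le> 1 / t * (real n + real n)"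
      using N_diff[OF f1(1) f2(1)] f1(2) f2(2) t by (intro mult_left_mono) auto
    also have "\<dots> = 4 * real n / r * N y" using Ny r(1) by (simp add: t_def field_simps)
    also have "\<dots> \<le> M * N y" using Ny by (intro mult_right_mono) (auto simp: M_def)
    finally have Nf: "N f \<le> M * N y" .
    have Af: "A f x = complex_of_real (1 / t) * (A f1 x - A f2 x)" for x
      unfolding f_def A_scale[OF X_diff[OF f1(1) f2(1)]] A_diff[OF f1(1) f2(1)] by simp
    have "y x - A f x = complex_of_real (1 / t) * ((z x - A f1 x) - (y0 x - A f2 x))" for x
      unfolding Af using t by (simp add: z_def field_simps)
    then have "N (\<lambda>x. y x - A f x) = cmod (complex_of_real (1 / t)) * N (\<lambda>x. (z x - A f1 x) - (y0 x - A f2 x))"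
      using N_scale[OF X_diff[OF X_diff[OF zX A_in[OF f1(1)]] X_diff[OF y0X A_in[OF f2(1)]]]] by (simp only:)
    also have "\<dots> = 1 / t * N (\<lambda>x. (z x - A f1 x) - (y0 x - A f2 x))" using t by (simp add: norm_divide)
    also have "\<dots> < 1 / t * (e' + e')"
      using N_diff[OF X_diff[OF zX A_in[OF f1(1)]] X_diff[OF y0X A_in[OF f2(1)]]] f1(3) f2(3) t
      by (intro mult_strict_left_mono) auto
    also have "\<dots> = e" using t by (simp add: e'_def)
    finally show ?thesis using fX Nf by blast
  qed
  then show ?thesis using M by blast
qed

text \<open>Successive approximation: each residual is solved approximately with half the previous
  tolerance, so the corrections form a geometrically decaying series. Its sum \<open>h\<close>
  satisfies \<open>A h = A f\<close> by boundedness of \<open>A\<close>, injectivity gives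
  \<open>h = f\<close>, and the geometric series supplies the factor 2.\<close>

lemma bounded_inverse: "\<exists>C>0. \<forall>f\<in>X. N f \<le> C * N (A f)"
proof -
  obtain M where M: "0 < M" "\<And>y e. y \<in> X \<Longrightarrow> 0 < e \<Longrightarrow> \<exists>f\<in>X. N f \<le> M * N y \<and> N (\<lambda>x. y x - A f x) < e"
    using approx_solution by blast
  define \<phi> where "\<phi> y e = (SOME f. f \<in> X \<and> N f \<le> M * N y \<and> N (\<lambda>x. y x - A f x) < e)" for y e
  have \<phi>: "\<phi> y e \<in> X" "N (\<phi> y e) \<le> M * N y" "N (\<lambda>x. y x - A (\<phi> y e) x) < e" if "y \<in> X" "0 < e" for y e
  proof -
    have "\<exists>f. f \<in> X \<and> N f \<le> M * N y \<and> N (\<lambda>x. y x - A f x) < e" using M(2)[OF that] by blast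
    from someI_ex[OF this] show "\<phi> y e \<in> X" "N (\<phi> y e) \<le> M * N y" "N (\<lambda>x. y x - A (\<phi> y e) x) < e"
      unfolding \<phi>_def by auto
  qed
  have "N f \<le> 2 * M * N (A f)" if f: "f \<in> X" for f
  proof (cases "N (A f) = 0")
    case True
    then have "A f = (\<lambda>x. 0)" using N_zero_iff[OF A_in[OF f]] by simp
    moreover have "A (\<lambda>x. 0) = (\<lambda>x. 0)" using A_scale[OF X_zero, of 0] by simp
    ultimately have "f = (\<lambda>x. 0)" using bij f X_zero unfolding bij_betw_def inj_on_def by metis
    then show ?thesis using True by (simp add: N_zero)
  next
    case False
    define a where "a = N (A f)"
    have a: "0 < a" using False N_nonneg[OF A_in[OF f]] by (simp add: a_def)
    \<comment> \<open>The residuals. Scaling the tolerance by \<open>a\<close>, the norm of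
      \<open>A f\<close>, is what keeps the final bound proportional to that norm.\<close>
    define Y where "Y = rec_nat (A f) (\<lambda>k y. (\<lambda>x. y x - A (\<phi> y (a * (1/2) ^ Suc k)) x))"
    have Y0: "Y 0 = A f" and YS: "Y (Suc k) = (\<lambda>x. Y k x - A (\<phi> (Y k) (a * (1/2) ^ Suc k)) x)" for k
      by (simp_all add: Y_def)
    have ep: "0 < a * (1/2) ^ Suc k" for k using a by simp
    have YX: "Y k \<in> X" for k
      by (induction k) (auto simp: Y0 YS intro!: X_diff A_in \<phi>(1) f ep simp del: power_Suc)
    define g where "g k = \<phi> (Y k) (a * (1/2) ^ Suc k)" for k
    have gX: "g k \<in> X" for k unfolding g_def by (rule \<phi>(1)[OF YX ep])
    have NY: "N (Y k) \<le> a * (1/2) ^ k" for k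
    proof (cases k)
      case 0
      then show ?thesis by (simp add: Y0 a_def)
    next
      case (Suc j)
      then show ?thesis using \<phi>(3)[OF YX ep, of j j] by (simp add: YS)
    qed
    have Ng: "N (g k) \<le> M * a * (1/2) ^ k" for k
    proof -
      have "N (g k) \<le> M * N (Y k)" unfolding g_def by (rule \<phi>(2)[OF YX ep])
      also have "\<dots> \<le> M * (a * (1/2) ^ k)" using M(1) NY by (intro mult_left_mono) auto
      finally show ?thesis by simp
    qed
    define s where "s n x = (\<Sum>k<n. g k x)" for n :: nat and x
    have s0: "s 0 = (\<lambda>x. 0)" and sS: "s (Suc n) = (\<lambda>x. s n x + g n x)" for n by (auto simp: s_def)
    have sX: "s n \<in> X" for n by (induction n) (auto simp: s0 sS intro: X_zero X_add gX)
    have As: "A (s n) = (\<lambda>x. A f x - Y n x)" for n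
    proof (induction n)
      case 0
      then show ?case using A_scale[OF X_zero, of 0] by (simp add: s0 Y0)
    next
      case (Suc n)
      then show ?case unfolding sS A_add[OF sX gX] YS g_def[symmetric] by (simp add: fun_eq_iff)
    qed
    have Ma: "0 \<le> M * a" using M(1) a by simp
    obtain h where h: "h \<in> X" "(\<lambda>n. N (\<lambda>x. s n x - h x)) \<longlonglongrightarrow> 0" and Ns: "\<And>n. N (s n) \<le> 2 * (M * a)"
      by (rule series_converges[OF gX Ng Ma]) (auto simp: s_def[abs_def] intro: that)
    have "N (\<lambda>x. A f x - A h x) \<le> a * (1/2)^n + B * N (\<lambda>x. s n x - h x)" for n
    proof -
      have "N (\<lambda>x. A f x - A h x) \<le> N (\<lambda>x. A f x - A (s n) x) + N (\<lambda>x. A (s n) x - A h x)"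
        by (rule N_diff_triangle[OF A_in[OF f] A_in[OF sX] A_in[OF h(1)]])
      also have "(\<lambda>x. A f x - A (s n) x) = Y n" by (simp add: As)
      also have "(\<lambda>x. A (s n) x - A h x) = A (\<lambda>x. s n x - h x)" by (rule A_diff[OF sX h(1), symmetric])
      also have "N (Y n) + N (A (\<lambda>x. s n x - h x)) \<le> a * (1/2)^n + B * N (\<lambda>x. s n x - h x)"
        by (intro add_mono NY A_bound X_diff sX h)
      finally show ?thesis .
    qed
    moreover have "(\<lambda>n. a * (1/2)^n + B * N (\<lambda>x. s n x - h x)) \<longlonglongrightarrow> a * 0 + B * 0"
      by (intro tendsto_intros LIMSEQ_power_zero h(2)) auto
    ultimately have "N (\<lambda>x. A f x - A h x) \<le> 0" using LIMSEQ_le_const by fastforce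
    then have "N (\<lambda>x. A f x - A h x) = 0" using N_nonneg[OF X_diff[OF A_in[OF f] A_in[OF h(1)]]] by simp
    then have "A f = A h" using N_zero_iff[OF X_diff[OF A_in[OF f] A_in[OF h(1)]]] by (simp add: fun_eq_iff)
    then have fh: "f = h" using bij f h(1) by (auto simp: bij_betw_def inj_on_def)
    have "N h \<le> 2 * M * a + N (\<lambda>x. s n x - h x)" for n
    proof -
      have "N (s n) \<le> 2 * M * a" using Ns[of n] by simp
      moreover have "N h \<le> N (s n) + N (\<lambda>x. s n x - h x)" using N_diff[OF sX X_diff[OF sX h(1)], of n n] by simp
      ultimately show ?thesis by simp
    qed
    moreover have "(\<lambda>n. 2 * M * a + N (\<lambda>x. s n x - h x)) \<longlonglongrightarrow> 2 * M * a + 0"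
      by (intro tendsto_intros h(2))
    ultimately have "N h \<le> 2 * M * a" using LIMSEQ_le_const by fastforce
    then show ?thesis by (simp add: fh a_def)
  qed
  then show ?thesis using M(1) by (intro exI[of _ "2 * M"]) auto
qed

end
end

section \<open>The upper estimate\<close>

text \<open>Absolute summability turns the unordered sum into a Bochner integral over the counting
  measure, where additivity and the norm estimate are at hand.\<close>

lemma infsum_count_space:
  fixes f :: "'i \<Rightarrow> complex"
  assumes "(\<integral>\<^sup>+ i. ennreal (cmod (f i)) \<partial>count_space A) < \<infinity>"
  shows "integrable (count_space A) f" "infsum f A = (\<integral>i. f i \<partial>count_space A)"
    "ennreal (cmod (infsum f A)) \<le> (\<integral>\<^sup>+ i. ennreal (cmod (f i)) \<partial>count_space A)"
proof -
  show int: "integrable (count_space A) f" using assms by (auto simp: integrable_iff_bounded)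
  then have "Infinite_Set_Sum.abs_summable_on f A" by (simp add: Infinite_Set_Sum.abs_summable_on_def)
  from infsetsum_infsum[OF this] show eq: "infsum f A = (\<integral>i. f i \<partial>count_space A)"
    by (simp add: infsetsum_def)
  show "ennreal (cmod (infsum f A)) \<le> (\<integral>\<^sup>+ i. ennreal (cmod (f i)) \<partial>count_space A)"
    unfolding eq by (rule integral_norm_bound_ennreal[OF int])
qed

text \<open>\<open>g\<close>, \<open>\<Theta>\<close> and \<open>K\<close> are the regularised kernels, so that their envelopes bound them everywhere.\<close>
locale spread_family = bf_group \<mu> \<Delta> V w E nE cw
  for \<mu> :: "'g::{topological_group_add,t2_space} measure" and \<Delta> :: "'g \<Rightarrow> real"
    and V :: "'g set" and w :: "'g \<Rightarrow> real" and E nE cw +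
  fixes S :: "('g \<Rightarrow> complex) set" and \<Gamma> :: "'g set"
    and T :: "'g \<Rightarrow> ('g \<Rightarrow> complex) \<Rightarrow> ('g \<Rightarrow> complex)"
    and g \<Theta> K :: "'g \<Rightarrow> real" and B :: real
  assumes S_E: "S \<subseteq> E" and S_subspace: "is_subspace S"
    and S_cont: "f \<in> S \<Longrightarrow> continuous_on UNIV f"
    and S_closed: "closed_mod_ae \<mu> E nE S"
    and T_in: "\<gamma> \<in> \<Gamma> \<Longrightarrow> f \<in> S \<Longrightarrow> T \<gamma> f \<in> S"
    and T_add: "\<gamma> \<in> \<Gamma> \<Longrightarrow> f \<in> S \<Longrightarrow> f' \<in> S \<Longrightarrow> T \<gamma> (\<lambda>x. f x + f' x) = (\<lambda>x. T \<gamma> f x + T \<gamma> f' x)"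
    and T_scale: "\<gamma> \<in> \<Gamma> \<Longrightarrow> f \<in> S \<Longrightarrow> T \<gamma> (\<lambda>x. c * f x) = (\<lambda>x. c * T \<gamma> f x)"
    and sep: "rel_separated V \<Gamma>"
    and g_meas [measurable]: "g \<in> borel_measurable borel" and g_nonneg: "0 \<le> g x"
    and \<Theta>_meas [measurable]: "\<Theta> \<in> borel_measurable borel" and \<Theta>_nonneg: "0 \<le> \<Theta> x"
    and K_meas [measurable]: "K \<in> borel_measurable borel"
    and g_env: "wint (env Q g) < \<infinity>"
    and \<Theta>_env: "wint (env Q \<Theta>) < \<infinity>"
    and K_env: "wint (env Q K) < \<infinity>"
    and \<Theta>_le: "\<Theta> x \<le> B"
    and T_bound: "\<gamma> \<in> \<Gamma> \<Longrightarrow> f \<in> S \<Longrightarrow> ennreal (cmod (T \<gamma> f x)) \<le>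
       (\<integral>\<^sup>+ y. ennreal (g (- \<gamma> + y)) * ennreal (cmod (f y)) * ennreal (\<Theta> (- y + x)) \<partial>\<mu>)"
    and K_bound: "f \<in> S \<Longrightarrow> ennreal (cmod (f x)) \<le> nconv \<mu> f (\<lambda>z. ennreal (K z)) x"
    and bij: "bij_betw (sum_ops \<Gamma> T) S S"
begin

abbreviation "EdT f \<equiv> Ed_fun V \<Gamma> (\<lambda>\<gamma>. L2_norm \<mu> (T \<gamma> f))"

lemma cnt: "countable \<Gamma>"
  by (rule rel_separated_countable[OF sep])

lemma S_measurable: "f \<in> S \<Longrightarrow> f \<in> borel_measurable borel"
  using S_E E_measurable by blast

lemma kernel_integral_le_env:
  "(\<integral>\<^sup>+ x. ennreal (k x) * ennreal (w x) \<partial>\<mu>) \<le> (wint (env Q k))"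
  using env_upper[OF zero_in_Q, of k] by (intro nn_integral_mono mult_right_mono) auto

text \<open>Minkowski's integral inequality \<open>\<parallel>a * \<Theta>\<parallel>\<^sub>2 \<le> C \<parallel>a\<parallel>\<^sub>1\<close>, again without Fubini: on a piece of diameter
  \<open>V\<close> the kernel is replaced by its envelope, which turns the convolution into a countable sum.\<close>
lemma ex_L2_bound:
  obtains D where "0 \<le> D" "\<And>a h. a \<in> borel_measurable borel \<Longrightarrow>
     (\<And>x. ennreal (cmod (h x)) \<le> (\<integral>\<^sup>+ y. a y * ennreal (\<Theta> (- y + x)) \<partial>\<mu>)) \<Longrightarrow>
     L2_sq \<mu> h \<le> ennreal D * (\<integral>\<^sup>+ y. a y \<partial>\<mu>)\<^sup>2"
proof -
  have B0: "0 \<le> B" using \<Theta>_nonneg \<Theta>_le by (meson order_trans)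
  define \<theta> where "\<theta> = env Q \<Theta>"
  have [measurable]: "\<theta> \<in> borel_measurable borel" unfolding \<theta>_def by (rule borel_measurable_env) simp
  \<comment> \<open>Boundedness of the envelope together with \<open>cw \<le> w x\<close> makes this
    weighted integrable function square integrable.\<close>
  have \<theta>B: "\<theta> z \<le> ennreal B" for z
    unfolding \<theta>_def env_def by (intro SUP_least ennreal_leI \<Theta>_le)
  have "(\<integral>\<^sup>+ z. (\<theta> z)\<^sup>2 \<partial>\<mu>) \<le> (\<integral>\<^sup>+ z. ennreal (B / cw) * (\<theta> z * ennreal (w z)) \<partial>\<mu>)"
  proof (rule nn_integral_mono)
    fix z
    have "1 \<le> ennreal (1 / cw) * ennreal (w z)"
      using cw_le[of z] cw_pos by (simp add: ennreal_mult[symmetric] ennreal_ge_1)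
    then have "\<theta> z * \<theta> z * 1 \<le> ennreal B * \<theta> z * (ennreal (1 / cw) * ennreal (w z))"
      by (intro mult_mono \<theta>B) auto
    also have "\<dots> = ennreal (B / cw) * (\<theta> z * ennreal (w z))"
    proof -
      have "ennreal (B / cw) = ennreal B * ennreal (1 / cw)"
        using B0 cw_pos by (simp add: ennreal_mult[symmetric])
      then show ?thesis by (simp only: ac_simps)
    qed
    finally show "(\<theta> z)\<^sup>2 \<le> ennreal (B / cw) * (\<theta> z * ennreal (w z))" by (simp add: power2_eq_square)
  qed
  also have "\<dots> = ennreal (B / cw) * (wint \<theta>)" by (rule nn_integral_cmult) simp
  also have "\<dots> < \<infinity>" using \<Theta>_env by (simp add: ennreal_mult_less_top \<theta>_def)
  finally obtain D where D: "(\<integral>\<^sup>+ z. (\<theta> z)\<^sup>2 \<partial>\<mu>) = ennreal D" "0 \<le> D"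
    by (cases "\<integral>\<^sup>+ z. (\<theta> z)\<^sup>2 \<partial>\<mu>") auto
  obtain p :: "nat \<Rightarrow> 'g" where p: "(\<Union>n. ltr (p n) Q) = UNIV"
    using ex_sequence_translates_left[OF open_interior zero_in_Q] .
  define A where "A = disjointed (\<lambda>n. ltr (p n) Q)"
  have "range (\<lambda>n. ltr (p n) Q) \<subseteq> sets borel" by auto
  from sets.range_disjointed_sets[OF this] have A[measurable]: "A n \<in> sets borel" for n unfolding A_def by blast
  have UA: "(\<Union>n. A n) = UNIV" unfolding A_def UN_disjointed_eq by (rule p)
  have disjA: "disjoint_family A" unfolding A_def by (rule disjoint_family_disjointed)
  have Asub: "A n \<subseteq> ltr (p n) Q" for n unfolding A_def by (rule disjointed_subset)
  note part = nn_integral_partition[OF _ A UA disjA]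
  show ?thesis
  proof (rule that[OF D(2)])
    fix a :: "'g \<Rightarrow> ennreal" and h :: "'g \<Rightarrow> complex"
    assume [measurable]: "a \<in> borel_measurable borel"
      and h: "\<And>x. ennreal (cmod (h x)) \<le> (\<integral>\<^sup>+ y. a y * ennreal (\<Theta> (- y + x)) \<partial>\<mu>)"
    define \<alpha> where "\<alpha> n = (\<integral>\<^sup>+ y. a y * indicator (A n) y \<partial>\<mu>)" for n
    \<comment> \<open>A discrete measure with the mass of \<open>a\<close> on \<open>A n\<close>
      placed at \<open>n\<close>. Its total mass is the integral of \<open>a\<close>, so
      Cauchy-Schwarz against the constant 1 costs exactly one such factor.\<close>
    define M where "M = density (count_space (UNIV::nat set)) \<alpha>"
    have MI: "(\<integral>\<^sup>+ n. F n \<partial>M) = (\<Sum>n. \<alpha> n * F n)" for F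
      unfolding M_def by (simp add: nn_integral_density nn_integral_count_space_nat)
    have sum\<alpha>: "(\<Sum>n. \<alpha> n) = (\<integral>\<^sup>+ y. a y \<partial>\<mu>)" unfolding \<alpha>_def by (rule part[symmetric]) simp
    have point: "ennreal (cmod (h x)) \<le> (\<Sum>n. \<alpha> n * \<theta> (- p n + x))" for x
    proof -
      have "ennreal (cmod (h x)) \<le> (\<integral>\<^sup>+ y. a y * ennreal (\<Theta> (- y + x)) \<partial>\<mu>)" by (rule h)
      also have "\<dots> = (\<Sum>n. \<integral>\<^sup>+ y. a y * ennreal (\<Theta> (- y + x)) * indicator (A n) y \<partial>\<mu>)"
        by (rule part) simp
      also have "\<dots> \<le> (\<Sum>n. \<integral>\<^sup>+ y. a y * indicator (A n) y * \<theta> (- p n + x) \<partial>\<mu>)"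
      proof (intro suminf_le nn_integral_mono)
        fix n y
        show "a y * ennreal (\<Theta> (- y + x)) * indicator (A n) y \<le> a y * indicator (A n) y * \<theta> (- p n + x)"
        proof (cases "y \<in> A n")
          case True
          then obtain q where q: "q \<in> Q" "y = p n + q" using Asub by blast
          then have "- y + x = - q + (- p n + x)" by (simp only: minus_add add.assoc)
          then have "ennreal (\<Theta> (- y + x)) \<le> \<theta> (- p n + x)"
            unfolding \<theta>_def using env_upper[of "- q" Q \<Theta>] q(1) Q_uminus_iff by metis
          then show ?thesis using True by (auto intro: mult_left_mono)
        qed simp
      qed auto
      also have "\<dots> = (\<Sum>n. \<alpha> n * \<theta> (- p n + x))" by (simp add: nn_integral_multc \<alpha>_def)
      finally show ?thesis .
    qed
    have sq: "(ennreal (cmod (h x)))\<^sup>2 \<le> (\<integral>\<^sup>+ y. a y \<partial>\<mu>) * (\<Sum>n. \<alpha> n * (\<theta> (- p n + x))\<^sup>2)" for x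
    proof -
      have "(ennreal (cmod (h x)))\<^sup>2 \<le> (\<integral>\<^sup>+ n. 1 * \<theta> (- p n + x) \<partial>M)\<^sup>2"
        using point[of x] by (intro power_mono) (auto simp: MI)
      also have "\<dots> \<le> (\<integral>\<^sup>+ n. 1\<^sup>2 \<partial>M) * (\<integral>\<^sup>+ n. (\<theta> (- p n + x))\<^sup>2 \<partial>M)"
        by (rule Cauchy_Schwarz_nn_integral) (auto simp: M_def)
      also have "\<dots> = (\<integral>\<^sup>+ y. a y \<partial>\<mu>) * (\<Sum>n. \<alpha> n * (\<theta> (- p n + x))\<^sup>2)"
        using MI[of "\<lambda>n. 1\<^sup>2"] by (simp add: MI sum\<alpha>)
      finally show ?thesis .
    qed
    have "L2_sq \<mu> h = (\<integral>\<^sup>+ x. (ennreal (cmod (h x)))\<^sup>2 \<partial>\<mu>)" by (simp add: L2_sq_def ennreal_power)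
    also have "\<dots> \<le> (\<integral>\<^sup>+ x. (\<integral>\<^sup>+ y. a y \<partial>\<mu>) * (\<Sum>n. \<alpha> n * (\<theta> (- p n + x))\<^sup>2) \<partial>\<mu>)"
      by (intro nn_integral_mono sq)
    also have "\<dots> = (\<integral>\<^sup>+ y. a y \<partial>\<mu>) * (\<integral>\<^sup>+ x. (\<Sum>n. \<alpha> n * (\<theta> (- p n + x))\<^sup>2) \<partial>\<mu>)"
      by (rule nn_integral_cmult) simp
    also have "(\<integral>\<^sup>+ x. (\<Sum>n. \<alpha> n * (\<theta> (- p n + x))\<^sup>2) \<partial>\<mu>) = (\<Sum>n. \<alpha> n * (\<integral>\<^sup>+ x. (\<theta> (- p n + x))\<^sup>2 \<partial>\<mu>))"
      by (subst nn_integral_suminf) (auto simp: nn_integral_cmult)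
    also have "\<dots> = (\<Sum>n. \<alpha> n * ennreal D)"
    proof -
      have "(\<integral>\<^sup>+ x. (\<theta> (- p n + x))\<^sup>2 \<partial>\<mu>) = ennreal D" for n
        unfolding D(1)[symmetric] by (rule nn_integral_add_left[where f="\<lambda>x. (\<theta> x)\<^sup>2"]) simp
      then show ?thesis by simp
    qed
    also have "\<dots> = (\<integral>\<^sup>+ y. a y \<partial>\<mu>) * ennreal D" by (simp add: ennreal_suminf_multc sum\<alpha>)
    finally show "L2_sq \<mu> h \<le> ennreal D * (\<integral>\<^sup>+ y. a y \<partial>\<mu>)\<^sup>2" by (simp add: power2_eq_square ac_simps)
  qed
qed

text \<open>The locally finite sum is rewritten over all of \<Gamma>, the form in which
  measurability and the exchange with integrals become available.\<close>

lemma Ed_fun_eq: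
  "ennreal (cmod (Ed_fun V \<Gamma> c x)) = (\<integral>\<^sup>+ \<gamma>. ennreal \<bar>c \<gamma>\<bar> * indicator (ltr \<gamma> V) x \<partial>count_space \<Gamma>)"
  "Ed_fun V \<Gamma> c x = complex_of_real (enn2real (\<integral>\<^sup>+ \<gamma>. ennreal \<bar>c \<gamma>\<bar> * indicator (ltr \<gamma> V) x \<partial>count_space \<Gamma>))"
proof -
  let ?F = "{\<gamma>\<in>\<Gamma>. x \<in> ltr \<gamma> V}"
  have "?F = \<Gamma> \<inter> ltr x V" by (auto simp: rel_separated_mem)
  then have fin: "finite ?F" using sep by (auto simp: rel_separated_def)
  have "(\<integral>\<^sup>+ \<gamma>. ennreal \<bar>c \<gamma>\<bar> * indicator (ltr \<gamma> V) x \<partial>count_space \<Gamma>)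
     = (\<Sum>\<gamma>\<in>?F. ennreal \<bar>c \<gamma>\<bar> * indicator (ltr \<gamma> V) x)"
    using fin by (intro nn_integral_count_space') auto
  also have "\<dots> = (\<Sum>\<gamma>\<in>?F. ennreal \<bar>c \<gamma>\<bar>)" by (intro sum.cong) auto
  also have "\<dots> = ennreal (\<Sum>\<gamma>\<in>?F. \<bar>c \<gamma>\<bar>)" by (rule sum_ennreal) simp
  finally have *: "(\<integral>\<^sup>+ \<gamma>. ennreal \<bar>c \<gamma>\<bar> * indicator (ltr \<gamma> V) x \<partial>count_space \<Gamma>) = ennreal (\<Sum>\<gamma>\<in>?F. \<bar>c \<gamma>\<bar>)" .
  have n: "0 \<le> (\<Sum>\<gamma>\<in>?F. \<bar>c \<gamma>\<bar>)" by (simp add: sum_nonneg)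
  show "Ed_fun V \<Gamma> c x = complex_of_real (enn2real (\<integral>\<^sup>+ \<gamma>. ennreal \<bar>c \<gamma>\<bar> * indicator (ltr \<gamma> V) x \<partial>count_space \<Gamma>))"
    unfolding * Ed_fun_def using n by (simp only: enn2real_ennreal)
  show "ennreal (cmod (Ed_fun V \<Gamma> c x)) = (\<integral>\<^sup>+ \<gamma>. ennreal \<bar>c \<gamma>\<bar> * indicator (ltr \<gamma> V) x \<partial>count_space \<Gamma>)"
    unfolding * Ed_fun_def norm_of_real abs_of_nonneg[OF n] ..
qed

lemma Ed_fun_measurable [measurable]: "Ed_fun V \<Gamma> c \<in> borel_measurable borel"
proof -
  have "(\<lambda>x. \<integral>\<^sup>+ \<gamma>. ennreal \<bar>c \<gamma>\<bar> * indicator (ltr \<gamma> V) x \<partial>count_space \<Gamma>) \<in> borel_measurable borel"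
    by (rule borel_measurable_nn_integral_count_space[OF cnt]) simp
  then show ?thesis unfolding Ed_fun_eq(2) by simp
qed

text \<open>Finiteness of the squared norms is part of the result because \<open>L2_norm\<close>
  would turn an infinite value into 0.\<close>

lemma upper_bound:
  obtains C where "0 < C" "\<And>f \<gamma>. f \<in> S \<Longrightarrow> \<gamma> \<in> \<Gamma> \<Longrightarrow> L2_sq \<mu> (T \<gamma> f) < \<infinity>"
    "\<And>f. f \<in> S \<Longrightarrow> EdT f \<in> E"
    "\<And>f. f \<in> S \<Longrightarrow> nE (EdT f) \<le> C * nE f"
proof -
  obtain C1 where C1: "0 < C1" "\<And>f h b. f \<in> E \<Longrightarrow> h \<in> borel_measurable borel \<Longrightarrow> 0 < b \<Longrightarrow>
     (wint h) \<le> ennreal b \<Longrightarrow>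
     \<exists>F\<in>E. nE F \<le> C1 * b * nE f \<and> (AE x in \<mu>. nconv \<mu> f h x = ennreal (cmod (F x)))"
    using nconv_bounded_in_E by blast
  obtain D where D: "0 \<le> D" "\<And>a h. a \<in> borel_measurable borel \<Longrightarrow>
     (\<And>x. ennreal (cmod (h x)) \<le> (\<integral>\<^sup>+ y. a y * ennreal (\<Theta> (- y + x)) \<partial>\<mu>)) \<Longrightarrow>
     L2_sq \<mu> h \<le> ennreal D * (\<integral>\<^sup>+ y. a y \<partial>\<mu>)\<^sup>2"
    using ex_L2_bound by blast
  obtain n :: nat where n: "\<And>x. finite (\<Gamma> \<inter> ltr x V)" "\<And>x. card (\<Gamma> \<inter> ltr x V) \<le> n"
    using sep unfolding rel_separated_def by blast
  obtain cu where cu: "0 < cu" "\<And>F. F \<in> borel_measurable borel \<Longrightarrow>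
     (\<integral>\<^sup>+ y. F (- y) * ennreal (w y) \<partial>\<mu>) \<le> ennreal cu * (wint F)"
    using nn_integral_uminus_w by blast
  \<comment> \<open>For \<open>x = \<gamma> + v\<close> the argument \<open>- \<gamma> + y\<close>
    equals \<open>v + (- x + y)\<close> with \<open>v\<close> in \<open>V\<close>. Adding
    \<open>Q\<close> yields an open set containing \<open>V\<close>.\<close>
  define C where "C = group_sumset V Q"
  have C: "open C" unfolding C_def by (intro open_group_sumset open_interior)
  have VC: "V \<subseteq> C" using group_sumsetI[OF _ zero_in_Q, of _ V] by (auto simp: C_def)
  have "C \<subseteq> group_sumset (closure V) (closure V)"
    unfolding C_def using V_subset_closure Q_subset_V by (intro group_sumset_mono) auto
  then have gC: "wint (env C g) < \<infinity>"
    by (rule nn_integral_env_finite[OF g_env compact_group_sumset[OF compact_closure_V compact_closure_V] C])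
  have mC[measurable]: "env C g \<in> borel_measurable borel" by (rule borel_measurable_env[OF C])
  \<comment> \<open>The bound involves \<open>- x + y\<close>, whereas a convolution kernel is
    evaluated at the inverse \<open>- y + x\<close>.\<close>
  define G where "G z = env C g (- z)" for z
  have G[measurable]: "G \<in> borel_measurable borel" unfolding G_def by measurable
  have "wint G \<le> ennreal cu * (wint (env C g))"
    unfolding G_def by (rule cu(2)[OF mC])
  also have "\<dots> < \<infinity>" using gC by (simp add: ennreal_mult_less_top)
  finally have Gfin: "wint G < \<infinity>" .
  \<comment> \<open>At most \<open>n\<close> translates of \<open>V\<close> meet at a point, and
    each term contributes \<open>sqrt D\<close> from the L2 bound.\<close>
  define d where "d = real n * sqrt D"
  have d0: "0 \<le> d" using D by (simp add: d_def)
  define G' where "G' z = ennreal d * G z" for z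
  have [measurable]: "G' \<in> borel_measurable borel" unfolding G'_def by measurable
  have "wint G' = ennreal d * (wint G)"
    unfolding G'_def mult.assoc by (rule nn_integral_cmult) simp
  also have "\<dots> < \<infinity>" using Gfin by (simp add: ennreal_mult_less_top)
  finally obtain b' where b': "wint G' = ennreal b'" "0 \<le> b'"
    by (cases "wint G'") auto
  define b where "b = b' + 1"
  have b: "0 < b" "wint G' \<le> ennreal b" using b' by (auto simp: b_def intro: ennreal_leI)
  have main: "(\<forall>\<gamma>\<in>\<Gamma>. L2_sq \<mu> (T \<gamma> f) < \<infinity>) \<and> EdT f \<in> E \<and>
     nE (EdT f) \<le> C1 * b * nE f" if f: "f \<in> S" for f
  proof -
    have fE: "f \<in> E" using f S_E by blast
    note [measurable] = E_measurable[OF fE]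
    define a where "a \<gamma> y = ennreal (g (- \<gamma> + y)) * ennreal (cmod (f y))" for \<gamma> y
    have a[measurable]: "a \<gamma> \<in> borel_measurable borel" for \<gamma> unfolding a_def by measurable
    have L2: "L2_sq \<mu> (T \<gamma> f) \<le> ennreal D * (\<integral>\<^sup>+ y. a \<gamma> y \<partial>\<mu>)\<^sup>2" if "\<gamma> \<in> \<Gamma>" for \<gamma>
      using T_bound[OF that f] by (intro D(2) a) (simp add: a_def)
    have a_le: "(\<integral>\<^sup>+ y. a \<gamma> y \<partial>\<mu>) \<le> nconv \<mu> f G x" if x: "x \<in> ltr \<gamma> V" for \<gamma> x
      unfolding nconv_def
    proof (rule nn_integral_mono)
      fix y
      obtain v where v: "v \<in> V" "x = \<gamma> + v" using x by auto
      have "- \<gamma> + y = v + (- x + y)" unfolding v(2) by (simp only: minus_add add.assoc[symmetric]) (simp del: add_uminus_conv_diff)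
      then have "ennreal (g (- \<gamma> + y)) \<le> env C g (- x + y)"
        using env_upper[of v C g "- x + y"] v(1) VC by auto
      also have "- x + y = - (- y + x)" by (simp only: minus_add minus_minus)
      finally have "ennreal (g (- \<gamma> + y)) \<le> G (- y + x)" by (simp only: G_def)
      then show "a \<gamma> y \<le> ennreal (cmod (f y)) * G (- y + x)"
        unfolding a_def by (subst mult.commute) (intro mult_left_mono, auto)
    qed
    obtain F0 where F0: "AE x in \<mu>. nconv \<mu> f G x = ennreal (cmod (F0 x))"
      using nconv_in_E[OF fE G Gfin] by metis
    \<comment> \<open>The convolution is finite almost everywhere and dominates this integral on
      \<open>\<gamma> + Q\<close>, a set of positive measure.\<close>
    have a_fin: "(\<integral>\<^sup>+ y. a \<gamma> y \<partial>\<mu>) < \<infinity>" for \<gamma>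
    proof (rule ccontr)
      assume neg: "\<not> (\<integral>\<^sup>+ y. a \<gamma> y \<partial>\<mu>) < \<infinity>"
      have "AE x in \<mu>. x \<notin> ltr \<gamma> Q"
        using F0
      proof eventually_elim
        case (elim x)
        show ?case
        proof
          assume "x \<in> ltr \<gamma> Q"
          then have "(\<integral>\<^sup>+ y. a \<gamma> y \<partial>\<mu>) \<le> nconv \<mu> f G x" using Q_subset_V by (intro a_le) auto
          then show False using neg elim by (simp add: top_unique less_top[symmetric])
        qed
      qed
      then have "emeasure \<mu> (ltr \<gamma> Q) = 0"
        by (subst (asm) AE_iff_null_sets[symmetric]) auto
      then show False using emeasure_Q by (simp add: emeasure_add_left)
    qed
    have fin: "L2_sq \<mu> (T \<gamma> f) < \<infinity>" if "\<gamma> \<in> \<Gamma>" for \<gamma>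
    proof -
      note L2[OF that]
      also have "ennreal D * (\<integral>\<^sup>+ y. a \<gamma> y \<partial>\<mu>)\<^sup>2 < \<infinity>"
        using a_fin[of \<gamma>] by (simp add: ennreal_mult_less_top power_less_top_ennreal)
      finally show ?thesis .
    qed
    have norm_le: "ennreal (L2_norm \<mu> (T \<gamma> f)) \<le> ennreal (sqrt D) * (\<integral>\<^sup>+ y. a \<gamma> y \<partial>\<mu>)" if "\<gamma> \<in> \<Gamma>" for \<gamma>
    proof -
      obtain r where r: "(\<integral>\<^sup>+ y. a \<gamma> y \<partial>\<mu>) = ennreal r" "0 \<le> r" using a_fin[of \<gamma>] by (cases "\<integral>\<^sup>+ y. a \<gamma> y \<partial>\<mu>") auto
      have "L2_sq \<mu> (T \<gamma> f) \<le> ennreal (D * r\<^sup>2)" using L2[OF that] r D(1) by (simp add: ennreal_mult ennreal_power)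
      then have "enn2real (L2_sq \<mu> (T \<gamma> f)) \<le> D * r\<^sup>2" using D(1) by (intro enn2real_leI) auto
      then have "L2_norm \<mu> (T \<gamma> f) \<le> sqrt (D * r\<^sup>2)" unfolding L2_norm_def by (rule real_sqrt_le_mono)
      also have "\<dots> = sqrt D * r" using r by (simp add: real_sqrt_mult)
      finally show ?thesis using r D(1) by (simp add: ennreal_mult[symmetric] ennreal_leI)
    qed
    have Ed_le: "ennreal (cmod (EdT f x)) \<le> nconv \<mu> f G' x" for x
    proof -
      let ?F = "{\<gamma>\<in>\<Gamma>. x \<in> ltr \<gamma> V}"
      have F: "?F = \<Gamma> \<inter> ltr x V" by (auto simp: rel_separated_mem)
      have fF: "finite ?F" unfolding F by (rule n)
      have "ennreal (cmod (EdT f x)) = (\<Sum>\<gamma>\<in>?F. ennreal (L2_norm \<mu> (T \<gamma> f)))"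
        unfolding Ed_fun_def norm_of_real by (subst sum_ennreal) (auto simp: L2_norm_def sum_nonneg)
      also have "\<dots> \<le> (\<Sum>\<gamma>\<in>?F. ennreal (sqrt D) * nconv \<mu> f G x)"
      proof (rule sum_mono)
        fix \<gamma> assume "\<gamma> \<in> ?F"
        then have "ennreal (L2_norm \<mu> (T \<gamma> f)) \<le> ennreal (sqrt D) * (\<integral>\<^sup>+ y. a \<gamma> y \<partial>\<mu>)"
          "(\<integral>\<^sup>+ y. a \<gamma> y \<partial>\<mu>) \<le> nconv \<mu> f G x" using norm_le a_le by auto
        then show "ennreal (L2_norm \<mu> (T \<gamma> f)) \<le> ennreal (sqrt D) * nconv \<mu> f G x"
          by (meson mult_left_mono order_trans zero_le)
      qed
      also have "\<dots> = ennreal (real (card ?F)) * (ennreal (sqrt D) * nconv \<mu> f G x)"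
        by (simp add: ennreal_of_nat_eq_real_of_nat)
      also have "\<dots> \<le> ennreal (real n) * (ennreal (sqrt D) * nconv \<mu> f G x)"
        using n(2)[of x] by (intro mult_right_mono ennreal_leI) (auto simp: F)
      also have "\<dots> = ennreal d * nconv \<mu> f G x"
        using D(1) by (simp add: d_def ennreal_mult mult.assoc)
      also have "\<dots> = nconv \<mu> f G' x"
        unfolding nconv_def G'_def by (subst nn_integral_cmult[symmetric]) (auto simp: ac_simps)
      finally show ?thesis .
    qed
    obtain F1 where F1: "F1 \<in> E" "nE F1 \<le> C1 * b * nE f" "AE x in \<mu>. nconv \<mu> f G' x = ennreal (cmod (F1 x))"
      using C1(2)[OF fE _ b] by auto
    have ae: "AE x in \<mu>. cmod (EdT f x) \<le> cmod (F1 x)"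
      using F1(3)
    proof eventually_elim
      case (elim x)
      show ?case using Ed_le[of x] unfolding elim by simp
    qed
    note S' = E_solid[OF F1(1) Ed_fun_measurable ae]
    show ?thesis using fin S'(1) order_trans[OF S'(2) F1(2)] by blast
  qed
  have "0 < C1 * b" using C1(1) b(1) by simp
  then show ?thesis using main by (intro that[of "C1 * b"]) blast+
qed

end

section \<open>The lower estimate\<close>

text \<open>What is removed is the part on \<open>L\<close>; the part outside is kept and becomes
  small as \<open>L\<close> grows.\<close>

definition cut_off :: "'a set \<Rightarrow> ('a \<Rightarrow> real) \<Rightarrow> 'a \<Rightarrow> real" where
  "cut_off L k x = (if x \<in> L then 0 else k x)"

lemma cut_off_measurable [measurable]:
  assumes [measurable]: "L \<in> sets M" "k \<in> borel_measurable M"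
  shows "cut_off L k \<in> borel_measurable M"
  unfolding cut_off_def[abs_def] by measurable

context haar_group
begin

text \<open>The set where the functions differ is open, and nonempty open sets have positive
  measure.\<close>

lemma continuous_AE_eq:
  fixes f h :: "'g \<Rightarrow> complex"
  assumes "continuous_on UNIV f" "continuous_on UNIV h" "AE x in \<mu>. f x = h x"
  shows "f = h"
proof (rule ccontr)
  assume "f \<noteq> h"
  have op: "open {x. f x \<noteq> h x}" using assms by (intro open_Collect_neq) auto
  moreover have "{x. f x \<noteq> h x} \<noteq> {}" using \<open>f \<noteq> h\<close> by auto
  ultimately have "0 < emeasure \<mu> {x. f x \<noteq> h x}" by (rule emeasure_open_pos)
  moreover have "emeasure \<mu> {x. f x \<noteq> h x} = 0"
    using assms(3) op by (subst (asm) AE_iff_measurable[OF _ refl]) auto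
  ultimately show False by simp
qed

end

context weighted_group
begin

text \<open>A countable cover by compact sets need not absorb every compact set. Thickening its
  members by the closure of \<open>V\<close> makes their interiors a cover, to which compactness
  applies.\<close>

lemma ex_compact_exhaustion:
  obtains L :: "nat \<Rightarrow> 'g set" where "\<And>n. compact (L n)" "\<And>C. compact C \<Longrightarrow> eventually (\<lambda>n. C \<subseteq> L n) sequentially"
proof -
  obtain A :: "nat \<Rightarrow> 'g set" where A: "\<And>n. compact (A n)" "(\<Union>n. A n) = UNIV" using ex_sigma_compact by blast
  define L where "L n = (\<Union>i\<le>n. group_sumset (A i) (closure V))" for n
  show ?thesis
  proof (rule that[of L])
    show "compact (L n)" for n unfolding L_def by (intro compact_UN compact_group_sumset A compact_closure_V) auto
    fix C :: "'g set" assume C: "compact C"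
    have op: "open (group_sumset (A n) Q)" for n by (intro open_group_sumset open_interior)
    have "C \<subseteq> (\<Union>n. group_sumset (A n) Q)"
    proof
      fix x assume "x \<in> C"
      have "x \<in> (\<Union>n. A n)" using A(2) by simp
      then obtain n where "x \<in> A n" by blast
      then have "x \<in> group_sumset (A n) Q" using group_sumsetI[OF _ zero_in_Q, of x] by simp
      then show "x \<in> (\<Union>n. group_sumset (A n) Q)" by blast
    qed
    from compactE_image[OF C op this] obtain F where F: "finite F" "C \<subseteq> (\<Union>n\<in>F. group_sumset (A n) Q)" by metis
    obtain n0 where n0: "\<And>i. i \<in> F \<Longrightarrow> i \<le> n0" using F(1) by (metis finite_nat_set_iff_bounded_le)
    have "C \<subseteq> L n" if "n0 \<le> n" for n
    proof
      fix x assume "x \<in> C"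
      then obtain i where i: "i \<in> F" "x \<in> group_sumset (A i) Q" using F(2) by blast
      have "group_sumset (A i) Q \<subseteq> group_sumset (A i) (closure V)"
        using Q_subset_V V_subset_closure by (intro group_sumset_mono) auto
      moreover have "i \<le> n" using n0[OF i(1)] that by simp
      ultimately show "x \<in> L n" using i(2) unfolding L_def by blast
    qed
    then show "eventually (\<lambda>n. C \<subseteq> L n) sequentially" unfolding eventually_sequentially by blast
  qed
qed

lemma env_cut_off_eq_0: "rtr z C \<subseteq> L \<Longrightarrow> env C (cut_off L k) z = 0"
  unfolding env_def by (auto simp: cut_off_def intro!: SUP_eqI)

text \<open>Dominated convergence along the exhaustion: the envelope at \<open>x\<close> sees only a
  relatively compact translate of \<open>Q\<close>, hence becomes exactly 0 once that translate lies
  in \<open>L n\<close>. One \<open>L\<close> serves both kernels.\<close>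

lemma ex_small_cut_off:
  assumes k[measurable]: "k \<in> borel_measurable borel" and k0: "\<And>x. 0 \<le> k x"
    and l[measurable]: "l \<in> borel_measurable borel" and l0: "\<And>x. 0 \<le> l x"
    and int: "wint (env Q k) < \<infinity>" "(\<integral>\<^sup>+ x. ennreal (l x) * ennreal (w x) \<partial>\<mu>) < \<infinity>"
    and e: "0 < e"
  obtains L where "compact L" "wint (env Q (cut_off L k)) < ennreal e"
    "(\<integral>\<^sup>+ x. ennreal (cut_off L l x) * ennreal (w x) \<partial>\<mu>) < ennreal e"
proof -
  obtain L :: "nat \<Rightarrow> 'g set" where L: "\<And>n. compact (L n)" "\<And>C. compact C \<Longrightarrow> eventually (\<lambda>n. C \<subseteq> L n) sequentially"
    using ex_compact_exhaustion by blast
  have [measurable]: "L n \<in> sets borel" for n using L(1) borel_compact by blast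
  have [measurable]: "env Q k' \<in> borel_measurable borel" for k' :: "'g \<Rightarrow> real" by (rule borel_measurable_env) simp
  have "(\<lambda>n. wint (env Q (cut_off (L n) k))) \<longlonglongrightarrow> (\<integral>\<^sup>+ x. 0 \<partial>\<mu>)"
  proof (rule nn_integral_dominated_convergence[where w="\<lambda>x. env Q k x * ennreal (w x)"])
    show "AE x in \<mu>. env Q (cut_off (L j) k) x * ennreal (w x) \<le> env Q k x * ennreal (w x)" for j
      by (intro AE_I2 mult_right_mono env_mono) (auto simp: cut_off_def k0)
    show "AE x in \<mu>. (\<lambda>n. env Q (cut_off (L n) k) x * ennreal (w x)) \<longlonglongrightarrow> 0"
    proof (rule AE_I2)
      fix x
      have "compact ((\<lambda>c. c + x) ` closure V)" by (rule compact_add_right[OF compact_closure_V])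
      from L(2)[OF this] have "eventually (\<lambda>n. env Q (cut_off (L n) k) x * ennreal (w x) = 0) sequentially"
      proof eventually_elim
        case (elim n)
        then have "rtr x Q \<subseteq> L n" using Q_subset_V V_subset_closure by blast
        then show ?case by (simp add: env_cut_off_eq_0)
      qed
      then show "(\<lambda>n. env Q (cut_off (L n) k) x * ennreal (w x)) \<longlonglongrightarrow> 0" by (rule tendsto_eventually)
    qed
  qed (use int in auto)
  then have "eventually (\<lambda>n. (wint (env Q (cut_off (L n) k))) < ennreal e) sequentially"
    using e by (intro order_tendstoD(2)) auto
  moreover have "(\<lambda>n. \<integral>\<^sup>+ x. ennreal (cut_off (L n) l x) * ennreal (w x) \<partial>\<mu>) \<longlonglongrightarrow> (\<integral>\<^sup>+ x. 0 \<partial>\<mu>)"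
  proof (rule nn_integral_dominated_convergence[where w="\<lambda>x. ennreal (l x) * ennreal (w x)"])
    show "AE x in \<mu>. ennreal (cut_off (L j) l x) * ennreal (w x) \<le> ennreal (l x) * ennreal (w x)" for j
      by (intro AE_I2 mult_right_mono ennreal_leI) (auto simp: cut_off_def l0)
    show "AE x in \<mu>. (\<lambda>n. ennreal (cut_off (L n) l x) * ennreal (w x)) \<longlonglongrightarrow> 0"
    proof (rule AE_I2)
      fix x :: 'g
      have "compact {x}" by simp
      from L(2)[OF this] have "eventually (\<lambda>n. ennreal (cut_off (L n) l x) * ennreal (w x) = 0) sequentially"
        by eventually_elim (simp add: cut_off_def)
      then show "(\<lambda>n. ennreal (cut_off (L n) l x) * ennreal (w x)) \<longlonglongrightarrow> 0" by (rule tendsto_eventually)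
    qed
  qed (use int in auto)
  then have "eventually (\<lambda>n. (\<integral>\<^sup>+ x. ennreal (cut_off (L n) l x) * ennreal (w x) \<partial>\<mu>) < ennreal e) sequentially"
    using e by (intro order_tendstoD(2)) auto
  ultimately have "eventually (\<lambda>n. (wint (env Q (cut_off (L n) k))) < ennreal e \<and>
      (\<integral>\<^sup>+ x. ennreal (cut_off (L n) l x) * ennreal (w x) \<partial>\<mu>) < ennreal e) sequentially"
    by (rule eventually_conj)
  then obtain n where "(wint (env Q (cut_off (L n) k))) < ennreal e"
      "(\<integral>\<^sup>+ x. ennreal (cut_off (L n) l x) * ennreal (w x) \<partial>\<mu>) < ennreal e"
    by (auto simp: eventually_sequentially)
  then show ?thesis using that L(1) by blast
qed

end

context spread_family
begin

text \<open>With \<open>U = {}\<close> nothing is removed and this is the full absolute sum of the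
  family at \<open>y\<close>.\<close>

definition tail :: "'g set \<Rightarrow> ('g \<Rightarrow> complex) \<Rightarrow> 'g \<Rightarrow> ennreal" where
  "tail U f y = (\<integral>\<^sup>+ \<gamma>. ennreal (cmod (T \<gamma> f y)) * indicator (- ltr \<gamma> U) y \<partial>count_space \<Gamma>)"

abbreviation "near U f x \<equiv> \<integral>\<^sup>+ \<gamma>. \<integral>\<^sup>+ y. ennreal (cmod (T \<gamma> f y)) * indicator (ltr \<gamma> U) y * ennreal (K (- y + x)) \<partial>\<mu> \<partial>count_space \<Gamma>"

text \<open>The arguments \<open>- \<gamma> + z\<close> and \<open>- z + y\<close> of the two
  kernels add up to \<open>- \<gamma> + y\<close>. If \<open>y\<close> lies outside
  \<open>\<gamma> + L + L\<close>, one of them is outside \<open>L\<close>, so either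
  \<open>g\<close> or \<open>\<Theta>\<close> may be replaced by its cut-off. Summation over
  \<Gamma> then acts on the factor with \<open>g\<close> alone.\<close>

lemma tail_bound:
  obtains M where "0 < M" "\<And>L f y. L \<in> sets borel \<Longrightarrow> f \<in> S \<Longrightarrow> tail (group_sumset L L) f y \<le>
     nconv \<mu> f (\<lambda>z. ennreal M * ((wint (env Q (cut_off L g))) * ennreal (\<Theta> z)
       + (wint (env Q g)) * ennreal (cut_off L \<Theta> z))) y"
proof -
  obtain M where M: "0 < M" "\<And>k z. (\<integral>\<^sup>+ \<gamma>. ennreal (k (- \<gamma> + z)) \<partial>count_space \<Gamma>)
      \<le> ennreal M * (wint (env Q k))"
    using rel_separated_sum_le[OF sep cw_pos cw_le] by blast
  show ?thesis
  proof (rule that[OF M(1)])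
    fix L :: "'g set" and f y assume L[measurable]: "L \<in> sets borel" and f: "f \<in> S"
    note [measurable] = S_measurable[OF f]
    let ?U = "group_sumset L L"
    let ?I1 = "wint (env Q (cut_off L g))" and ?I = "wint (env Q g)"
    define q where "q \<gamma> z = ennreal (cut_off L g (- \<gamma> + z)) * ennreal (\<Theta> (- z + y)) + ennreal (g (- \<gamma> + z)) * ennreal (cut_off L \<Theta> (- z + y))" for \<gamma> z
    have [measurable]: "q \<gamma> \<in> borel_measurable borel" for \<gamma> unfolding q_def by measurable
    have "tail ?U f y \<le> (\<integral>\<^sup>+ \<gamma>. \<integral>\<^sup>+ z. ennreal (cmod (f z)) * q \<gamma> z \<partial>\<mu> \<partial>count_space \<Gamma>)"
      unfolding tail_def
    proof (rule nn_integral_mono)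
      fix \<gamma> assume "\<gamma> \<in> space (count_space \<Gamma>)"
      then have \<gamma>: "\<gamma> \<in> \<Gamma>" by simp
      show "ennreal (cmod (T \<gamma> f y)) * indicator (- ltr \<gamma> ?U) y \<le> (\<integral>\<^sup>+ z. ennreal (cmod (f z)) * q \<gamma> z \<partial>\<mu>)"
      proof (cases "y \<in> ltr \<gamma> ?U")
        case False
        have "ennreal (cmod (T \<gamma> f y)) \<le> (\<integral>\<^sup>+ z. ennreal (g (- \<gamma> + z)) * ennreal (cmod (f z)) * ennreal (\<Theta> (- z + y)) \<partial>\<mu>)"
          by (rule T_bound[OF \<gamma> f])
        also have "\<dots> \<le> (\<integral>\<^sup>+ z. ennreal (cmod (f z)) * q \<gamma> z \<partial>\<mu>)"
        proof (rule nn_integral_mono)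
          fix z
          have "- \<gamma> + z \<notin> L \<or> - z + y \<notin> L"
          proof (rule ccontr)
            assume "\<not> ?thesis"
            then have "(- \<gamma> + z) + (- z + y) \<in> ?U" by (intro group_sumsetI) auto
            moreover have "y = \<gamma> + ((- \<gamma> + z) + (- z + y))" by (simp only: add.assoc add_minus_cancel)
            ultimately show False using False by blast
          qed
          then have "ennreal (g (- \<gamma> + z)) * ennreal (\<Theta> (- z + y)) \<le> q \<gamma> z" by (auto simp: q_def cut_off_def)
          then have "ennreal (cmod (f z)) * (ennreal (g (- \<gamma> + z)) * ennreal (\<Theta> (- z + y))) \<le> ennreal (cmod (f z)) * q \<gamma> z"
            by (rule mult_left_mono) simp
          then show "ennreal (g (- \<gamma> + z)) * ennreal (cmod (f z)) * ennreal (\<Theta> (- z + y)) \<le> ennreal (cmod (f z)) * q \<gamma> z"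
            by (simp only: ac_simps)
        qed
        finally show ?thesis using False by simp
      qed simp
    qed
    also have "\<dots> = (\<integral>\<^sup>+ z. \<integral>\<^sup>+ \<gamma>. ennreal (cmod (f z)) * q \<gamma> z \<partial>count_space \<Gamma> \<partial>\<mu>)"
      by (rule nn_integral_count_space_nn_integral[symmetric, OF cnt]) simp
    also have "\<dots> \<le> nconv \<mu> f (\<lambda>z. ennreal M * (?I1 * ennreal (\<Theta> z) + ?I * ennreal (cut_off L \<Theta> z))) y"
      unfolding nconv_def
    proof (rule nn_integral_mono)
      fix z
      have "(\<integral>\<^sup>+ \<gamma>. ennreal (cmod (f z)) * q \<gamma> z \<partial>count_space \<Gamma>) = ennreal (cmod (f z)) * (\<integral>\<^sup>+ \<gamma>. q \<gamma> z \<partial>count_space \<Gamma>)"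
        by (rule nn_integral_cmult) simp
      also have "(\<integral>\<^sup>+ \<gamma>. q \<gamma> z \<partial>count_space \<Gamma>) = (\<integral>\<^sup>+ \<gamma>. ennreal (cut_off L g (- \<gamma> + z)) \<partial>count_space \<Gamma>) * ennreal (\<Theta> (- z + y))
          + (\<integral>\<^sup>+ \<gamma>. ennreal (g (- \<gamma> + z)) \<partial>count_space \<Gamma>) * ennreal (cut_off L \<Theta> (- z + y))"
        unfolding q_def by (subst nn_integral_add) (auto simp: nn_integral_multc)
      also have "\<dots> \<le> (ennreal M * ?I1) * ennreal (\<Theta> (- z + y)) + (ennreal M * ?I) * ennreal (cut_off L \<Theta> (- z + y))"
        by (intro add_mono mult_right_mono M(2)) auto
      also have "\<dots> = ennreal M * (?I1 * ennreal (\<Theta> (- z + y)) + ?I * ennreal (cut_off L \<Theta> (- z + y)))"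
        by (simp only: distrib_left mult.assoc)
      finally show "(\<integral>\<^sup>+ \<gamma>. ennreal (cmod (f z)) * q \<gamma> z \<partial>count_space \<Gamma>) \<le> ennreal (cmod (f z)) * (ennreal M * (?I1 * ennreal (\<Theta> (- z + y)) + ?I * ennreal (cut_off L \<Theta> (- z + y))))"
        by (simp add: mult_left_mono)
    qed
    finally show "tail ?U f y \<le> nconv \<mu> f (\<lambda>z. ennreal M * (?I1 * ennreal (\<Theta> z) + ?I * ennreal (cut_off L \<Theta> z))) y" .
  qed
qed

lemma tail_in_E:
  obtains C where "0 < C" "\<And>f. f \<in> S \<Longrightarrow> \<exists>F\<in>E. nE F \<le> C * nE f \<and> (AE y in \<mu>. tail {} f y \<le> ennreal (cmod (F y)))"
    "\<And>e. 0 < e \<Longrightarrow> \<exists>U. compact U \<and> (\<forall>f\<in>S. \<exists>F\<in>E. nE F \<le> e * nE f \<and> (AE y in \<mu>. tail U f y \<le> ennreal (cmod (F y))))"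
proof -
  obtain C1 where C1: "0 < C1" "\<And>f h b. f \<in> E \<Longrightarrow> h \<in> borel_measurable borel \<Longrightarrow> 0 < b \<Longrightarrow>
     (wint h) \<le> ennreal b \<Longrightarrow>
     \<exists>F\<in>E. nE F \<le> C1 * b * nE f \<and> (AE x in \<mu>. nconv \<mu> f h x = ennreal (cmod (F x)))"
    using nconv_bounded_in_E by blast
  define I where "I k = (wint (env Q k))" for k
  define J where "J k = (\<integral>\<^sup>+ x. ennreal (k x) * ennreal (w x) \<partial>\<mu>)" for k
  obtain M where M: "0 < M" "\<And>L f y. L \<in> sets borel \<Longrightarrow> f \<in> S \<Longrightarrow> tail (group_sumset L L) f y \<le>
     nconv \<mu> f (\<lambda>z. ennreal M * (I (cut_off L g) * ennreal (\<Theta> z) + I g * ennreal (cut_off L \<Theta> z))) y"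
    unfolding I_def using tail_bound by blast
  have gen: "\<exists>F\<in>E. nE F \<le> C1 * b * nE f \<and> (AE y in \<mu>. tail (group_sumset L L) f y \<le> ennreal (cmod (F y)))"
    if L[measurable]: "L \<in> sets borel" and b: "0 < b" "ennreal M * (I (cut_off L g) * J \<Theta> + I g * J (cut_off L \<Theta>)) \<le> ennreal b"
      and f: "f \<in> S" for L b f
  proof -
    let ?h = "\<lambda>z. ennreal M * (I (cut_off L g) * ennreal (\<Theta> z) + I g * ennreal (cut_off L \<Theta> z))"
    have "(\<integral>\<^sup>+ x. ?h x * ennreal (w x) \<partial>\<mu>) = (\<integral>\<^sup>+ x. ennreal M * (I (cut_off L g) * (ennreal (\<Theta> x) * ennreal (w x)) + I g * (ennreal (cut_off L \<Theta> x) * ennreal (w x))) \<partial>\<mu>)"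
      by (simp only: mult.assoc distrib_right)
    also have "\<dots> = ennreal M * (I (cut_off L g) * J \<Theta> + I g * J (cut_off L \<Theta>))"
      unfolding J_def by (simp add: nn_integral_cmult nn_integral_add)
    finally have "(\<integral>\<^sup>+ x. ?h x * ennreal (w x) \<partial>\<mu>) \<le> ennreal b" using b(2) by simp
    moreover have "?h \<in> borel_measurable borel" by measurable
    moreover have "f \<in> E" using f S_E by blast
    ultimately obtain F where F: "F \<in> E" "nE F \<le> C1 * b * nE f" "AE x in \<mu>. nconv \<mu> f ?h x = ennreal (cmod (F x))"
      using C1(2)[of f ?h b] b(1) by blast
    have "AE y in \<mu>. tail (group_sumset L L) f y \<le> ennreal (cmod (F y))"
      using F(3)
    proof eventually_elim
      case (elim y)
      show ?case using M(2)[OF L f, of y] unfolding elim .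
    qed
    then show ?thesis using F by blast
  qed
  obtain i where i: "I g = ennreal i" "0 \<le> i" using g_env unfolding I_def[symmetric] by (cases "I g") auto
  have "J \<Theta> < \<infinity>" unfolding J_def using kernel_integral_le_env[of \<Theta>] \<Theta>_env by (rule le_less_trans)
  then obtain j where j: "J \<Theta> = ennreal j" "0 \<le> j" by (cases "J \<Theta>") auto
  show ?thesis
  proof (rule that)
    define b where "b = M * (i * j + i * j) + 1"
    have b0: "0 < b" using M(1) i j by (simp add: b_def add_nonneg_pos)
    show "0 < C1 * b" using b0 C1(1) by simp
    fix f assume f: "f \<in> S"
    \<comment> \<open>The choice \<open>L = {}\<close> cuts nothing off, and its sumset is empty, so
      the same estimate bounds the full absolute sum.\<close>
    have "cut_off {} k = k" for k :: "'g \<Rightarrow> real" by (simp add: cut_off_def fun_eq_iff)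
    moreover have "ennreal M * (I g * J \<Theta> + I g * J \<Theta>) \<le> ennreal b"
      using M(1) i j by (simp add: ennreal_mult[symmetric] ennreal_plus[symmetric] b_def ennreal_leI del: ennreal_plus)
    ultimately have "\<exists>F\<in>E. nE F \<le> C1 * b * nE f \<and> (AE y in \<mu>. tail (group_sumset {} {}) f y \<le> ennreal (cmod (F y)))"
      by (intro gen f b0) auto
    then show "\<exists>F\<in>E. nE F \<le> C1 * b * nE f \<and> (AE y in \<mu>. tail {} f y \<le> ennreal (cmod (F y)))"
      by (simp add: group_sumset_def)
  next
    fix e :: real assume e: "0 < e"
    \<comment> \<open>Both cut-off quantities are below \<open>\<delta>\<close>, so the kernel has
      weighted norm at most \<open>M * \<delta> * (i + j)\<close>; the denominator brings this below
      \<open>e / C1\<close>, and the 1 keeps it nonzero.\<close>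
    define \<delta> where "\<delta> = e / (C1 * M * (i + j + 1))"
    have \<delta>: "0 < \<delta>" using e C1(1) M(1) i j by (simp add: \<delta>_def)
    obtain L where L: "compact L" "I (cut_off L g) < ennreal \<delta>" "J (cut_off L \<Theta>) < ennreal \<delta>"
      using ex_small_cut_off[OF g_meas g_nonneg \<Theta>_meas \<Theta>_nonneg g_env \<open>J \<Theta> < \<infinity>\<close>[unfolded J_def] \<delta>]
      unfolding I_def J_def by blast
    have Lb: "L \<in> sets borel" by (rule borel_compact[OF L(1)])
    have "ennreal M * (I (cut_off L g) * J \<Theta> + I g * J (cut_off L \<Theta>)) \<le> ennreal M * (ennreal \<delta> * ennreal j + ennreal i * ennreal \<delta>)"
      using L(2,3) i j by (intro mult_left_mono add_mono mult_mono) auto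
    also have "\<dots> = ennreal (M * (\<delta> * j + i * \<delta>))"
      using M(1) i j \<delta> by (simp add: ennreal_mult[symmetric] ennreal_plus[symmetric] del: ennreal_plus)
    also have "\<dots> \<le> ennreal (e / C1)"
    proof (rule ennreal_leI)
      have "M * (\<delta> * j + i * \<delta>) \<le> M * \<delta> * (i + j + 1)" using M(1) \<delta> by (simp add: algebra_simps)
      also have "\<dots> = e / C1"
      proof -
        have "0 < i + j + 1" using i j by simp
        then show ?thesis using M(1) C1(1) by (simp add: \<delta>_def)
      qed
      finally show "M * (\<delta> * j + i * \<delta>) \<le> e / C1" .
    qed
    finally have le: "ennreal M * (I (cut_off L g) * J \<Theta> + I g * J (cut_off L \<Theta>)) \<le> ennreal (e / C1)" .
    have "\<exists>F\<in>E. nE F \<le> e * nE f \<and> (AE y in \<mu>. tail (group_sumset L L) f y \<le> ennreal (cmod (F y)))" if f: "f \<in> S" for f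
      using gen[OF Lb _ le f] e C1(1) by simp
    moreover have "compact (group_sumset L L)" by (intro compact_group_sumset L)
    ultimately show "\<exists>U. compact U \<and> (\<forall>f\<in>S. \<exists>F\<in>E. nE F \<le> e * nE f \<and> (AE y in \<mu>. tail U f y \<le> ennreal (cmod (F y))))"
      by blast
  qed
qed

section \<open>The sum of the family as a bounded invertible operator on \<open>S\<close>\<close>

lemma sum_ops_in: "f \<in> S \<Longrightarrow> sum_ops \<Gamma> T f \<in> S"
  using bij by (auto simp: bij_betw_def)

lemma tail_empty: "tail {} f y = (\<integral>\<^sup>+ \<gamma>. ennreal (cmod (T \<gamma> f y)) \<partial>count_space \<Gamma>)"
  by (simp add: tail_def)

lemma sum_ops_le: "ennreal (cmod (sum_ops \<Gamma> T f y)) \<le> tail {} f y"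
proof (cases "tail {} f y < \<infinity>")
  case True
  then show ?thesis unfolding tail_empty sum_ops_def by (rule infsum_count_space(3))
next
  case False
  then show ?thesis by (simp add: less_top[symmetric])
qed

lemma AE_tail_finite: "f \<in> S \<Longrightarrow> AE y in \<mu>. tail {} f y < \<infinity>"
proof -
  assume f: "f \<in> S"
  obtain F where "AE y in \<mu>. tail {} f y \<le> ennreal (cmod (F y))" using tail_in_E f by metis
  then show ?thesis by eventually_elim (auto intro: le_less_trans)
qed

text \<open>A limit in \<open>E\<close> of elements of \<open>S\<close> agrees almost everywhere
  with an element of \<open>S\<close>, to which the convergence is transferred by solidity.
  Definiteness holds because a continuous function that vanishes almost everywhere is 0.\<close>

lemma function_banach_S: "function_banach S nE"
proof
  show "is_subspace S" by (rule S_subspace)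
  show "0 \<le> nE f" if "f \<in> S" for f using that S_E nE_nonneg by blast
  show "nE f = 0 \<longleftrightarrow> f = (\<lambda>x. 0)" if f: "f \<in> S" for f
  proof
    assume "nE f = 0"
    then have "AE x in \<mu>. f x = 0" using f S_E nE_eq_0_iff by blast
    then show "f = (\<lambda>x. 0)" using S_cont[OF f] by (intro continuous_AE_eq) auto
  qed (simp add: N_zero)
  show "nE (\<lambda>x. f x + h x) \<le> nE f + nE h" if "f \<in> S" "h \<in> S" for f h using that S_E nE_add by blast
  show "nE (\<lambda>x. c * f x) = cmod c * nE f" if "f \<in> S" for f c using that S_E nE_scale by blast
  fix F :: "nat \<Rightarrow> 'g \<Rightarrow> complex"
  assume F: "\<And>n. F n \<in> S" and c: "\<And>\<epsilon>. 0 < \<epsilon> \<Longrightarrow> \<exists>n0. \<forall>m\<ge>n0. \<forall>n\<ge>n0. nE (\<lambda>x. F m x - F n x) < \<epsilon>"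
  have FE: "F n \<in> E" for n using F S_E by blast
  obtain f where f: "f \<in> E" "(\<lambda>n. nE (\<lambda>x. F n x - f x)) \<longlonglongrightarrow> 0"
    using E_complete[OF FE c] by blast
  then obtain h where h: "h \<in> S" "AE x in \<mu>. f x = h x"
    using S_closed F unfolding closed_mod_ae_def ae_eq_def by blast
  have hE: "h \<in> E" using h S_E by blast
  have "nE (\<lambda>x. F n x - h x) \<le> nE (\<lambda>x. F n x - f x)" for n
  proof (rule E_solid(2)[OF X_diff[OF FE f(1)] E_measurable[OF X_diff[OF FE hE]]])
    show "AE x in \<mu>. cmod (F n x - h x) \<le> cmod (F n x - f x)" using h(2) by eventually_elim simp
  qed
  then have "(\<lambda>n. nE (\<lambda>x. F n x - h x)) \<longlonglongrightarrow> 0"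
    using nE_nonneg[OF X_diff[OF FE hE]] by (intro tendsto_sandwich[OF _ _ tendsto_const f(2)]) auto
  then show "\<exists>f\<in>S. (\<lambda>n. nE (\<lambda>x. F n x - f x)) \<longlonglongrightarrow> 0" using h(1) by blast
qed

lemma S_add: "f \<in> S \<Longrightarrow> h \<in> S \<Longrightarrow> (\<lambda>x. f x + h x) \<in> S"
  using S_subspace unfolding is_subspace_def by blast

text \<open>Pointwise sums are absolutely convergent only almost everywhere, so additivity is first
  obtained there; both sides are continuous, hence equal everywhere.\<close>

lemma sum_ops_add:
  assumes "f \<in> S" "h \<in> S"
  shows "sum_ops \<Gamma> T (\<lambda>x. f x + h x) = (\<lambda>x. sum_ops \<Gamma> T f x + sum_ops \<Gamma> T h x)"
proof (rule continuous_AE_eq)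
  show "continuous_on UNIV (sum_ops \<Gamma> T (\<lambda>x. f x + h x))"
    by (intro S_cont sum_ops_in S_add assms)
  show "continuous_on UNIV (\<lambda>x. sum_ops \<Gamma> T f x + sum_ops \<Gamma> T h x)"
    by (intro S_cont sum_ops_in S_add assms)
  show "AE x in \<mu>. sum_ops \<Gamma> T (\<lambda>x. f x + h x) x = sum_ops \<Gamma> T f x + sum_ops \<Gamma> T h x"
    using AE_tail_finite[OF assms(1)] AE_tail_finite[OF assms(2)] AE_tail_finite[OF S_add[OF assms]]
  proof eventually_elim
    case (elim x)
    note e = elim[unfolded tail_empty]
    have "sum_ops \<Gamma> T (\<lambda>x. f x + h x) x = (\<integral>\<gamma>. T \<gamma> (\<lambda>x. f x + h x) x \<partial>count_space \<Gamma>)"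
      unfolding sum_ops_def by (rule infsum_count_space(2)[OF e(3)])
    also have "\<dots> = (\<integral>\<gamma>. T \<gamma> f x + T \<gamma> h x \<partial>count_space \<Gamma>)"
      by (rule Bochner_Integration.integral_cong[OF refl]) (simp add: T_add assms)
    also have "\<dots> = (\<integral>\<gamma>. T \<gamma> f x \<partial>count_space \<Gamma>) + (\<integral>\<gamma>. T \<gamma> h x \<partial>count_space \<Gamma>)"
      by (rule Bochner_Integration.integral_add[OF infsum_count_space(1)[OF e(1)] infsum_count_space(1)[OF e(2)]])
    also have "\<dots> = sum_ops \<Gamma> T f x + sum_ops \<Gamma> T h x"
      unfolding sum_ops_def by (simp only: infsum_count_space(2)[OF e(1)] infsum_count_space(2)[OF e(2)])
    finally show ?case .
  qed
qed

lemma sum_ops_scale: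
  assumes "f \<in> S"
  shows "sum_ops \<Gamma> T (\<lambda>x. c * f x) = (\<lambda>x. c * sum_ops \<Gamma> T f x)"
proof
  fix x
  have "sum_ops \<Gamma> T (\<lambda>x. c * f x) x = (\<Sum>\<^sub>\<infinity>\<gamma>\<in>\<Gamma>. c * T \<gamma> f x)"
    unfolding sum_ops_def by (rule infsum_cong) (simp add: T_scale assms)
  also have "\<dots> = c * (\<Sum>\<^sub>\<infinity>\<gamma>\<in>\<Gamma>. T \<gamma> f x)" by (rule infsum_cmult_right')
  finally show "sum_ops \<Gamma> T (\<lambda>x. c * f x) x = c * sum_ops \<Gamma> T f x" by (simp add: sum_ops_def)
qed

text \<open>Domination by \<open>tail {}\<close> shows that the operator is bounded, and its assumed
  bijectivity then gives a bounded inverse.\<close>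

lemma sum_ops_inverse_bounded: "\<exists>C>0. \<forall>f\<in>S. nE f \<le> C * nE (sum_ops \<Gamma> T f)"
proof -
  interpret FB: function_banach S nE by (rule function_banach_S)
  obtain C where C: "\<And>f. f \<in> S \<Longrightarrow> \<exists>F\<in>E. nE F \<le> C * nE f \<and> (AE y in \<mu>. tail {} f y \<le> ennreal (cmod (F y)))"
    using tail_in_E by metis
  have bound: "nE (sum_ops \<Gamma> T f) \<le> C * nE f" if f: "f \<in> S" for f
  proof -
    obtain F where F: "F \<in> E" "nE F \<le> C * nE f" "AE y in \<mu>. tail {} f y \<le> ennreal (cmod (F y))"
      using C[OF f] by blast
    have ae: "AE y in \<mu>. cmod (sum_ops \<Gamma> T f y) \<le> cmod (F y)"
      using F(3)
    proof eventually_elim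
      case (elim y)
      have "ennreal (cmod (sum_ops \<Gamma> T f y)) \<le> ennreal (cmod (F y))" using sum_ops_le elim by (rule order_trans)
      then show ?case by simp
    qed
    have "nE (sum_ops \<Gamma> T f) \<le> nE F"
      by (rule E_solid(2)[OF F(1) S_measurable[OF sum_ops_in[OF f]] ae])
    then show ?thesis using F(2) by simp
  qed
  show ?thesis by (rule FB.bounded_inverse[OF bij sum_ops_add sum_ops_scale bound])
qed

text \<open>On \<open>\<gamma> + U\<close> Cauchy-Schwarz bounds the integral of
  \<open>T \<gamma> f\<close> by its L2 norm times \<open>sqrt m\<close>. The kernel, moved to a
  base point \<open>y\<close> in \<open>\<gamma> + V\<close>, is bounded by its envelope, and
  averaging over \<open>y\<close> produces the indicator functions that make up the sequence-space
  function of these norms.\<close>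

lemma near_part_bound:
  assumes U: "compact U"
  obtains h where "h \<in> borel_measurable borel" "wint h < \<infinity>"
    "\<And>f x. f \<in> S \<Longrightarrow> near U f x
       \<le> nconv \<mu> (EdT f) h x"
proof -
  note [measurable] = borel_compact[OF U]
  \<comment> \<open>Moving from \<open>y' = \<gamma> + u\<close> to \<open>y = \<gamma> + v'\<close>
    multiplies the kernel argument on the left by \<open>- u + v'\<close>, so the envelope is taken
    over an open set containing \<open>- U + V\<close>.\<close>
  define C where "C = group_sumset (group_sumset (uminus ` U) V) Q"
  have C: "open C" unfolding C_def by (intro open_group_sumset open_interior)
  have "C \<subseteq> group_sumset (group_sumset (uminus ` U) (closure V)) (closure V)"
    unfolding C_def using V_subset_closure Q_subset_V by (intro group_sumset_mono) auto
  then have KC: "wint (env C K) < \<infinity>"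
    by (rule nn_integral_env_finite[OF K_env compact_group_sumset[OF compact_group_sumset[OF compact_uminus[OF U] compact_closure_V] compact_closure_V] C])
  define \<kappa> where "\<kappa> = env C K"
  have [measurable]: "\<kappa> \<in> borel_measurable borel" unfolding \<kappa>_def by (rule borel_measurable_env[OF C])
  have inC: "- u + v \<in> C" if "u \<in> U" "v \<in> V" for u v
    unfolding C_def using group_sumsetI[OF group_sumsetI zero_in_Q, of "- u" "uminus ` U" v V] that by simp
  obtain m where m: "emeasure \<mu> U = ennreal m" "0 \<le> m" using emeasure_compact[OF U] by (cases "emeasure \<mu> U") auto
  have "emeasure \<mu> V \<le> emeasure \<mu> (closure V)"
    using V_subset_closure borel_compact[OF compact_closure_V] by (intro emeasure_mono) auto
  also have "\<dots> < \<infinity>" by (rule emeasure_compact[OF compact_closure_V])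
  finally obtain v where v: "emeasure \<mu> V = ennreal v" "0 \<le> v" by (cases "emeasure \<mu> V") auto
  have "emeasure \<mu> Q \<le> emeasure \<mu> V" using Q_subset_V by (intro emeasure_mono) auto
  then have "0 < emeasure \<mu> V" using emeasure_Q(1) by simp
  then have v0: "0 < v" using v by (simp add: ennreal_less_zero_iff)
  \<comment> \<open>\<open>sqrt m\<close> comes from Cauchy-Schwarz on a set of measure
    \<open>m\<close>, and \<open>1 / v\<close> from averaging over a set of measure
    \<open>v\<close>.\<close>
  define d where "d = sqrt m / v"
  define h where "h z = ennreal d * \<kappa> z" for z
  show ?thesis
  proof (rule that[of h])
    show "h \<in> borel_measurable borel" unfolding h_def by measurable
    have "wint h = ennreal d * (wint \<kappa>)"
      unfolding h_def mult.assoc by (rule nn_integral_cmult) simp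
    also have "\<dots> < \<infinity>" using KC by (simp add: \<kappa>_def ennreal_mult_less_top)
    finally show "wint h < \<infinity>" .
    fix f x assume f: "f \<in> S"
    let ?X = "\<lambda>\<gamma>. \<integral>\<^sup>+ y. ennreal (cmod (T \<gamma> f y)) * indicator (ltr \<gamma> U) y * ennreal (K (- y + x)) \<partial>\<mu>"
    let ?c = "\<lambda>\<gamma>. L2_norm \<mu> (T \<gamma> f)"
    have one: "?X \<gamma> \<le> (\<integral>\<^sup>+ y. ennreal \<bar>?c \<gamma>\<bar> * indicator (ltr \<gamma> V) y * h (- y + x) \<partial>\<mu>)" if \<gamma>: "\<gamma> \<in> \<Gamma>" for \<gamma>
    proof -
      note [measurable] = S_measurable[OF T_in[OF \<gamma> f]]
      define b where "b = (\<integral>\<^sup>+ y. ennreal (cmod (T \<gamma> f y)) * indicator (ltr \<gamma> U) y \<partial>\<mu>)"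
      have fin: "L2_sq \<mu> (T \<gamma> f) < \<infinity>" using upper_bound f \<gamma> by metis
      then obtain s where s: "L2_sq \<mu> (T \<gamma> f) = ennreal s" "0 \<le> s" by (cases "L2_sq \<mu> (T \<gamma> f)") auto
      have c: "?c \<gamma> = sqrt s" using s by (simp add: L2_norm_def)
      have "b\<^sup>2 \<le> (\<integral>\<^sup>+ y. (ennreal (cmod (T \<gamma> f y)))\<^sup>2 \<partial>\<mu>) * (\<integral>\<^sup>+ y. (indicator (ltr \<gamma> U) y)\<^sup>2 \<partial>\<mu>)"
        unfolding b_def by (rule Cauchy_Schwarz_nn_integral) auto
      also have "(\<integral>\<^sup>+ y. (ennreal (cmod (T \<gamma> f y)))\<^sup>2 \<partial>\<mu>) = ennreal s"
        unfolding s(1)[symmetric] L2_sq_def by (simp add: ennreal_power)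
      also have "(\<integral>\<^sup>+ y. (indicator (ltr \<gamma> U) y)\<^sup>2 \<partial>\<mu>) = (\<integral>\<^sup>+ y. indicator (ltr \<gamma> U) y \<partial>\<mu>)"
        by (intro nn_integral_cong) (auto simp: indicator_def)
      also have "\<dots> = ennreal m" using m by (simp add: emeasure_add_left)
      finally have "b\<^sup>2 \<le> ennreal (s * m)" using s m by (simp add: ennreal_mult)
      also have "\<dots> = (ennreal (sqrt s * sqrt m))\<^sup>2"
        using s m by (simp add: ennreal_power power_mult_distrib)
      finally have sq: "b\<^sup>2 \<le> (ennreal (sqrt s * sqrt m))\<^sup>2" .
      have b: "b \<le> ennreal (sqrt s * sqrt m)"
      proof (cases b)
        case (real r)
        have n: "0 \<le> sqrt s * sqrt m" using s(2) m(2) by simp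
        have "ennreal (r\<^sup>2) \<le> ennreal ((sqrt s * sqrt m)\<^sup>2)"
          using sq unfolding real(2) ennreal_power[OF real(1)] ennreal_power[OF n] .
        then have "r\<^sup>2 \<le> (sqrt s * sqrt m)\<^sup>2" by (subst (asm) ennreal_le_iff) auto
        then have "r \<le> sqrt s * sqrt m" using n by (rule power2_le_imp_le)
        then show ?thesis unfolding real(2) by (rule ennreal_leI)
      next
        case top
        have n: "0 \<le> sqrt s * sqrt m" using s(2) m(2) by simp
        show ?thesis using sq unfolding top ennreal_power[OF n] by (simp add: top_unique)
      qed
      \<comment> \<open>The left side does not depend on \<open>y\<close>, which is what permits
        averaging over \<open>\<gamma> + V\<close>.\<close>
      have Xle: "?X \<gamma> \<le> b * \<kappa> (- y + x)" if y: "y \<in> ltr \<gamma> V" for y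
      proof -
        obtain v' where v': "v' \<in> V" "y = \<gamma> + v'" using y by auto
        have "?X \<gamma> \<le> (\<integral>\<^sup>+ y'. ennreal (cmod (T \<gamma> f y')) * indicator (ltr \<gamma> U) y' * \<kappa> (- y + x) \<partial>\<mu>)"
        proof (rule nn_integral_mono)
          fix y'
          show "ennreal (cmod (T \<gamma> f y')) * indicator (ltr \<gamma> U) y' * ennreal (K (- y' + x))
             \<le> ennreal (cmod (T \<gamma> f y')) * indicator (ltr \<gamma> U) y' * \<kappa> (- y + x)"
          proof (cases "y' \<in> ltr \<gamma> U")
            case True
            then obtain u where u: "u \<in> U" "y' = \<gamma> + u" by auto
            have "- y' + x = (- u + v') + (- y + x)" unfolding u(2) v'(2)
              by (simp only: minus_add add.assoc add_minus_cancel)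
            then have "ennreal (K (- y' + x)) \<le> \<kappa> (- y + x)"
              unfolding \<kappa>_def using env_upper[OF inC[OF u(1) v'(1)], of K "- y + x"] by simp
            then show ?thesis by (intro mult_left_mono) auto
          qed simp
        qed
        also have "\<dots> = b * \<kappa> (- y + x)" unfolding b_def by (rule nn_integral_multc) simp
        finally show ?thesis .
      qed
      have "ennreal v * ?X \<gamma> = (\<integral>\<^sup>+ y. ?X \<gamma> * indicator (ltr \<gamma> V) y \<partial>\<mu>)"
        using v by (subst nn_integral_cmult_indicator) (auto simp: emeasure_add_left mult.commute)
      also have "\<dots> \<le> (\<integral>\<^sup>+ y. ennreal (sqrt s * sqrt m) * (indicator (ltr \<gamma> V) y * \<kappa> (- y + x)) \<partial>\<mu>)"
      proof (rule nn_integral_mono)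
        fix y
        show "?X \<gamma> * indicator (ltr \<gamma> V) y \<le> ennreal (sqrt s * sqrt m) * (indicator (ltr \<gamma> V) y * \<kappa> (- y + x))"
        proof (cases "y \<in> ltr \<gamma> V")
          case True
          have "?X \<gamma> \<le> ennreal (sqrt s * sqrt m) * \<kappa> (- y + x)"
            using Xle[OF True] mult_right_mono[OF b, of "\<kappa> (- y + x)"] by (meson order_trans zero_le)
          then show ?thesis using True by simp
        qed simp
      qed
      finally have le: "ennreal v * ?X \<gamma> \<le> (\<integral>\<^sup>+ y. ennreal (sqrt s * sqrt m) * (indicator (ltr \<gamma> V) y * \<kappa> (- y + x)) \<partial>\<mu>)" .
      have "?X \<gamma> = ennreal (1 / v) * (ennreal v * ?X \<gamma>)"
        using v0 by (simp add: mult.assoc[symmetric] ennreal_mult[symmetric])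
      also have "\<dots> \<le> ennreal (1 / v) * (\<integral>\<^sup>+ y. ennreal (sqrt s * sqrt m) * (indicator (ltr \<gamma> V) y * \<kappa> (- y + x)) \<partial>\<mu>)"
        by (intro mult_left_mono le) simp
      also have "\<dots> = (\<integral>\<^sup>+ y. ennreal (1 / v) * (ennreal (sqrt s * sqrt m) * (indicator (ltr \<gamma> V) y * \<kappa> (- y + x))) \<partial>\<mu>)"
        by (rule nn_integral_cmult[symmetric]) simp
      also have "\<dots> = (\<integral>\<^sup>+ y. ennreal \<bar>?c \<gamma>\<bar> * indicator (ltr \<gamma> V) y * h (- y + x) \<partial>\<mu>)"
      proof -
        have "ennreal (1 / v) * ennreal (sqrt s * sqrt m) = ennreal \<bar>?c \<gamma>\<bar> * ennreal d"
          unfolding c d_def using s m v0 by (simp add: ennreal_mult[symmetric])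
        then have "ennreal (1 / v) * (ennreal (sqrt s * sqrt m) * (indicator (ltr \<gamma> V) y * \<kappa> (- y + x)))
           = ennreal \<bar>?c \<gamma>\<bar> * indicator (ltr \<gamma> V) y * h (- y + x)" for y
          unfolding h_def mult.assoc[symmetric] by (simp only: ac_simps)
        then show ?thesis by (simp only:)
      qed
      finally show ?thesis .
    qed
    have "(\<integral>\<^sup>+ \<gamma>. ?X \<gamma> \<partial>count_space \<Gamma>) \<le> (\<integral>\<^sup>+ \<gamma>. \<integral>\<^sup>+ y. ennreal \<bar>?c \<gamma>\<bar> * indicator (ltr \<gamma> V) y * h (- y + x) \<partial>\<mu> \<partial>count_space \<Gamma>)"
      by (intro nn_integral_mono one) simp
    also have "\<dots> = (\<integral>\<^sup>+ y. \<integral>\<^sup>+ \<gamma>. ennreal \<bar>?c \<gamma>\<bar> * indicator (ltr \<gamma> V) y * h (- y + x) \<partial>count_space \<Gamma> \<partial>\<mu>)"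
      by (rule nn_integral_count_space_nn_integral[symmetric, OF cnt]) (simp add: h_def)
    also have "\<dots> = nconv \<mu> (Ed_fun V \<Gamma> ?c) h x"
      unfolding nconv_def Ed_fun_eq(1) by (simp add: nn_integral_multc)
    finally show "(\<integral>\<^sup>+ \<gamma>. ?X \<gamma> \<partial>count_space \<Gamma>) \<le> nconv \<mu> (Ed_fun V \<Gamma> ?c) h x" .
  qed
qed

text \<open>The reproducing bound is applied to each \<open>T \<gamma> f\<close> separately, before
  summing, because the set \<open>\<gamma> + U\<close> at which the integral is split depends on
  \<open>\<gamma>\<close>.\<close>

lemma sum_ops_le_near_tail:
  assumes f: "f \<in> S" and U: "compact U"
  shows "ennreal (cmod (sum_ops \<Gamma> T f x)) \<le>
    near U f x
     + (\<integral>\<^sup>+ y. tail U f y * ennreal (K (- y + x)) \<partial>\<mu>)"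
proof -
  note [measurable] = borel_compact[OF U]
  have [measurable]: "- ltr \<gamma> U \<in> sets borel" for \<gamma>
    using sets.compl_sets[OF sets_add_left[OF borel_compact[OF U], of \<gamma>]] by (simp add: Compl_eq_Diff_UNIV)
  let ?n = "\<lambda>\<gamma> y. ennreal (cmod (T \<gamma> f y)) * indicator (ltr \<gamma> U) y * ennreal (K (- y + x))"
  let ?t = "\<lambda>\<gamma> y. ennreal (cmod (T \<gamma> f y)) * indicator (- ltr \<gamma> U) y * ennreal (K (- y + x))"
  have "ennreal (cmod (sum_ops \<Gamma> T f x)) \<le> (\<integral>\<^sup>+ \<gamma>. ennreal (cmod (T \<gamma> f x)) \<partial>count_space \<Gamma>)"
    using sum_ops_le[of f x] by (simp add: tail_empty)
  also have "\<dots> \<le> (\<integral>\<^sup>+ \<gamma>. (\<integral>\<^sup>+ y. ?n \<gamma> y \<partial>\<mu>) + (\<integral>\<^sup>+ y. ?t \<gamma> y \<partial>\<mu>) \<partial>count_space \<Gamma>)"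
  proof (rule nn_integral_mono)
    fix \<gamma> assume "\<gamma> \<in> space (count_space \<Gamma>)"
    then have \<gamma>: "\<gamma> \<in> \<Gamma>" by simp
    note [measurable] = S_measurable[OF T_in[OF \<gamma> f]]
    have "ennreal (cmod (T \<gamma> f x)) \<le> nconv \<mu> (T \<gamma> f) (\<lambda>z. ennreal (K z)) x" by (rule K_bound[OF T_in[OF \<gamma> f]])
    also have "\<dots> = (\<integral>\<^sup>+ y. ?n \<gamma> y + ?t \<gamma> y \<partial>\<mu>)"
      unfolding nconv_def by (intro nn_integral_cong) (auto simp: indicator_def)
    also have "\<dots> = (\<integral>\<^sup>+ y. ?n \<gamma> y \<partial>\<mu>) + (\<integral>\<^sup>+ y. ?t \<gamma> y \<partial>\<mu>)" by (rule nn_integral_add) auto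
    finally show "ennreal (cmod (T \<gamma> f x)) \<le> (\<integral>\<^sup>+ y. ?n \<gamma> y \<partial>\<mu>) + (\<integral>\<^sup>+ y. ?t \<gamma> y \<partial>\<mu>)" .
  qed
  also have "\<dots> = (\<integral>\<^sup>+ \<gamma>. \<integral>\<^sup>+ y. ?n \<gamma> y \<partial>\<mu> \<partial>count_space \<Gamma>) + (\<integral>\<^sup>+ \<gamma>. \<integral>\<^sup>+ y. ?t \<gamma> y \<partial>\<mu> \<partial>count_space \<Gamma>)"
    by (rule nn_integral_add) auto
  also have "(\<integral>\<^sup>+ \<gamma>. \<integral>\<^sup>+ y. ?t \<gamma> y \<partial>\<mu> \<partial>count_space \<Gamma>) = (\<integral>\<^sup>+ y. \<integral>\<^sup>+ \<gamma>. ?t \<gamma> y \<partial>count_space \<Gamma> \<partial>\<mu>)"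
  proof (rule nn_integral_count_space_nn_integral[symmetric, OF cnt])
    fix \<gamma> assume \<gamma>: "\<gamma> \<in> \<Gamma>"
    note [measurable] = S_measurable[OF T_in[OF \<gamma> f]]
    show "?t \<gamma> \<in> borel_measurable \<mu>" by measurable
  qed
  also have "\<dots> = (\<integral>\<^sup>+ y. tail U f y * ennreal (K (- y + x)) \<partial>\<mu>)"
    unfolding tail_def by (simp add: nn_integral_multc)
  finally show ?thesis .
qed

text \<open>\<open>U\<close> is chosen so large that the part of \<open>T \<gamma> f\<close> outside \<open>\<gamma> + U\<close> contributes at most half of
  \<open>\<parallel>f\<parallel>\<close> after inverting the sum of the \<open>T \<gamma>\<close>; what remains is controlled by local \<open>L\<^sup>2\<close> norms.\<close>
lemma lower_bound:
  obtains c where "0 < c" "\<And>f. f \<in> S \<Longrightarrow> c * nE f \<le> nE (EdT f)"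
proof -
  obtain C1 where C1: "0 < C1" "\<And>f h b. f \<in> E \<Longrightarrow> h \<in> borel_measurable borel \<Longrightarrow> 0 < b \<Longrightarrow>
     (wint h) \<le> ennreal b \<Longrightarrow>
     \<exists>F\<in>E. nE F \<le> C1 * b * nE f \<and> (AE x in \<mu>. nconv \<mu> f h x = ennreal (cmod (F x)))"
    using nconv_bounded_in_E by blast
  obtain C0 where C0: "0 < C0" "\<And>f. f \<in> S \<Longrightarrow> nE f \<le> C0 * nE (sum_ops \<Gamma> T f)"
    using sum_ops_inverse_bounded by blast
  have "(\<integral>\<^sup>+ x. ennreal (K x) * ennreal (w x) \<partial>\<mu>) < \<infinity>"
    using kernel_integral_le_env[of K] K_env by (rule le_less_trans)
  then obtain k where "(\<integral>\<^sup>+ x. ennreal (K x) * ennreal (w x) \<partial>\<mu>) = ennreal k" "0 \<le> k"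
    by (cases "\<integral>\<^sup>+ x. ennreal (K x) * ennreal (w x) \<partial>\<mu>") auto
  then have k: "0 < k + 1" "(\<integral>\<^sup>+ x. ennreal (K x) * ennreal (w x) \<partial>\<mu>) \<le> ennreal (k + 1)" by (auto intro: ennreal_leI)
  \<comment> \<open>\<open>C0\<close> comes from inverting the sum and \<open>C1 * (k + 1)\<close>
    from convolving with \<open>K\<close>; their product with \<open>e\<close> is
    \<open>1 / 2\<close>, so this share of the norm of \<open>f\<close> can be subtracted.\<close>
  define e where "e = 1 / (2 * C0 * C1 * (k + 1))"
  have e: "0 < e" using C0(1) C1(1) k by (simp add: e_def)
  obtain U where U: "compact U" "\<And>f. f \<in> S \<Longrightarrow> \<exists>F\<in>E. nE F \<le> e * nE f \<and> (AE y in \<mu>. tail U f y \<le> ennreal (cmod (F y)))"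
    using tail_in_E e by metis
  obtain h where h: "h \<in> borel_measurable borel" "wint h < \<infinity>"
    "\<And>f x. f \<in> S \<Longrightarrow> near U f x
       \<le> nconv \<mu> (EdT f) h x"
    using near_part_bound[OF U(1)] by blast
  obtain b' where "wint h = ennreal b'" "0 \<le> b'"
    using h(2) by (cases "wint h") auto
  then have b: "0 < b' + 1" "wint h \<le> ennreal (b' + 1)" by (auto intro: ennreal_leI)
  define c where "c = 1 / (2 * C0 * (C1 * (b' + 1)))"
  have main: "c * nE f \<le> nE (EdT f)" if f: "f \<in> S" for f
  proof -
    let ?D = "EdT f"
    have DE: "?D \<in> E" using upper_bound f by metis
    obtain F where F: "F \<in> E" "nE F \<le> e * nE f" "AE y in \<mu>. tail U f y \<le> ennreal (cmod (F y))"
      using U(2)[OF f] by blast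
    obtain F1 where F1: "F1 \<in> E" "nE F1 \<le> C1 * (b' + 1) * nE ?D" "AE x in \<mu>. nconv \<mu> ?D h x = ennreal (cmod (F1 x))"
      using C1(2)[OF DE h(1) b] by blast
    have "(\<lambda>z. ennreal (K z)) \<in> borel_measurable borel" by measurable
    then obtain F2 where F2: "F2 \<in> E" "nE F2 \<le> C1 * (k + 1) * nE F" "AE x in \<mu>. nconv \<mu> F (\<lambda>z. ennreal (K z)) x = ennreal (cmod (F2 x))"
      using C1(2)[OF F(1) _ k] by blast
    have ae: "AE x in \<mu>. cmod (sum_ops \<Gamma> T f x) \<le> cmod (F1 x) + cmod (F2 x)"
      using F1(3) F2(3)
    proof eventually_elim
      case (elim x)
      have "(\<integral>\<^sup>+ y. tail U f y * ennreal (K (- y + x)) \<partial>\<mu>) \<le> nconv \<mu> F (\<lambda>z. ennreal (K z)) x"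
        unfolding nconv_def
      proof (rule nn_integral_mono_AE)
        show "AE y in \<mu>. tail U f y * ennreal (K (- y + x)) \<le> ennreal (cmod (F y)) * ennreal (K (- y + x))"
          using F(3) by eventually_elim (auto intro: mult_right_mono)
      qed
      then have "ennreal (cmod (sum_ops \<Gamma> T f x)) \<le> nconv \<mu> ?D h x + nconv \<mu> F (\<lambda>z. ennreal (K z)) x"
        using sum_ops_le_near_tail[OF f U(1), of x] h(3)[OF f, of x] by (meson add_mono order_trans)
      then have "ennreal (cmod (sum_ops \<Gamma> T f x)) \<le> ennreal (cmod (F1 x) + cmod (F2 x))"
        unfolding elim by simp
      then show ?case by (subst (asm) ennreal_le_iff) auto
    qed
    have "nE (sum_ops \<Gamma> T f) \<le> nE F1 + nE F2"
      by (rule E_solid_add(2)[OF F1(1) F2(1) S_measurable[OF sum_ops_in[OF f]] ae])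
    also have "\<dots> \<le> C1 * (b' + 1) * nE ?D + C1 * (k + 1) * (e * nE f)"
    proof (rule add_mono[OF F1(2)])
      have "C1 * (k + 1) * nE F \<le> C1 * (k + 1) * (e * nE f)"
        using C1(1) k(1) F(2) by (intro mult_left_mono) auto
      then show "nE F2 \<le> C1 * (k + 1) * (e * nE f)" using F2(2) by linarith
    qed
    finally have "C0 * nE (sum_ops \<Gamma> T f) \<le> C0 * (C1 * (b' + 1) * nE ?D + C1 * (k + 1) * (e * nE f))"
      using C0(1) by (intro mult_left_mono) auto
    then have "nE f \<le> C0 * (C1 * (b' + 1) * nE ?D + C1 * (k + 1) * (e * nE f))"
      using C0(2)[OF f] by simp
    also have "\<dots> = C0 * (C1 * (b' + 1)) * nE ?D + (C0 * C1 * (k + 1) * e) * nE f" by (simp add: algebra_simps)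
    also have "C0 * C1 * (k + 1) * e = 1 / 2" using C0(1) C1(1) k(1) by (simp add: e_def)
    finally have "nE f \<le> 2 * C0 * (C1 * (b' + 1)) * nE ?D" by simp
    moreover have "0 < 2 * C0 * (C1 * (b' + 1))" using C0(1) C1(1) b(1) by simp
    ultimately show ?thesis by (simp add: c_def divide_le_eq mult.commute)
  qed
  have "0 < c" using C0(1) C1(1) b(1) by (simp add: c_def)
  then show ?thesis using main that by blast
qed

end

section \<open>The norm equivalence\<close>

text \<open>Translating by \<open>x\<close> and then by \<open>- x\<close> returns \<open>f\<close>,
  so the product of the two operator norms is at least 1. This gives a uniform lower bound for an
  admissible weight.\<close>

lemma max_translation_norm_ge_1:
  fixes E :: "('g::{topological_group_add,t2_space} \<Rightarrow> complex) set"
  assumes BF: "BF_space \<mu> E nE" and TI: "translation_invariant E nE" and f: "f \<in> E" "0 < nE f"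
  shows "1 \<le> max (uE E nE x) (uE E nE (- x))"
proof -
  have sub: "is_subspace E" by (rule BF[unfolded BF_space_def, THEN conjunct2, THEN conjunct1])
  have scale: "(\<lambda>x. c * h x) \<in> E" if "h \<in> E" for c h using sub that unfolding is_subspace_def by blast
  have nn: "0 \<le> nE h" if "h \<in> E" for h
    using BF[unfolded BF_space_def, THEN conjunct2, THEN conjunct2, THEN conjunct1] that by blast
  have nscale: "nE (\<lambda>x. c * h x) = cmod c * nE h" if "h \<in> E" for c h
    using BF[unfolded BF_space_def, THEN conjunct2, THEN conjunct2, THEN conjunct2, THEN conjunct2, THEN conjunct1] that by blast
  have inE: "Ltr x h \<in> E" if "h \<in> E" for x h using TI that unfolding translation_invariant_def by blast
  have upper: "nE (Ltr x h) \<le> uE E nE x" if h: "h \<in> E" "nE h \<le> 1" for x h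
  proof -
    obtain B where B: "\<And>f. f \<in> E \<Longrightarrow> nE (Ltr x f) \<le> B * nE f"
      using TI unfolding translation_invariant_def by blast
    \<comment> \<open>\<open>opnorm\<close> is a real supremum, which bounds its members only when
      the set is bounded above.\<close>
    have "bdd_above {nE (Ltr x f) | f. f \<in> E \<and> nE f \<le> 1}"
    proof (rule bdd_aboveI)
      fix r assume "r \<in> {nE (Ltr x f) | f. f \<in> E \<and> nE f \<le> 1}"
      then obtain f where f: "f \<in> E" "nE f \<le> 1" "r = nE (Ltr x f)" by blast
      have "r \<le> B * nE f" using B f by simp
      also have "\<dots> \<le> \<bar>B\<bar> * nE f" using nn[OF f(1)] by (intro mult_right_mono) auto
      also have "\<dots> \<le> \<bar>B\<bar> * 1" using f(2) by (intro mult_left_mono) auto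
      finally show "r \<le> \<bar>B\<bar>" by simp
    qed
    then show ?thesis unfolding uE_def opnorm_def using h by (intro cSup_upper) auto
  qed
  have zero: "(\<lambda>x. 0) \<in> E" using sub unfolding is_subspace_def by blast
  have n0: "nE (\<lambda>x. 0) = 0" using nscale[OF zero, of 0] by simp
  have u0: "0 \<le> uE E nE x" for x
  proof -
    have "0 \<le> nE (Ltr x (\<lambda>x. 0))" by (rule nn[OF inE[OF zero]])
    also have "\<dots> \<le> uE E nE x" by (rule upper) (auto simp: zero n0)
    finally show ?thesis .
  qed
  have le: "nE (Ltr x h) \<le> uE E nE x * nE h" if h: "h \<in> E" "0 < nE h" for x h
  proof -
    let ?c = "complex_of_real (1 / nE h)"
    have "nE (Ltr x (\<lambda>y. ?c * h y)) \<le> uE E nE x"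
    proof (rule upper[OF scale[OF h(1)]])
      show "nE (\<lambda>y. ?c * h y) \<le> 1" unfolding nscale[OF h(1)] using h(2) by (simp add: norm_divide)
    qed
    moreover have "Ltr x (\<lambda>y. ?c * h y) = (\<lambda>y. ?c * Ltr x h y)" by (simp add: Ltr_def)
    ultimately have "1 / nE h * nE (Ltr x h) \<le> uE E nE x"
      using h(2) by (simp only: nscale[OF inE[OF h(1)]]) (simp add: norm_divide)
    then show ?thesis using h(2) by (simp add: field_simps)
  qed
  have Ltr_Ltr: "Ltr (- x) (Ltr x f) = f" by (simp add: Ltr_def add.assoc[symmetric])
  have pos: "0 < nE (Ltr x f)"
  proof (rule ccontr)
    assume "\<not> ?thesis"
    then have "nE (Ltr x f) = 0" using nn[OF inE[OF f(1)], of x] by linarith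
    moreover obtain B where "nE (Ltr (- x) (Ltr x f)) \<le> B * nE (Ltr x f)"
      using TI inE[OF f(1), of x] unfolding translation_invariant_def by blast
    ultimately show False using f(2) by (simp add: Ltr_Ltr)
  qed
  have "nE f \<le> uE E nE (- x) * nE (Ltr x f)" using le[OF inE[OF f(1)] pos, of "- x"] by (simp add: Ltr_Ltr)
  also have "\<dots> \<le> uE E nE (- x) * (uE E nE x * nE f)" using le[OF f] u0 by (intro mult_left_mono) auto
  finally have "1 * nE f \<le> (uE E nE x * uE E nE (- x)) * nE f" by (simp add: ac_simps)
  then have "1 \<le> uE E nE x * uE E nE (- x)" using f(2) by (simp only: mult_le_cancel_right)
  moreover have "uE E nE x * uE E nE (- x) < 1" if "uE E nE x < 1" "uE E nE (- x) < 1"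
    using mult_left_mono[of "uE E nE (- x)" 1 "uE E nE x"] that u0[of x] by simp
  ultimately show ?thesis by (auto simp: le_max_iff_disj not_le[symmetric])
qed

theorem theorem3p5:
  fixes \<mu> :: "'g::{topological_group_add,t2_space} measure"
    and \<Delta> w K :: "'g \<Rightarrow> real"
    and V \<Gamma> :: "'g set"
    and E S :: "('g \<Rightarrow> complex) set"
    and nE :: "('g \<Rightarrow> complex) \<Rightarrow> real"
    and P :: "('g \<Rightarrow> complex) \<Rightarrow> ('g \<Rightarrow> complex)"
    and T :: "'g \<Rightarrow> ('g \<Rightarrow> complex) \<Rightarrow> ('g \<Rightarrow> complex)"
  assumes "lc_sigma_compact TYPE('g)"
    and "left_haar \<mu>"
    and "modular_function \<mu> \<Delta>"
    and "good_nbhd V"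
    and "A1 \<mu> \<Delta> E nE w S"
    and "A2 \<mu> V w E S P K"
    and "well_spread \<mu> V w S \<Gamma> T"
    and "bij_betw (sum_ops \<Gamma> T) S S"
  shows "\<exists>c C. 0 < c \<and> c \<le> C \<and>
           (\<forall>f\<in>S. (\<forall>\<gamma>\<in>\<Gamma>. L2_sq \<mu> (T \<gamma> f) < \<infinity>) \<and>
              Ed_fun V \<Gamma> (\<lambda>\<gamma>. L2_norm \<mu> (T \<gamma> f)) \<in> E \<and>
              c * nE f \<le> nE (Ed_fun V \<Gamma> (\<lambda>\<gamma>. L2_norm \<mu> (T \<gamma> f))) \<and>
              nE (Ed_fun V \<Gamma> (\<lambda>\<gamma>. L2_norm \<mu> (T \<gamma> f))) \<le> C * nE f)"
proof -
  interpret haar_group \<mu> \<Delta> using assms(1-3) by unfold_locales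
  note A1 = assms(5)[unfolded A1_def]
  have BF: "solid_TI_BF_space \<mu> \<Delta> E nE" and adm: "admissible_weight \<Delta> E nE w"
    and wm: "w \<in> borel_measurable borel" and SE: "S \<subseteq> E" and Ssub: "is_subspace S"
    and Scont: "\<forall>s\<in>S. continuous_on UNIV s" and Sclosed: "closed_mod_ae \<mu> E nE S"
    using A1 by - (elim conjE, assumption)+
  have BF': "BF_space \<mu> E nE" and TI: "translation_invariant E nE"
    using BF unfolding solid_TI_BF_space_def by - (elim conjE, assumption)+
  have w_pos: "\<forall>x. w x > 0" and w_sym: "\<forall>x. w x = \<Delta> (- x) * w (- x)" and w_sub: "\<forall>x y. w (x + y) \<le> w x * w y"
    and w_ge: "\<exists>C>0. \<forall>x. w x \<ge> C * max (max (uE E nE x) (uE E nE (- x)))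
                              (max (vE \<Delta> E nE x) (\<Delta> (- x) * vE \<Delta> E nE (- x)))"
    using adm unfolding admissible_weight_def by - (elim conjE, assumption)+
  obtain cw where cw: "0 < cw" and cw_ge: "\<And>x. cw * max (max (uE E nE x) (uE E nE (- x)))
                              (max (vE \<Delta> E nE x) (\<Delta> (- x) * vE \<Delta> E nE (- x))) \<le> w x"
    using w_ge by blast
  note ws = assms(7)[unfolded well_spread_def]
  have T_lin: "\<forall>\<gamma>\<in>\<Gamma>. (\<forall>f\<in>S. T \<gamma> f \<in> S) \<and>
        (\<forall>f\<in>S. \<forall>g\<in>S. T \<gamma> (\<lambda>x. f x + g x) = (\<lambda>x. T \<gamma> f x + T \<gamma> g x)) \<and>
        (\<forall>c. \<forall>f\<in>S. T \<gamma> (\<lambda>x. c * f x) = (\<lambda>x. c * T \<gamma> f x))"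
    by (rule ws[THEN conjunct1])
  have nEnn: "\<forall>f\<in>E. nE f \<ge> 0 \<and> (nE f = 0 \<longleftrightarrow> ae_eq \<mu> f (\<lambda>x. 0))"
    by (rule BF'[unfolded BF_space_def, THEN conjunct2, THEN conjunct2, THEN conjunct1])
  have zeroE: "(\<lambda>x. 0) \<in> E"
    using BF'[unfolded BF_space_def is_subspace_def, THEN conjunct2, THEN conjunct1] by blast
  have nE0: "nE (\<lambda>x. 0) = 0" using nEnn zeroE by (simp add: ae_eq_def)
  show ?thesis
  proof (cases "\<forall>f\<in>E. nE f = 0")
    \<comment> \<open>When the norm vanishes on \<open>E\<close>, all operator norms are 0 and
      admissibility yields no lower bound for \<open>w\<close>. Continuity then forces every element
      of \<open>S\<close> to be 0, and linearity does the same for its images.\<close>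
    case True
    have "(\<forall>\<gamma>\<in>\<Gamma>. L2_sq \<mu> (T \<gamma> f) < \<infinity>) \<and> Ed_fun V \<Gamma> (\<lambda>\<gamma>. L2_norm \<mu> (T \<gamma> f)) = (\<lambda>x. 0) \<and> nE f = 0" if f: "f \<in> S" for f
    proof -
      have fE: "f \<in> E" using f SE by blast
      then have n: "nE f = 0" using True by blast
      then have "AE x in \<mu>. f x = 0" using nEnn fE unfolding ae_eq_def by blast
      then have f0: "f = (\<lambda>x. 0)" using Scont f by (intro continuous_AE_eq) auto
      have T0: "T \<gamma> f = (\<lambda>x. 0)" if "\<gamma> \<in> \<Gamma>" for \<gamma>
      proof -
        have "T \<gamma> (\<lambda>x. 0 * f x) = (\<lambda>x. 0 * T \<gamma> f x)" using T_lin that f by blast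
        then show ?thesis by (simp add: f0)
      qed
      have "Ed_fun V \<Gamma> (\<lambda>\<gamma>. L2_norm \<mu> (T \<gamma> f)) = (\<lambda>x. 0)"
        unfolding Ed_fun_def by (auto simp: T0 L2_norm_def L2_sq_def intro!: sum.neutral)
      moreover have "\<forall>\<gamma>\<in>\<Gamma>. L2_sq \<mu> (T \<gamma> f) < \<infinity>" by (simp add: T0 L2_sq_def)
      ultimately show ?thesis using n by blast
    qed
    then show ?thesis by (intro exI[of _ 1]) (auto simp: zeroE nE0)
  next
    case False
    then obtain f0 where f0: "f0 \<in> E" "0 < nE f0" using nEnn by (metis order_less_le)
    have cw_le: "cw \<le> w x" for x
    proof -
      let ?u = "uE E nE x" and ?u' = "uE E nE (- x)"
      let ?m = "max (max ?u ?u') (max (vE \<Delta> E nE x) (\<Delta> (- x) * vE \<Delta> E nE (- x)))"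
      have "1 \<le> ?m" using max_translation_norm_ge_1[OF BF' TI f0, of x] by (simp add: le_max_iff_disj)
      then have "cw * 1 \<le> cw * ?m" using cw by (intro mult_left_mono) auto
      then show ?thesis using cw_ge[of x] by linarith
    qed
    have cw_v: "cw * vE \<Delta> E nE x \<le> w x" for x
    proof -
      have "cw * vE \<Delta> E nE x \<le> cw * max (max (uE E nE x) (uE E nE (- x)))
                              (max (vE \<Delta> E nE x) (\<Delta> (- x) * vE \<Delta> E nE (- x)))"
        using cw by (intro mult_left_mono) auto
      then show ?thesis using cw_ge[of x] by linarith
    qed
    interpret weighted_group \<mu> \<Delta> V w
    proof unfold_locales
      show "good_nbhd V" by (rule assms(4))
      show "0 < w x" "w x = \<Delta> (- x) * w (- x)" "w (x + y) \<le> w x * w y" for x y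
        using w_pos w_sym w_sub by blast+
    qed (rule wm)
    note A2 = assms(6)[unfolded A2_def Let_def]
    have P_id: "\<forall>s\<in>S. P s = s" and K0: "\<forall>x. K x \<ge> 0" and KW: "K \<in> WR_Linf_L1 \<mu> V w"
      and P_bound: "\<forall>f\<in>W_L1_Linf \<mu> V w \<union> E. \<forall>x. ennreal (cmod (P f x)) \<le> (\<integral>\<^sup>+ y. ennreal (cmod (f y) * K (- y + x)) \<partial>\<mu>)"
      using A2 by - (elim conjE, assumption)+
    obtain \<Theta> and g :: "'g \<Rightarrow> complex" where \<Theta>0: "\<forall>x. \<Theta> x \<ge> 0" and \<Theta>W: "\<Theta> \<in> W_Linf_L1 \<mu> V w"
      and \<Theta>WR: "\<Theta> \<in> WR_Linf_L1 \<mu> V w" and gW: "g \<in> WR_Linf_L1 \<mu> V w"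
      and TB: "\<forall>\<gamma>\<in>\<Gamma>. \<forall>f\<in>S. \<forall>x. ennreal (cmod (T \<gamma> f x)) \<le>
            (\<integral>\<^sup>+ y. ennreal (cmod (g (- \<gamma> + y)) * cmod (f y) * \<Theta> (- y + x)) \<partial>\<mu>)"
      using ws[THEN conjunct2, THEN conjunct2] by (elim exE conjE)
    have reg: "\<exists>k'. k' \<in> borel_measurable borel \<and> (\<forall>x. 0 \<le> k' x) \<and> (AE x in \<mu>. k' x = k x) \<and>
        (wint (env Q k')) < \<infinity>"
      if k: "k \<in> WR_Linf_L1 \<mu> V w" "\<And>x. 0 \<le> k x" for k :: "'g \<Rightarrow> real"
    proof -
      have "k \<in> borel_measurable \<mu>" using k(1) unfolding WR_Linf_L1_def by blast
      then have "k \<in> borel_measurable borel" by simp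
      then show ?thesis
      proof (rule regularise[OF _ k(2)])
        fix k' assume k': "k' \<in> borel_measurable borel" "\<And>x. 0 \<le> k' x"
          "AE x in \<mu>. k' x = k x" "\<And>z. env Q k' z \<le> sharpR \<mu> V k z"
        have "wint (env Q k') \<le> (wint (sharpR \<mu> V k))"
          by (intro nn_integral_mono mult_right_mono k'(4)) simp
        also have "\<dots> < \<infinity>" using k(1) by (simp add: WR_Linf_L1_def)
        finally show ?thesis using k'(1-3) by (intro exI[of _ k'] conjI allI)
      qed
    qed
    obtain K' where K': "K' \<in> borel_measurable borel" "\<And>x. 0 \<le> K' x" "AE x in \<mu>. K' x = K x"
        "wint (env Q K') < \<infinity>"
      using reg[OF KW] K0 by blast
    have "(\<lambda>x. cmod (g x)) \<in> WR_Linf_L1 \<mu> V w"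
      using gW by (auto simp: WR_Linf_L1_def sharpR_def intro: borel_measurable_norm)
    from reg[OF this] obtain g' where g': "g' \<in> borel_measurable borel" "\<And>x. 0 \<le> g' x" "AE x in \<mu>. g' x = cmod (g x)"
        "wint (env Q g') < \<infinity>" by auto
    obtain \<Theta>1 where \<Theta>1[measurable]: "\<Theta>1 \<in> borel_measurable borel" and \<Theta>1': "\<And>x. 0 \<le> \<Theta>1 x" "AE x in \<mu>. \<Theta>1 x = \<Theta> x"
        "wint (env Q \<Theta>1) < \<infinity>"
      using reg[OF \<Theta>WR] \<Theta>0 by blast
    have \<Theta>m: "\<Theta> \<in> borel_measurable \<mu>" and \<Theta>int: "wint (sharpL \<mu> V \<Theta>) < \<infinity>"
      using \<Theta>W by (simp_all add: W_Linf_L1_def)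
    \<comment> \<open>The left-sided condition on \<open>\<Theta>\<close> supplies the essential
      bound, the right-sided one the integrable envelope.\<close>
    obtain B where B: "0 < B" "AE x in \<mu>. \<Theta> x \<le> B"
      using AE_bounded[OF \<Theta>m[unfolded measurable_cong_sets[OF sets_mu refl]] _ \<Theta>int cw cw_le] \<Theta>0 by blast
    \<comment> \<open>Replacing values above \<open>B\<close> by 0 changes a null set only, makes
      the bound hold everywhere, and cannot enlarge the envelope.\<close>
    define \<Theta>' where "\<Theta>' x = (if \<Theta>1 x \<le> B then \<Theta>1 x else 0)" for x
    have \<Theta>'m: "\<Theta>' \<in> borel_measurable borel" unfolding \<Theta>'_def by measurable
    have \<Theta>'0: "0 \<le> \<Theta>' x" "\<Theta>' x \<le> \<Theta>1 x" "\<Theta>' x \<le> B" for x using \<Theta>1' B by (auto simp: \<Theta>'_def)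
    have \<Theta>'ae: "AE x in \<mu>. \<Theta>' x = \<Theta> x" using \<Theta>1'(2) B(2) by eventually_elim (simp add: \<Theta>'_def)
    have "wint (env Q \<Theta>') \<le> (wint (env Q \<Theta>1))"
      using \<Theta>'0 by (intro nn_integral_mono mult_right_mono env_mono) auto
    then have \<Theta>'int: "wint (env Q \<Theta>') < \<infinity>" using \<Theta>1'(3) by (rule le_less_trans)
    interpret spread_family \<mu> \<Delta> V w E nE cw S \<Gamma> T g' \<Theta>' K' B
    proof unfold_locales
      show "solid_TI_BF_space \<mu> \<Delta> E nE" by (rule BF)
      show "0 < cw" "cw \<le> w x" "cw * vE \<Delta> E nE x \<le> w x" for x by (rule cw cw_le cw_v)+
      show "S \<subseteq> E" "is_subspace S" "closed_mod_ae \<mu> E nE S" by (rule SE Ssub Sclosed)+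
      show "continuous_on UNIV f" if "f \<in> S" for f using Scont that by blast
      show "T \<gamma> f \<in> S" if "\<gamma> \<in> \<Gamma>" "f \<in> S" for \<gamma> f using T_lin that by blast
      show "T \<gamma> (\<lambda>x. f x + f' x) = (\<lambda>x. T \<gamma> f x + T \<gamma> f' x)" if "\<gamma> \<in> \<Gamma>" "f \<in> S" "f' \<in> S" for \<gamma> f f'
        using T_lin that by blast
      show "T \<gamma> (\<lambda>x. c * f x) = (\<lambda>x. c * T \<gamma> f x)" if "\<gamma> \<in> \<Gamma>" "f \<in> S" for \<gamma> f c using T_lin that by blast
      show "rel_separated V \<Gamma>" by (rule ws[THEN conjunct2, THEN conjunct1])
      show "g' \<in> borel_measurable borel" "0 \<le> g' x" "\<Theta>' \<in> borel_measurable borel" "0 \<le> \<Theta>' x"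
        "K' \<in> borel_measurable borel" "\<Theta>' x \<le> B" for x
        by (rule g' \<Theta>'m \<Theta>'0 K')+
      show "wint (env Q g') < \<infinity>" "wint (env Q \<Theta>') < \<infinity>"
        "wint (env Q K') < \<infinity>" by (rule g' \<Theta>'int K')+
      show "bij_betw (sum_ops \<Gamma> T) S S" by (rule assms(8))
      show "ennreal (cmod (T \<gamma> f x)) \<le> (\<integral>\<^sup>+ y. ennreal (g' (- \<gamma> + y)) * ennreal (cmod (f y)) * ennreal (\<Theta>' (- y + x)) \<partial>\<mu>)"
        if "\<gamma> \<in> \<Gamma>" "f \<in> S" for \<gamma> f x
      proof -
        have "ennreal (cmod (T \<gamma> f x)) \<le> (\<integral>\<^sup>+ y. ennreal (cmod (g (- \<gamma> + y)) * cmod (f y) * \<Theta> (- y + x)) \<partial>\<mu>)"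
          using TB that by blast
        also have "\<dots> = (\<integral>\<^sup>+ y. ennreal (g' (- \<gamma> + y)) * ennreal (cmod (f y)) * ennreal (\<Theta>' (- y + x)) \<partial>\<mu>)"
        proof (rule nn_integral_cong_AE)
          show "AE y in \<mu>. ennreal (cmod (g (- \<gamma> + y)) * cmod (f y) * \<Theta> (- y + x)) = ennreal (g' (- \<gamma> + y)) * ennreal (cmod (f y)) * ennreal (\<Theta>' (- y + x))"
            using AE_add_left[OF g'(3), of "- \<gamma>"] AE_minus_add[OF \<Theta>'ae, of x]
          proof eventually_elim
            case (elim y)
            show ?case unfolding elim using \<Theta>0 by (simp add: ennreal_mult)
          qed
        qed
        finally show ?thesis .
      qed
      show "ennreal (cmod (f x)) \<le> nconv \<mu> f (\<lambda>z. ennreal (K' z)) x" if f: "f \<in> S" for f x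
      proof -
        have "ennreal (cmod (f x)) = ennreal (cmod (P f x))" using P_id f by simp
        also have "\<dots> \<le> (\<integral>\<^sup>+ y. ennreal (cmod (f y) * K (- y + x)) \<partial>\<mu>)" using P_bound f SE by blast
        also have "\<dots> = nconv \<mu> f (\<lambda>z. ennreal (K' z)) x"
          unfolding nconv_def
        proof (rule nn_integral_cong_AE)
          show "AE y in \<mu>. ennreal (cmod (f y) * K (- y + x)) = ennreal (cmod (f y)) * ennreal (K' (- y + x))"
            using AE_minus_add[OF K'(3), of x]
          proof eventually_elim
            case (elim y)
            show ?case unfolding elim using K0 by (simp add: ennreal_mult)
          qed
        qed
        finally show ?thesis .
      qed
    qed
    obtain C where C: "0 < C" "\<And>f \<gamma>. f \<in> S \<Longrightarrow> \<gamma> \<in> \<Gamma> \<Longrightarrow> L2_sq \<mu> (T \<gamma> f) < \<infinity>"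
      "\<And>f. f \<in> S \<Longrightarrow> EdT f \<in> E"
      "\<And>f. f \<in> S \<Longrightarrow> nE (EdT f) \<le> C * nE f"
      using upper_bound by blast
    obtain c where c: "0 < c" "\<And>f. f \<in> S \<Longrightarrow> c * nE f \<le> nE (EdT f)"
      using lower_bound by blast
    \<comment> \<open>The maximum secures \<open>c \<le> C\<close>, which the two estimates force by
      themselves only if \<open>S\<close> has an element of nonzero norm.\<close>
    have "nE (EdT f) \<le> max c C * nE f" if f: "f \<in> S" for f
    proof -
      have "C * nE f \<le> max c C * nE f" using f SE nE_nonneg by (intro mult_right_mono) auto
      then show ?thesis using C(4)[OF f] by linarith
    qed
    then show ?thesis using c C by (intro exI[of _ c] exI[of _ "max c C"]) auto
  qed
qed

end
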